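(* Let $R$ be a one-dimensional local Noetherian ring with finite residue field $k$, and let $n$ be a positive integer. Then every ideal of $R$ has an $n$-generated reduction if and only if $$|\operatorname{Max}(\overline{R_{red}})| \leq \frac{|k|^{n+1}-|k|}{|k|-1}.$$
   Context: A reduction of an ideal $I$ is an ideal $J\subseteq I$ such that $I^{m+1}=JI^m$ for some $m>0$; it is $n$-generated if it can be generated by $n$ elements. $R_{red}=R/\sqrt{0}$, $\overline{A}$ is the integral closure of a ring $A$ in its total quotient ring, and $\operatorname{Max}(A)$ is the set of maximal ideals of $A$. *)

theory Defs
  imports "HOL-Algebra.Ideal_Product" "HOL-Algebra.Ring_Divisibility"
begin

definition local_ring :: "('a, 'b) ring_scheme \<Rightarrow> bool" where
  "local_ring R \<longleftrightarrow> cring R \<and> (\<exists>!M. maximalideal M R)"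

definition prime_chain :: "('a, 'b) ring_scheme \<Rightarrow> (nat \<Rightarrow> 'a set) \<Rightarrow> nat \<Rightarrow> bool" where
  "prime_chain R P k \<longleftrightarrow> (\<forall>i\<le>k. primeideal (P i) R) \<and> (\<forall>i<k. P i \<subset> P (Suc i))"

definition krull_dim_eq :: "('a, 'b) ring_scheme \<Rightarrow> nat \<Rightarrow> bool" where
  "krull_dim_eq R d \<longleftrightarrow> (\<exists>P. prime_chain R P d) \<and> \<not> (\<exists>P. prime_chain R P (Suc d))"

fun ideal_pow :: "('a, 'b) ring_scheme \<Rightarrow> 'a set \<Rightarrow> nat \<Rightarrow> 'a set" where
  "ideal_pow R I 0 = carrier R"
| "ideal_pow R I (Suc m) = ideal_prod R I (ideal_pow R I m)"

definition reduction :: "('a, 'b) ring_scheme \<Rightarrow> 'a set \<Rightarrow> 'a set \<Rightarrow> bool" where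
  "reduction R J I \<longleftrightarrow> ideal J R \<and> J \<subseteq> I \<and>
     (\<exists>m>0. ideal_pow R I (m + 1) = ideal_prod R J (ideal_pow R I m))"

definition n_generated :: "('a, 'b) ring_scheme \<Rightarrow> nat \<Rightarrow> 'a set \<Rightarrow> bool" where
  "n_generated R n J \<longleftrightarrow> (\<exists>S. S \<subseteq> carrier R \<and> finite S \<and> card S \<le> n \<and> J = Idl\<^bsub>R\<^esub> S)"

definition nilradical :: "('a, 'b) ring_scheme \<Rightarrow> 'a set" where
  "nilradical R = {a \<in> carrier R. \<exists>k::nat. a [^]\<^bsub>R\<^esub> k = \<zero>\<^bsub>R\<^esub>}"

definition reduced_ring :: "('a, 'b) ring_scheme \<Rightarrow> 'a set ring" where
  "reduced_ring R = R Quot (nilradical R)"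

definition nonzerodivisors :: "('a, 'b) ring_scheme \<Rightarrow> 'a set" where
  "nonzerodivisors R = {s \<in> carrier R. \<forall>a \<in> carrier R. s \<otimes>\<^bsub>R\<^esub> a = \<zero>\<^bsub>R\<^esub> \<longrightarrow> a = \<zero>\<^bsub>R\<^esub>}"

definition frac_rel :: "('a, 'b) ring_scheme \<Rightarrow> (('a \<times> 'a) \<times> ('a \<times> 'a)) set" where
  "frac_rel R = {((a, s), (b, t)). a \<in> carrier R \<and> b \<in> carrier R \<and>
      s \<in> nonzerodivisors R \<and> t \<in> nonzerodivisors R \<and> a \<otimes>\<^bsub>R\<^esub> t = b \<otimes>\<^bsub>R\<^esub> s}"

definition frac_class :: "('a, 'b) ring_scheme \<Rightarrow> 'a \<Rightarrow> 'a \<Rightarrow> ('a \<times> 'a) set" where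
  "frac_class R a s = frac_rel R `` {(a, s)}"

definition frac_mult :: "('a, 'b) ring_scheme \<Rightarrow> ('a \<times> 'a) set \<Rightarrow> ('a \<times> 'a) set \<Rightarrow> ('a \<times> 'a) set" where
  "frac_mult R U V = frac_rel R ``
     {p. \<exists>a s b t. p = (a \<otimes>\<^bsub>R\<^esub> b, s \<otimes>\<^bsub>R\<^esub> t) \<and> (a, s) \<in> U \<and> (b, t) \<in> V}"

definition frac_add :: "('a, 'b) ring_scheme \<Rightarrow> ('a \<times> 'a) set \<Rightarrow> ('a \<times> 'a) set \<Rightarrow> ('a \<times> 'a) set" where
  "frac_add R U V = frac_rel R ``
     {p. \<exists>a s b t. p = ((a \<otimes>\<^bsub>R\<^esub> t) \<oplus>\<^bsub>R\<^esub> (b \<otimes>\<^bsub>R\<^esub> s), s \<otimes>\<^bsub>R\<^esub> t) \<and> (a, s) \<in> U \<and> (b, t) \<in> V}"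

definition total_quotient_ring :: "('a, 'b) ring_scheme \<Rightarrow> ('a \<times> 'a) set ring" where
  "total_quotient_ring R =
     \<lparr> carrier = {frac_class R a s | a s. a \<in> carrier R \<and> s \<in> nonzerodivisors R},
       Group.monoid.mult = frac_mult R,
       one = frac_class R \<one>\<^bsub>R\<^esub> \<one>\<^bsub>R\<^esub>,
       zero = frac_class R \<zero>\<^bsub>R\<^esub> \<one>\<^bsub>R\<^esub>,
       add = frac_add R \<rparr>"

definition frac_map :: "('a, 'b) ring_scheme \<Rightarrow> 'a \<Rightarrow> ('a \<times> 'a) set" where
  "frac_map R a = frac_class R a \<one>\<^bsub>R\<^esub>"

definition integral_over :: "('a, 'b) ring_scheme \<Rightarrow> ('a \<times> 'a) set \<Rightarrow> bool" where
  "integral_over R x \<longleftrightarrow> x \<in> carrier (total_quotient_ring R) \<and>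
     (\<exists>n::nat. n \<ge> 1 \<and> (\<exists>c::nat \<Rightarrow> 'a. (\<forall>i<n. c i \<in> carrier R) \<and>
        x [^]\<^bsub>total_quotient_ring R\<^esub> n \<oplus>\<^bsub>total_quotient_ring R\<^esub>
          (\<Oplus>\<^bsub>total_quotient_ring R\<^esub> i\<in>{..<n}.
              frac_map R (c i) \<otimes>\<^bsub>total_quotient_ring R\<^esub> x [^]\<^bsub>total_quotient_ring R\<^esub> i)
        = \<zero>\<^bsub>total_quotient_ring R\<^esub>))"

definition integral_closure :: "('a, 'b) ring_scheme \<Rightarrow> ('a \<times> 'a) set ring" where
  "integral_closure R = (total_quotient_ring R) \<lparr> carrier := {x. integral_over R x} \<rparr>"

definition Max_spec :: "('a, 'b) ring_scheme \<Rightarrow> 'a set set" where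
  "Max_spec A = {M. maximalideal M A}"

end

theory Submission
  imports Defs "HOL-Algebra.Subrings"
begin

text \<open>
  Write \<open>A = R\<^sub>r\<^sub>e\<^sub>d\<close>, \<open>S\<close> for its total quotient ring, \<open>B\<close> for the integral closure of \<open>A\<close> in \<open>S\<close>,
  and \<open>q = |k|\<close>. Since \<open>A\<close> is Noetherian, \<open>y \<in> S\<close> is integral iff all its powers have a common
  denominator, and this description is used for \<open>B\<close> throughout.

  \<^emph>\<open>Necessity.\<close> If \<open>B\<close> has \<open>1 + q + \<dots> + q\<^sup>n\<close> maximal ideals \<open>M\<^sub>\<lambda>\<close>, index them by the points \<open>\<lambda>\<close> of
  projective \<open>n\<close>-space over \<open>k\<close> and choose \<open>x\<^sub>0, \<dots>, x\<^sub>n \<in> B\<close> with \<open>x\<^sub>i \<equiv> \<lambda>\<^sub>i\<close> modulo \<open>M\<^sub>\<lambda>\<close>. After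
  clearing denominators they generate an ideal \<open>I\<close> of \<open>R\<close>. Any \<open>n\<close> elements of \<open>I\<close> are linear
  combinations whose coefficient vectors are orthogonal to some \<open>\<lambda>\<close>, so the ideal they generate is
  contained in \<open>M\<^sub>\<lambda> I\<close> and cannot be a reduction.

  \<^emph>\<open>Sufficiency.\<close> Because \<open>A/aA\<close> is finite for every regular \<open>a\<close>, counting shows that every
  \<open>y \<in> S\<close> is a root of a polynomial over \<open>A\<close> with a unit coefficient; hence \<open>B\<close> behaves like a
  valuation ring at each maximal ideal \<open>M\<close>, and \<open>I\<close> becomes principal there, say \<open>w\<^sub>M I \<subseteq> B\<close> and
  \<open>w\<^sub>M I \<not>\<subseteq> M\<close> (or \<open>I\<close> vanishes at \<open>M\<close>). An ideal \<open>J \<subseteq> I\<close> with \<open>w\<^sub>M J \<not>\<subseteq> M\<close> for all \<open>M\<close> satisfies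
  \<open>JB = IB\<close> and is therefore a reduction. Each \<open>M\<close> excludes at most one of the \<open>1 + q + \<dots> + q\<^sup>e\<close>
  hyperplanes in the span of \<open>e + 1\<close> generators, so as long as \<open>e \<ge> n\<close> the number of generators can
  be lowered without violating any of the at most \<open>q + \<dots> + q\<^sup>n\<close> conditions.
\<close>

text \<open>Over a finite residue field a general linear combination of generators need not exist;
  the theorem measures how many local conditions a linear combination can still meet. The bound
  \<open>(q^(n+1) - q)/(q - 1)\<close> is one less than the number of points of projective
  \<open>n\<close>-space, so \<open>n\<close> generators stop sufficing once the points can be
  embedded into the set of maximal ideals.

  The integral closure is not known in advance to be finite over \<open>A\<close>, Noetherian or
  semilocal, and \<open>A\<close> need not be a domain. Therefore no structure theory of Dedekind
  rings is invoked: local principality comes from counting classes modulo powers of a regular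
  element, and zero divisors are split off by idempotents. Modules over the closure are replaced by
  ideals of \<open>R\<close> that contain a regular element and are preserved by finitely many
  integral elements; being finitely generated, they admit a Cayley-Hamilton argument. For reductions
  this argument is homogeneous, with lower terms in \<open>J I^(k-1)\<close>, so it yields
  \<open>x^t\<close> in \<open>J I^(t-1)\<close> up to a nilpotent, which is removed by passing to a
  higher power.\<close>

context cring
begin

section \<open>Normal forms for ring identities\<close>

lemma add_cancel_0:
  "x \<in> carrier R \<Longrightarrow> x \<oplus> \<ominus> x = \<zero>"
  by (simp add: r_neg)

lemma add_cancel_0t:
  "x \<in> carrier R \<Longrightarrow> z \<in> carrier R \<Longrightarrow> x \<oplus> (\<ominus> x \<oplus> z) = z"
  by (simp add: r_neg2 r_neg1)

lemma add_cancel_1: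
  "x \<in> carrier R \<Longrightarrow> y0 \<in> carrier R \<Longrightarrow> x \<oplus> (y0 \<oplus> \<ominus> x) = y0"
  by (simp add: a_lcomm[of x y0] add_cancel_0)

lemma add_cancel_1t:
  "x \<in> carrier R \<Longrightarrow> y0 \<in> carrier R \<Longrightarrow> z \<in> carrier R \<Longrightarrow> x \<oplus> (y0 \<oplus> (\<ominus> x \<oplus> z)) = y0 \<oplus> z"
  by (simp add: a_lcomm[of x y0] add_cancel_0t)

lemma add_cancel_2:
  "x \<in> carrier R \<Longrightarrow> y0 \<in> carrier R \<Longrightarrow> y1 \<in> carrier R \<Longrightarrow> x \<oplus> (y0 \<oplus> (y1 \<oplus> \<ominus> x)) = y0 \<oplus> y1"
  by (simp add: a_lcomm[of x y0] add_cancel_1)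

lemma add_cancel_2t:
  "x \<in> carrier R \<Longrightarrow> y0 \<in> carrier R \<Longrightarrow> y1 \<in> carrier R \<Longrightarrow> z \<in> carrier R \<Longrightarrow> x \<oplus> (y0 \<oplus> (y1 \<oplus> (\<ominus> x \<oplus> z))) = y0 \<oplus> (y1 \<oplus> z)"
  by (simp add: a_lcomm[of x y0] add_cancel_1t)

lemma add_cancel_3:
  "x \<in> carrier R \<Longrightarrow> y0 \<in> carrier R \<Longrightarrow> y1 \<in> carrier R \<Longrightarrow> y2 \<in> carrier R \<Longrightarrow> x \<oplus> (y0 \<oplus> (y1 \<oplus> (y2 \<oplus> \<ominus> x))) = y0 \<oplus> (y1 \<oplus> y2)"
  by (simp add: a_lcomm[of x y0] add_cancel_2)

lemma add_cancel_3t: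
  "x \<in> carrier R \<Longrightarrow> y0 \<in> carrier R \<Longrightarrow> y1 \<in> carrier R \<Longrightarrow> y2 \<in> carrier R \<Longrightarrow> z \<in> carrier R \<Longrightarrow> x \<oplus> (y0 \<oplus> (y1 \<oplus> (y2 \<oplus> (\<ominus> x \<oplus> z)))) = y0 \<oplus> (y1 \<oplus> (y2 \<oplus> z))"
  by (simp add: a_lcomm[of x y0] add_cancel_2t)

text \<open>AC rewriting does not bring \<open>x\<close> and \<open>\<ominus> x\<close> next to each other, hence the cancellation rules
  across several summands.\<close>

lemmas ring_nf = a_minus_def l_distr r_distr minus_add l_minus r_minus a_ac m_ac
  add_cancel_0 add_cancel_0t add_cancel_1 add_cancel_1t add_cancel_2 add_cancel_2t add_cancel_3 add_cancel_3t

section \<open>Ideals and maximal ideals of a commutative ring\<close>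

lemma ideal_criterion:
  assumes "B \<subseteq> carrier R" "\<zero> \<in> B"
    and add: "\<And>a b. a \<in> B \<Longrightarrow> b \<in> B \<Longrightarrow> a \<oplus> b \<in> B"
    and mult: "\<And>a r. a \<in> B \<Longrightarrow> r \<in> carrier R \<Longrightarrow> r \<otimes> a \<in> B"
  shows "ideal B R"
proof (rule idealI)
  show "ring R" by (rule ring_axioms)
  show "subgroup B (add_monoid R)"
  proof (rule add.subgroupI)
    fix a assume a: "a \<in> B"
    then have "(\<ominus> \<one>) \<otimes> a \<in> B" by (intro mult) auto
    then show "\<ominus> a \<in> B" using a assms(1) by (simp add: l_minus subset_eq)
  qed (use assms in auto)
qed (use assms in \<open>auto simp: m_comm subset_eq\<close>)

lemma ideal_zero_mem: "ideal B R \<Longrightarrow> \<zero> \<in> B"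
  by (simp add: additive_subgroup.zero_closed ideal.axioms(1))

lemma ideal_add_mem: "ideal B R \<Longrightarrow> a \<in> B \<Longrightarrow> b \<in> B \<Longrightarrow> a \<oplus> b \<in> B"
  by (simp add: additive_subgroup.a_closed ideal.axioms(1))

lemma ideal_minus_mem: "ideal B R \<Longrightarrow> a \<in> B \<Longrightarrow> b \<in> B \<Longrightarrow> a \<ominus> b \<in> B"
  unfolding a_minus_def
  by (simp add: additive_subgroup.a_closed additive_subgroup.a_inv_closed ideal.axioms(1))

lemma ideal_mult_mem: "ideal B R \<Longrightarrow> a \<in> B \<Longrightarrow> r \<in> carrier R \<Longrightarrow> r \<otimes> a \<in> B"
  by (rule ideal.I_l_closed)

lemma ideal_mult_mem': "ideal B R \<Longrightarrow> a \<in> B \<Longrightarrow> r \<in> carrier R \<Longrightarrow> a \<otimes> r \<in> B"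
  by (rule ideal.I_r_closed)

lemma ideal_sub: "ideal B R \<Longrightarrow> B \<subseteq> carrier R"
  by (auto intro: ideal.Icarr)

lemma ideal_mem_of_minus_mem:
  assumes "ideal B R" "a \<ominus> b \<in> B" "b \<in> B" "a \<in> carrier R"
  shows "a \<in> B"
proof -
  have b: "b \<in> carrier R" using assms ideal_sub by blast
  have "a = (a \<ominus> b) \<oplus> b" using assms(4) b by (simp add: ring_nf)
  then show ?thesis using ideal_add_mem[OF assms(1-3)] by simp
qed

definition adjoin :: "'a set \<Rightarrow> 'a \<Rightarrow> 'a set" where
  "adjoin B x = {b \<oplus> r \<otimes> x |b r. b \<in> B \<and> r \<in> carrier R}"

lemma adjoin_ideal:
  assumes B: "ideal B R" and x: "x \<in> carrier R"
  shows "ideal (adjoin B x) R"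
proof (rule ideal_criterion)
  note Bc = subsetD[OF ideal_sub[OF B]]
  show "adjoin B x \<subseteq> carrier R" using Bc x by (auto simp: adjoin_def)
  have "\<zero> = \<zero> \<oplus> \<zero> \<otimes> x" using x by simp
  then show "\<zero> \<in> adjoin B x" using ideal_zero_mem[OF B] unfolding adjoin_def by blast
next
  note Bc = subsetD[OF ideal_sub[OF B]]
  fix a b assume "a \<in> adjoin B x" "b \<in> adjoin B x"
  then obtain u v r s where uv: "u \<in> B" "v \<in> B" and rs: "r \<in> carrier R" "s \<in> carrier R"
    and ab: "a = u \<oplus> r \<otimes> x" "b = v \<oplus> s \<otimes> x" unfolding adjoin_def by blast
  have uvc: "u \<in> carrier R" "v \<in> carrier R" using uv Bc by auto
  have "a \<oplus> b = (u \<oplus> v) \<oplus> (r \<oplus> s) \<otimes> x" unfolding ab using uvc rs x by (simp add: ring_nf)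
  then show "a \<oplus> b \<in> adjoin B x"
    using ideal_add_mem[OF B uv] rs unfolding adjoin_def by blast
next
  note Bc = subsetD[OF ideal_sub[OF B]]
  fix a t assume "a \<in> adjoin B x" and t: "t \<in> carrier R"
  then obtain u r where u: "u \<in> B" and r: "r \<in> carrier R"
    and a: "a = u \<oplus> r \<otimes> x" unfolding adjoin_def by blast
  have uc: "u \<in> carrier R" using u Bc by auto
  have "t \<otimes> a = (t \<otimes> u) \<oplus> (t \<otimes> r) \<otimes> x" unfolding a using uc r x t by (simp add: ring_nf)
  then show "t \<otimes> a \<in> adjoin B x"
    using ideal_mult_mem[OF B u t] r t unfolding adjoin_def by blast
qed

lemma adjoin_supset: "ideal B R \<Longrightarrow> x \<in> carrier R \<Longrightarrow> B \<subseteq> adjoin B x"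
proof
  fix b assume B: "ideal B R" "x \<in> carrier R" "b \<in> B"
  then have "b = b \<oplus> \<zero> \<otimes> x" using subsetD[OF ideal_sub] by simp
  then show "b \<in> adjoin B x" using B unfolding adjoin_def by blast
qed

lemma adjoin_mem: "ideal B R \<Longrightarrow> x \<in> carrier R \<Longrightarrow> x \<in> adjoin B x"
proof -
  assume B: "ideal B R" "x \<in> carrier R"
  then have "x = \<zero> \<oplus> \<one> \<otimes> x" by auto
  then show "x \<in> adjoin B x" using ideal_zero_mem[OF B(1)] unfolding adjoin_def by blast
qed

text \<open>The field property of \<open>R/M\<close> in terms of elements, so that no quotient ring
  has to be formed.\<close>

lemma maximalideal_inverse_mod:
  assumes M: "maximalideal M R" and x: "x \<in> carrier R" "x \<notin> M"
  obtains r where "r \<in> carrier R" "r \<otimes> x \<ominus> \<one> \<in> M"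
proof -
  have MI: "ideal M R" using M by (rule maximalideal.axioms)
  have "adjoin M x = carrier R"
    using maximalideal.I_maximal[OF M adjoin_ideal[OF MI x(1)]]
      adjoin_supset[OF MI x(1)] adjoin_mem[OF MI x(1)] x(2) ideal_sub[OF adjoin_ideal[OF MI x(1)]]
    by blast
  then have "\<one> \<in> adjoin M x" by simp
  then obtain b r where b: "b \<in> M" and r: "r \<in> carrier R" and e: "\<one> = b \<oplus> r \<otimes> x"
    unfolding adjoin_def by blast
  have bc: "b \<in> carrier R" using b ideal_sub[OF MI] by auto
  have "r \<otimes> x \<ominus> \<one> = \<ominus> b" unfolding e using bc r x by (simp add: ring_nf)
  then have "r \<otimes> x \<ominus> \<one> \<in> M"
    using b MI by (simp add: additive_subgroup.a_inv_closed ideal.axioms(1))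
  with r show thesis by (rule that)
qed

text \<open>Proved by Zorn's lemma without a chain condition, because it is also applied to the
  integral closure, whose Noetherianity is not established.\<close>

lemma exists_maximalideal_supset:
  assumes B: "ideal B R" "\<one> \<notin> B"
  shows "\<exists>M. maximalideal M R \<and> B \<subseteq> M"
proof -
  define F where "F = {I. ideal I R \<and> \<one> \<notin> I \<and> B \<subseteq> I}"
  have "\<exists>M\<in>F. \<forall>X\<in>F. M \<subseteq> X \<longrightarrow> X = M"
  proof (rule subset_Zorn_nonempty)
    show "F \<noteq> {}" using B by (auto simp: F_def)
    fix C assume C: "C \<noteq> {}" "subset.chain F C"
    have sub: "C \<subseteq> F" using C(2) by (simp add: subset.chain_def)
    have tot: "X \<subseteq> Y \<or> Y \<subseteq> X" if "X \<in> C" "Y \<in> C" for X Y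
      using C(2) that unfolding subset.chain_def by blast
    have id: "ideal X R" "\<one> \<notin> X" "B \<subseteq> X" if "X \<in> C" for X using sub that by (auto simp: F_def)
    have "ideal (\<Union>C) R"
    proof (rule ideal_criterion)
      show "\<Union>C \<subseteq> carrier R" using ideal_sub[OF id(1)] by blast
      show "\<zero> \<in> \<Union>C" using ideal_zero_mem[OF id(1)] C(1) by blast
    next
      fix a b assume "a \<in> \<Union>C" "b \<in> \<Union>C"
      then obtain X where "X \<in> C" "a \<in> X" "b \<in> X" using tot by blast
      then show "a \<oplus> b \<in> \<Union>C" using ideal_add_mem[OF id(1)] by blast
    next
      fix a r assume "a \<in> \<Union>C" "r \<in> carrier R"
      then show "r \<otimes> a \<in> \<Union>C" using ideal_mult_mem[OF id(1)] by blast
    qed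
    moreover have "\<one> \<notin> \<Union>C" "B \<subseteq> \<Union>C" using id(2,3) C(1) by blast+
    ultimately show "\<Union>C \<in> F" by (simp add: F_def)
  qed
  then obtain M where M: "M \<in> F" and max: "\<And>X. X \<in> F \<Longrightarrow> M \<subseteq> X \<Longrightarrow> X = M" by blast
  have MI: "ideal M R" using M by (simp add: F_def)
  have "maximalideal M R"
  proof (rule maximalidealI[OF MI])
    show "carrier R \<noteq> M" using M by (auto simp: F_def)
    fix J assume J: "ideal J R" "M \<subseteq> J" "J \<subseteq> carrier R"
    show "J = M \<or> J = carrier R"
    proof (cases "\<one> \<in> J")
      case True
      then show ?thesis using J ideal.one_imp_carrier by blast
    next
      case False
      then have "J \<in> F" using J M by (auto simp: F_def)
      then show ?thesis using max J by blast
    qed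
  qed
  then show ?thesis using M by (auto simp: F_def)
qed

end

text \<open>A nonempty chain of ideals in a Noetherian ring contains its own union, so Zorn's lemma
  applies to any family of ideals, whatever property defines it.\<close>

lemma (in noetherian_ring) exists_maximal_in_family:
  assumes "F \<noteq> {}" "\<And>I. I \<in> F \<Longrightarrow> ideal I R"
  obtains M where "M \<in> F" "\<And>X. X \<in> F \<Longrightarrow> M \<subseteq> X \<Longrightarrow> X = M"
proof -
  have "\<exists>M\<in>F. \<forall>X\<in>F. M \<subseteq> X \<longrightarrow> X = M"
  proof (rule subset_Zorn_nonempty[OF assms(1)])
    fix C assume C: "C \<noteq> {}" "subset.chain F C"
    then have "C \<subseteq> F" by (simp add: subset_chain_def)
    then have "C \<subseteq> {I. ideal I R}" using assms(2) by auto
    then have "subset.chain {I. ideal I R} C" using C(2) by (simp add: subset_chain_def)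
    then have "\<Union>C \<in> C" by (rule ideal_chain_is_trivial[OF C(1)])
    then show "\<Union>C \<in> F" using \<open>C \<subseteq> F\<close> by auto
  qed
  then show thesis using that by blast
qed

context cring
begin

subsection \<open>Ideal powers and reductions\<close>

lemma ideal_prod_mono: "A \<subseteq> A' \<Longrightarrow> B \<subseteq> B' \<Longrightarrow> A \<cdot> B \<subseteq> A' \<cdot> B'"
proof
  fix x assume "A \<subseteq> A'" "B \<subseteq> B'" "x \<in> A \<cdot> B"
  from this(3,1,2) show "x \<in> A' \<cdot> B'"
    by (induct rule: ideal_prod.induct) (auto intro: ideal_prod.intros)
qed

lemma ideal_prod_subset:
  assumes "ideal C R" "\<And>a b. a \<in> A \<Longrightarrow> b \<in> B \<Longrightarrow> a \<otimes> b \<in> C"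
  shows "A \<cdot> B \<subseteq> C"
proof
  fix x assume "x \<in> A \<cdot> B"
  then show "x \<in> C"
    by (induct rule: ideal_prod.induct) (auto intro: assms ideal_add_mem[OF assms(1)])
qed

lemma ideal_pow_ideal: "ideal I R \<Longrightarrow> ideal (ideal_pow R I k) R"
  by (induct k) (simp_all add: oneideal ideal_prod_is_ideal)

lemma ideal_pow_mem: "ideal I R \<Longrightarrow> x \<in> I \<Longrightarrow> x [^] (k::nat) \<in> ideal_pow R I k"
proof (induct k)
  case (Suc k)
  then have "x \<in> carrier R" using ideal_sub by blast
  then have "x [^] Suc k = x \<otimes> x [^] k" by (simp add: m_comm)
  then show ?case using Suc by (auto intro: ideal_prod.prod)
qed simp

lemma ideal_pow_mult_mem:
  assumes I: "ideal I R"
  shows "a \<in> ideal_pow R I j \<Longrightarrow> b \<in> ideal_pow R I k \<Longrightarrow> a \<otimes> b \<in> ideal_pow R I (j + k)"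
proof (induct j arbitrary: a)
  case 0
  then show ?case using ideal_mult_mem[OF ideal_pow_ideal[OF I]] by simp
next
  case (Suc j)
  have bc: "b \<in> carrier R" using Suc.prems(2) ideal_sub[OF ideal_pow_ideal[OF I]] by blast
  have pc: "ideal_pow R I j \<subseteq> carrier R" using ideal_sub[OF ideal_pow_ideal[OF I]] .
  have Ic: "I \<subseteq> carrier R" using ideal_sub[OF I] .
  have "a \<in> I \<cdot> ideal_pow R I j" using Suc.prems(1) by simp
  then show ?case
  proof (induct rule: ideal_prod.induct)
    case (prod u v)
    have "u \<otimes> v \<otimes> b = u \<otimes> (v \<otimes> b)" using prod bc pc Ic by (simp add: m_assoc subset_eq)
    then show ?case using Suc.hyps[OF prod(2) Suc.prems(2)] prod(1) by (auto intro: ideal_prod.prod)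
  next
    case (sum s t)
    have st: "s \<in> carrier R" "t \<in> carrier R"
      using sum ideal_prod_in_carrier[OF I ideal_pow_ideal[OF I]] by auto
    have "(s \<oplus> t) \<otimes> b = s \<otimes> b \<oplus> t \<otimes> b" using st bc by (simp add: l_distr)
    then show ?case using sum by (auto intro: ideal_prod.sum)
  qed
qed

text \<open>Only meaningful for \<^term>\<open>k \<ge> 1\<close>.\<close>

definition red_deg :: "'a set \<Rightarrow> 'a set \<Rightarrow> nat \<Rightarrow> 'a set" where
  "red_deg J I k = J \<cdot> ideal_pow R I (k - 1)"

lemma red_deg_ideal: "ideal I R \<Longrightarrow> ideal J R \<Longrightarrow> ideal (red_deg J I k) R"
  unfolding red_deg_def by (simp add: ideal_prod_is_ideal ideal_pow_ideal)

text \<open>In the Rees algebra of \<open>I\<close>, the sets \<open>red_deg J I k\<close> are the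
  graded pieces of the ideal generated by \<open>J\<close> placed in degree one; this is its
  compatibility with multiplication by the graded pieces \<open>I^l\<close>.\<close>

lemma red_deg_pow_mult:
  assumes I: "ideal I R" and J: "ideal J R" and k: "k \<ge> 1"
    and a: "a \<in> red_deg J I k" and b: "b \<in> ideal_pow R I l"
  shows "a \<otimes> b \<in> red_deg J I (k + l)"
proof -
  have bc: "b \<in> carrier R" using b ideal_sub[OF ideal_pow_ideal[OF I]] by blast
  show ?thesis using a unfolding red_deg_def
  proof (induct rule: ideal_prod.induct)
    case (prod u v)
    then have "u \<in> carrier R" "v \<in> carrier R" using ideal_sub J ideal_pow_ideal[OF I] by blast+
    then have e: "u \<otimes> v \<otimes> b = u \<otimes> (v \<otimes> b)" using bc by (simp add: m_assoc)
    have "v \<otimes> b \<in> ideal_pow R I (k - 1 + l)" by (rule ideal_pow_mult_mem[OF I prod(2) b])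
    moreover have "k - 1 + l = k + l - 1" using k by simp
    ultimately show ?case unfolding e using prod by (auto intro: ideal_prod.prod)
  next
    case (sum s t)
    have "s \<in> carrier R" "t \<in> carrier R"
      using sum ideal_prod_in_carrier[OF J ideal_pow_ideal[OF I]] by auto
    then have "(s \<oplus> t) \<otimes> b = s \<otimes> b \<oplus> t \<otimes> b" using bc by (simp add: l_distr)
    then show ?case using sum by (auto intro: ideal_prod.sum)
  qed
qed

lemma red_deg_subset_pow:
  assumes I: "ideal I R" and J: "J \<subseteq> I" and k: "k \<ge> 1"
  shows "red_deg J I k \<subseteq> ideal_pow R I k"
proof -
  have "k = Suc (k - 1)" using k by simp
  then have "ideal_pow R I k = I \<cdot> ideal_pow R I (k - 1)" by (metis ideal_pow.simps(2))
  then show ?thesis unfolding red_deg_def using ideal_prod_mono[OF J] by blast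
qed

lemma genideal_insert:
  assumes "G \<subseteq> carrier R" "x \<in> carrier R"
  shows "Idl (insert x G) = adjoin (Idl G) x"
proof
  have GI: "ideal (Idl G) R" using assms genideal_ideal by simp
  show "Idl (insert x G) \<subseteq> adjoin (Idl G) x"
    using adjoin_ideal[OF GI assms(2)] adjoin_mem[OF GI assms(2)] adjoin_supset[OF GI assms(2)]
      genideal_self[OF assms(1)]
    by (intro genideal_minimal) auto
  have xI: "ideal (Idl (insert x G)) R" using assms by (intro genideal_ideal) auto
  have s: "insert x G \<subseteq> Idl (insert x G)" using assms by (intro genideal_self) auto
  then have "Idl G \<subseteq> Idl (insert x G)" using xI by (intro genideal_minimal) auto
  then show "adjoin (Idl G) x \<subseteq> Idl (insert x G)"
    using s ideal_add_mem[OF xI] ideal_mult_mem[OF xI] unfolding adjoin_def by auto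
qed

lemma ideal_pow_mono: "A \<subseteq> B \<Longrightarrow> ideal_pow R A k \<subseteq> ideal_pow R B k"
  by (induct k) (simp_all add: ideal_prod_mono)

lemma red_deg_pow_mult':
  assumes "ideal I R" "ideal J R" "k \<ge> 1" "a \<in> red_deg J I k" "b \<in> ideal_pow R I l"
  shows "b \<otimes> a \<in> red_deg J I (k + l)"
proof -
  have "a \<in> carrier R" "b \<in> carrier R"
    using assms ideal_sub red_deg_ideal ideal_pow_ideal by blast+
  then show ?thesis using red_deg_pow_mult[OF assms] by (simp add: m_comm)
qed

text \<open>Binomial pigeonhole: expanding \<open>(X + xR)\<^bsup>p+t\<^esup>\<close>, each term contains \<open>X\<^bsup>p\<^esup>\<close> or \<open>x\<^bsup>t\<^esup>\<close>.\<close>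

lemma adjoin_pow_red:
  assumes X: "ideal X R" and x: "x \<in> I" and I: "ideal I R" and J: "ideal J R" and XI: "X \<subseteq> I"
    and p: "p \<ge> 1" and t: "t \<ge> 1"
    and Xp: "ideal_pow R X p \<subseteq> red_deg J I p" and xt: "x [^] t \<in> red_deg J I t"
  shows "i \<le> p \<Longrightarrow> j \<le> t \<Longrightarrow> k = (p - i) + (t - j) \<Longrightarrow> a \<in> ideal_pow R X i \<Longrightarrow>
    c \<in> ideal_pow R (adjoin X x) k \<Longrightarrow> a \<otimes> x [^] j \<otimes> c \<in> red_deg J I (p + t)"
proof (induct k arbitrary: i j a c)
  have xc: "x \<in> carrier R" using x ideal_sub[OF I] by blast
  note Xi = adjoin_ideal[OF X xc]
  have XxI: "adjoin X x \<subseteq> I"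
    unfolding adjoin_def using XI x ideal_add_mem[OF I] ideal_mult_mem[OF I] by auto
  have inI: "c \<in> ideal_pow R I k" if "c \<in> ideal_pow R (adjoin X x) k" for c k
    using that ideal_pow_mono[OF XxI] by blast
  have inI2: "c \<in> ideal_pow R I k" if "c \<in> ideal_pow R X k" for c k
    using that ideal_pow_mono[OF XI] by blast
  have cI: "c \<in> carrier R" if "c \<in> ideal_pow R I k" for c k
    using that ideal_sub[OF ideal_pow_ideal[OF I]] by blast
  {
    \<comment> \<open>Once one of the two exponents has reached its target, the remaining factors
      only have to be elements of \<open>I\<close>.\<close>
    fix i j k a c
    assume ij: "i \<le> p" "j \<le> t" "k = (p - i) + (t - j)" "a \<in> ideal_pow R X i"
      "c \<in> ideal_pow R (adjoin X x) k" and or: "i = p \<or> j = t"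
    have ac: "a \<in> carrier R" "c \<in> carrier R" "x [^] j \<in> carrier R"
      using cI[OF inI2[OF ij(4)]] cI[OF inI[OF ij(5)]] xc by auto
    from or have "a \<otimes> x [^] j \<otimes> c \<in> red_deg J I (p + t)"
    proof
      assume i: "i = p"
      have "x [^] j \<otimes> c \<in> ideal_pow R I (j + k)"
        by (rule ideal_pow_mult_mem[OF I ideal_pow_mem[OF I x] inI[OF ij(5)]])
      moreover have "j + k = t" using ij i by simp
      ultimately have "a \<otimes> (x [^] j \<otimes> c) \<in> red_deg J I (p + t)"
        using red_deg_pow_mult[OF I J p, of a _ t] Xp ij(4) i by auto
      then show ?thesis using ac by (simp add: m_assoc)
    next
      assume j: "j = t"
      have "a \<otimes> c \<in> ideal_pow R I (i + k)"
        by (rule ideal_pow_mult_mem[OF I inI2[OF ij(4)] inI[OF ij(5)]])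
      moreover have "i + k = p" using ij j by simp
      ultimately have "x [^] j \<otimes> (a \<otimes> c) \<in> red_deg J I (t + p)"
        using red_deg_pow_mult[OF I J t, of "x [^] j" _ p] xt j by auto
      then show ?thesis using ac by (simp add: m_ac add.commute)
    qed
  } note edge = this
  {
    case 0
    then show ?case using edge[OF 0] by auto
  next
    case (Suc k)
    show ?case
    proof (cases "i = p \<or> j = t")
      case True
      then show ?thesis using edge[OF Suc.prems] by blast
    next
      case False
      then have i: "Suc i \<le> p" "k = (p - Suc i) + (t - j)" and j: "Suc j \<le> t" "k = (p - i) + (t - Suc j)"
        using Suc.prems by auto
      have ac: "a \<in> carrier R" using cI[OF inI2[OF Suc.prems(4)]] .
      have "c \<in> adjoin X x \<cdot> ideal_pow R (adjoin X x) k" using Suc.prems(5) by simp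
      then show ?thesis
      proof (induct rule: ideal_prod.induct)
        case (prod w v)
        \<comment> \<open>One factor \<open>w\<close> of the power is split as
          \<open>u + r x\<close>: the first summand raises \<open>i\<close>, the second raises
          \<open>j\<close>, and both lower the number of remaining factors.\<close>
        then obtain u r where u: "u \<in> X" and r: "r \<in> carrier R" and w: "w = u \<oplus> r \<otimes> x"
          unfolding adjoin_def by blast
        have uc: "u \<in> carrier R" using u ideal_sub[OF X] by blast
        have vc: "v \<in> carrier R" using cI[OF inI[OF prod(2)]] .
        have "u \<otimes> a \<in> ideal_pow R X (Suc i)" using u Suc.prems(4) by (simp add: ideal_prod.prod)
        then have 1: "(u \<otimes> a) \<otimes> x [^] j \<otimes> v \<in> red_deg J I (p + t)"
          by (rule Suc.hyps[OF i(1) Suc.prems(2) i(2) _ prod(2)])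
        have "r \<otimes> a \<in> ideal_pow R X i" using ideal_mult_mem[OF ideal_pow_ideal[OF X] Suc.prems(4) r] .
        then have 2: "(r \<otimes> a) \<otimes> x [^] Suc j \<otimes> v \<in> red_deg J I (p + t)"
          by (rule Suc.hyps[OF Suc.prems(1) j(1) j(2) _ prod(2)])
        define y where "y = x [^] j"
        have y: "y \<in> carrier R" using xc by (simp add: y_def)
        have "a \<otimes> y \<otimes> (w \<otimes> v) = (u \<otimes> a) \<otimes> y \<otimes> v \<oplus> (r \<otimes> a) \<otimes> (y \<otimes> x) \<otimes> v"
          unfolding w using ac uc vc r y xc by (simp add: ring_nf)
        moreover have "x [^] Suc j = y \<otimes> x" by (simp add: y_def)
        ultimately show ?case using ideal_add_mem[OF red_deg_ideal[OF I J] 1 2] y_def by simp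
      next
        case (sum s v)
        have "s \<in> carrier R" "v \<in> carrier R"
          using sum ideal_prod_in_carrier[OF Xi ideal_pow_ideal[OF Xi]] by auto
        then have "a \<otimes> x [^] j \<otimes> (s \<oplus> v) = a \<otimes> x [^] j \<otimes> s \<oplus> a \<otimes> x [^] j \<otimes> v"
          using ac xc by (simp add: r_distr)
        then show ?case using ideal_add_mem[OF red_deg_ideal[OF I J] sum(2,4)] by simp
      qed
    qed
  }
qed

text \<open>Integrality of the generators over \<open>J\<close> suffices: they are adjoined one at a
  time, and by the binomial pigeonhole a high power of each partial ideal falls into
  \<open>J I^(p-1)\<close>. For the full ideal this inclusion gives the reduction equation.\<close>

lemma reduction_if_generators_integral:
  assumes G: "finite G" "G \<subseteq> carrier R" and J: "ideal J R" "J \<subseteq> Idl G"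
    and int: "\<And>x. x \<in> G \<Longrightarrow> \<exists>t\<ge>1. x [^] (t::nat) \<in> red_deg J (Idl G) t"
  shows "reduction R J (Idl G)"
proof -
  define I where "I = Idl G"
  have I: "ideal I R" unfolding I_def using G genideal_ideal by simp
  have GI: "G \<subseteq> I" unfolding I_def using G genideal_self by simp
  have "\<exists>p\<ge>1. ideal_pow R (Idl H) p \<subseteq> red_deg J I p" if "H \<subseteq> G" "finite H" for H
    using that(2,1)
  proof (induct H)
    case empty
    have "Idl {} \<subseteq> {\<zero>}" using genideal_minimal[OF zeroideal] by simp
    then have "ideal_pow R (Idl {}) 1 \<subseteq> {\<zero>}"
      using ideal_prod_subset[OF zeroideal, of "Idl {}" "carrier R"] by fastforce
    then show ?case using ideal_zero_mem[OF red_deg_ideal[OF I J(1)]] by blast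
  next
    case (insert x H)
    then obtain p where p: "p \<ge> 1" "ideal_pow R (Idl H) p \<subseteq> red_deg J I p" by blast
    obtain t where t: "t \<ge> 1" "x [^] t \<in> red_deg J I t" using int insert I_def by blast
    have Hc: "H \<subseteq> carrier R" "x \<in> carrier R" using insert G by auto
    have HI: "ideal (Idl H) R" "Idl H \<subseteq> I"
      using genideal_ideal[OF Hc(1)] genideal_minimal[OF I, of H] GI insert by auto
    have "ideal_pow R (adjoin (Idl H) x) (p + t) \<subseteq> red_deg J I (p + t)"
    proof
      fix c assume c: "c \<in> ideal_pow R (adjoin (Idl H) x) (p + t)"
      have "\<one> \<otimes> x [^] (0::nat) \<otimes> c \<in> red_deg J I (p + t)"
        using adjoin_pow_red[OF HI(1) _ I J(1) HI(2) p(1) t(1) p(2) t(2), of 0 0 "p + t" \<one> c] c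
          insert GI by auto
      moreover have "c \<in> carrier R"
        using c ideal_sub[OF ideal_pow_ideal[OF adjoin_ideal[OF HI(1) Hc(2)]]] by blast
      ultimately show "c \<in> red_deg J I (p + t)" by simp
    qed
    then show ?case using genideal_insert[OF Hc] p(1) by (metis le_add1 le_trans)
  qed
  from this[OF _ G(1)] obtain p where p: "p \<ge> 1" "ideal_pow R I p \<subseteq> red_deg J I p"
    unfolding I_def by blast
  \<comment> \<open>The degree is raised from \<open>p\<close> to \<open>p + 1\<close> so that the
    exponent \<open>m = p\<close> in \<open>reduction\<close> is positive.\<close>
  have "ideal_pow R I (p + 1) = red_deg J I (p + 1)"
  proof
    show "red_deg J I (p + 1) \<subseteq> ideal_pow R I (p + 1)"
      using red_deg_subset_pow[OF I, of J "p + 1"] J I_def by simp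
    have "b \<otimes> a \<in> red_deg J I (p + 1)" if "b \<in> I" "a \<in> ideal_pow R I p" for a b
    proof -
      have "b \<in> ideal_pow R I 1" using that(1) ideal_prod_one[OF I] by simp
      then show ?thesis using red_deg_pow_mult'[OF I J(1) p(1)] that p(2) by blast
    qed
    then show "ideal_pow R I (p + 1) \<subseteq> red_deg J I (p + 1)"
      using ideal_prod_subset[OF red_deg_ideal[OF I J(1)]] by simp
  qed
  then show ?thesis
    unfolding reduction_def red_deg_def using J p(1) I_def by (auto intro!: exI[of _ p])
qed

text \<open>Lifts membership from the reduced ring to \<open>R\<close>: with \<open>y = x^t\<close>,
  the difference \<open>y^(k+1) - (y - l)^(k+1)\<close> is a homogeneous multiple of
  \<open>l\<close>, hence lies in \<open>red_deg\<close> of degree \<open>t (k+1)\<close>, and its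
  second term vanishes for large \<open>k\<close>.\<close>

lemma power_mem_of_diff_nilpotent:
  assumes I: "ideal I R" and J: "ideal J R" "J \<subseteq> I" and x: "x \<in> I" and t: "t \<ge> 1"
    and l: "l \<in> red_deg J I t" and nil: "(x [^] t \<ominus> l) [^] (s::nat) = \<zero>"
  shows "\<exists>u\<ge>1. x [^] (u::nat) \<in> red_deg J I u"
proof -
  have xc: "x \<in> carrier R" using x ideal_sub[OF I] by blast
  have lc: "l \<in> carrier R" using l ideal_sub[OF red_deg_ideal[OF I J(1)]] by blast
  \<comment> \<open>Successor exponents keep the degree positive, where \<open>red_deg\<close> has
    its meaning; a vanishing power stays zero after one more factor.\<close>
  have "(x [^] t) [^] Suc k \<ominus> (x [^] t \<ominus> l) [^] Suc k \<in> red_deg J I (t * Suc k)" for k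
  proof (induct k)
    case 0
    have "x [^] t \<ominus> (x [^] t \<ominus> l) = l"
    proof -
      define y where "y = x [^] t"
      have "y \<in> carrier R" using xc by (simp add: y_def)
      then show ?thesis unfolding y_def[symmetric] using lc by (simp add: ring_nf)
    qed
    then show ?case using l xc lc by simp
  next
    case (Suc k)
    define y where "y = x [^] t"
    define A where "A = y [^] Suc k"
    define B where "B = (y \<ominus> l) [^] Suc k"
    have c: "y \<in> carrier R" "A \<in> carrier R" "B \<in> carrier R"
      using xc lc by (simp_all add: y_def A_def B_def)
    have 1: "A \<ominus> B \<in> red_deg J I (t * Suc k)" using Suc unfolding A_def B_def y_def .
    have yI: "y \<in> ideal_pow R I t" unfolding y_def by (rule ideal_pow_mem[OF I x])
    have AI: "A \<in> ideal_pow R I (t * Suc k)"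
      unfolding A_def y_def using ideal_pow_mem[OF I x, of "t * Suc k"] xc
      by (simp only: nat_pow_pow)
    have lI: "l \<in> ideal_pow R I t" using l red_deg_subset_pow[OF I J(2) t] by blast
    have "A \<ominus> B \<in> ideal_pow R I (t * Suc k)"
      using 1 red_deg_subset_pow[OF I J(2), of "t * Suc k"] t by auto
    then have BI: "B \<in> ideal_pow R I (t * Suc k)"
      using ideal_minus_mem[OF ideal_pow_ideal[OF I] AI, of "A \<ominus> B"] c
      by (simp add: a_minus_def minus_add r_neg2)
    have "(A \<ominus> B) \<otimes> y \<in> red_deg J I (t * Suc k + t)"
      using red_deg_pow_mult[OF I J(1) _ 1 yI] t by simp
    moreover have "l \<otimes> B \<in> red_deg J I (t + t * Suc k)"
      by (rule red_deg_pow_mult[OF I J(1) t l BI])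
    ultimately have "(A \<ominus> B) \<otimes> y \<oplus> l \<otimes> B \<in> red_deg J I (t * Suc (Suc k))"
      using ideal_add_mem[OF red_deg_ideal[OF I J(1)]] by (simp add: add.commute)
    moreover have "(A \<ominus> B) \<otimes> y \<oplus> l \<otimes> B = A \<otimes> y \<ominus> B \<otimes> (y \<ominus> l)" using c lc by (simp add: ring_nf)
    ultimately show ?case unfolding A_def B_def y_def by simp
  qed
  from this[of s] have *: "(x [^] t) [^] Suc s \<ominus> (x [^] t \<ominus> l) [^] Suc s \<in> red_deg J I (t * Suc s)" .
  have "(x [^] t \<ominus> l) [^] Suc s = \<zero>" using nil xc lc by simp
  moreover have "(x [^] t) [^] Suc s = x [^] (t * Suc s)" using xc by (rule nat_pow_pow)
  moreover have "x [^] (t * Suc s) \<ominus> \<zero> = x [^] (t * Suc s)"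
    using xc by (simp add: a_minus_def del: nat_pow_Suc mult_Suc_right)
  ultimately have "x [^] (t * Suc s) \<in> red_deg J I (t * Suc s)" using * by metis
  then show ?thesis using t by (intro exI[of _ "t * Suc s"]) auto
qed

end

section \<open>Linear combinations and a Cayley-Hamilton argument by elimination\<close>

text \<open>The coefficients come from a mere subset \<open>L\<close>, later one of the graded sets
  of lower terms. Inductive generation makes closure arguments possible without indexed
  sums.\<close>

inductive_set (in cring) comb :: "'a set \<Rightarrow> (nat \<Rightarrow> 'a) \<Rightarrow> nat \<Rightarrow> 'a set"
  for L :: "'a set" and \<beta> :: "nat \<Rightarrow> 'a" and p :: nat where
  zero: "\<zero> \<in> comb L \<beta> p"
| gen: "c \<in> L \<Longrightarrow> k < p \<Longrightarrow> c \<otimes> \<beta> k \<in> comb L \<beta> p"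
| add: "u \<in> comb L \<beta> p \<Longrightarrow> v \<in> comb L \<beta> p \<Longrightarrow> u \<oplus> v \<in> comb L \<beta> p"

context cring
begin

lemma comb_carrier:
  assumes "L \<subseteq> carrier R" "\<And>k. k < p \<Longrightarrow> \<beta> k \<in> carrier R" "u \<in> comb L \<beta> p"
  shows "u \<in> carrier R"
  using assms(3) by (induct rule: comb.induct) (use assms(1,2) in auto)

text \<open>Isolates the coefficient of the last generator, which is what eliminating generators one
  at a time requires.\<close>

lemma comb_Suc:
  assumes L: "L \<subseteq> carrier R" "\<zero> \<in> L" "\<And>a b. a \<in> L \<Longrightarrow> b \<in> L \<Longrightarrow> a \<oplus> b \<in> L"
    and \<beta>: "\<And>k. k < Suc p \<Longrightarrow> \<beta> k \<in> carrier R" and u: "u \<in> comb L \<beta> (Suc p)"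
  obtains v c where "v \<in> comb L \<beta> p" "c \<in> L" "u = v \<oplus> c \<otimes> \<beta> p"
proof -
  have bp: "\<beta> p \<in> carrier R" using \<beta> by simp
  have vc: "v \<in> carrier R" if "v \<in> comb L \<beta> p" for v using comb_carrier[OF L(1) _ that] \<beta> by simp
  from u have "\<exists>v\<in>comb L \<beta> p. \<exists>c\<in>L. u = v \<oplus> c \<otimes> \<beta> p"
  proof (induct rule: comb.induct)
    case zero
    have "\<zero> = \<zero> \<oplus> \<zero> \<otimes> \<beta> p" using bp by simp
    then show ?case using comb.zero L(2) by blast
  next
    case (gen c k)
    have cc: "c \<in> carrier R" using gen L by auto
    show ?case
    proof (cases "k = p")
      case True
      have "c \<otimes> \<beta> k = \<zero> \<oplus> c \<otimes> \<beta> p" using True cc bp by simp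
      then show ?thesis using comb.zero gen by blast
    next
      case False
      then have k: "k < p" using gen by simp
      then have "\<beta> k \<in> carrier R" using \<beta> by simp
      then have "c \<otimes> \<beta> k = c \<otimes> \<beta> k \<oplus> \<zero> \<otimes> \<beta> p" using cc bp by simp
      then show ?thesis using comb.gen[OF gen(1) k] L(2) by blast
    qed
  next
    case (add u1 u2)
    then obtain v1 v2 c1 c2 where v: "v1 \<in> comb L \<beta> p" "v2 \<in> comb L \<beta> p" and c: "c1 \<in> L" "c2 \<in> L"
      and u: "u1 = v1 \<oplus> c1 \<otimes> \<beta> p" "u2 = v2 \<oplus> c2 \<otimes> \<beta> p" by blast
    have cc: "v1 \<in> carrier R" "v2 \<in> carrier R" "c1 \<in> carrier R" "c2 \<in> carrier R"
      using v c L vc by auto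
    have "u1 \<oplus> u2 = (v1 \<oplus> v2) \<oplus> (c1 \<oplus> c2) \<otimes> \<beta> p"
      unfolding u using cc bp by algebra
    then show ?case using comb.add[OF v] L(3)[OF c] by blast
  qed
  then show thesis using that by blast
qed

lemma genideal_subset_comb:
  assumes "\<And>k. k < p \<Longrightarrow> \<beta> k \<in> carrier R"
  shows "Idl (\<beta> ` {..<p}) \<subseteq> comb (carrier R) \<beta> p"
proof (rule genideal_minimal)
  show "\<beta> ` {..<p} \<subseteq> comb (carrier R) \<beta> p"
  proof
    fix y assume "y \<in> \<beta> ` {..<p}"
    then obtain k where k: "k < p" "y = \<beta> k" by auto
    then have "y = \<one> \<otimes> \<beta> k" using assms by simp
    then show "y \<in> comb (carrier R) \<beta> p" using comb.gen[of \<one> "carrier R" k p \<beta>] k by simp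
  qed
  show "ideal (comb (carrier R) \<beta> p) R"
  proof (rule ideal_criterion)
    show "comb (carrier R) \<beta> p \<subseteq> carrier R"
      using comb_carrier[of "carrier R" p \<beta>] assms by blast
    fix a r assume a: "a \<in> comb (carrier R) \<beta> p" and r: "r \<in> carrier R"
    from a show "r \<otimes> a \<in> comb (carrier R) \<beta> p"
    proof (induct rule: comb.induct)
      case zero then show ?case using r by (simp add: comb.zero)
    next
      case (gen c k)
      have "r \<otimes> (c \<otimes> \<beta> k) = (r \<otimes> c) \<otimes> \<beta> k" using gen r assms by (simp add: m_assoc)
      then show ?case using comb.gen[of "r \<otimes> c" "carrier R" k p \<beta>] gen r by simp
    next
      case (add u v)
      have "u \<in> carrier R" "v \<in> carrier R"
        using add comb_carrier[of "carrier R" p \<beta>] assms by blast+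
      then show ?case using add r comb.add by (simp add: r_distr)
    qed
  qed (auto intro: comb.intros)
qed

end

text \<open>A determinant-free form of the Cayley-Hamilton argument: \<^term>\<open>L k\<close> plays the role of the
  homogeneous polynomials of degree \<^term>\<open>k\<close> in \<^term>\<open>x\<close> with leading term removed, and the
  module generators \<open>\<beta>\<close> are eliminated one at a time.\<close>

locale lower_terms = cring R for R (structure) +
  fixes L :: "nat \<Rightarrow> 'a set" and x :: 'a
  assumes xc: "x \<in> carrier R"
    and Lc: "L k \<subseteq> carrier R"
    and L0: "\<zero> \<in> L k"
    and Lminus: "a \<in> L k \<Longrightarrow> b \<in> L k \<Longrightarrow> a \<ominus> b \<in> L k"
    and Lmult: "k \<ge> 1 \<Longrightarrow> l \<ge> 1 \<Longrightarrow> a \<in> L k \<Longrightarrow> b \<in> L l \<Longrightarrow> a \<otimes> b \<in> L (k + l)"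
    and Lx: "k \<ge> 1 \<Longrightarrow> a \<in> L k \<Longrightarrow> x \<otimes> a \<in> L (Suc k)"
begin

text \<open>\<open>z\<close> is the value at \<open>x\<close> of a monic polynomial of degree
  \<open>k\<close> whose lower terms are taken from \<open>L k\<close>.\<close>

definition monic :: "'a \<Rightarrow> nat \<Rightarrow> bool" where
  "monic z k \<longleftrightarrow> z \<in> carrier R \<and> x [^] k \<ominus> z \<in> L k"

lemma Lcarr: "a \<in> L k \<Longrightarrow> a \<in> carrier R"
  using Lc by blast

lemma Ladd:
  assumes "a \<in> L k" "b \<in> L k"
  shows "a \<oplus> b \<in> L k"
proof -
  have c: "a \<in> carrier R" "b \<in> carrier R" using assms Lcarr by auto
  have "a \<oplus> b = a \<ominus> (\<zero> \<ominus> b)" using c by (simp add: ring_nf)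
  then show ?thesis using Lminus[OF assms(1) Lminus[OF L0 assms(2)]] by simp
qed

lemma Lxpow: "k \<ge> 1 \<Longrightarrow> a \<in> L k \<Longrightarrow> x [^] (j::nat) \<otimes> a \<in> L (j + k)"
proof (induct j)
  case 0
  then show ?case using Lcarr by simp
next
  case (Suc j)
  have a: "a \<in> carrier R" using Suc Lcarr by auto
  have "x \<otimes> (x [^] j \<otimes> a) \<in> L (Suc (j + k))" using Suc Lx by simp
  moreover have "x [^] Suc j \<otimes> a = x \<otimes> (x [^] j \<otimes> a)" using xc a by (simp add: m_ac)
  ultimately show ?case by simp
qed

lemma monic_mult_L:
  assumes z: "monic z k" and k: "k \<ge> 1" and l: "l \<ge> 1" and a: "a \<in> L l"
  shows "z \<otimes> a \<in> L (k + l)"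
proof -
  define y where "y = x [^] k"
  have c: "y \<in> carrier R" "z \<in> carrier R" "a \<in> carrier R"
    using z a xc Lcarr by (auto simp: monic_def y_def)
  have "y \<otimes> a \<ominus> (y \<ominus> z) \<otimes> a \<in> L (k + l)"
    using z Lminus[OF Lxpow[OF l a] Lmult[OF k l _ a]] by (auto simp: monic_def y_def)
  moreover have "y \<otimes> a \<ominus> (y \<ominus> z) \<otimes> a = z \<otimes> a"
    using c by (simp add: ring_nf)
  ultimately show ?thesis by simp
qed

lemma monic_mult:
  assumes z: "monic z k" and w: "monic w l" and k: "k \<ge> 1" and l: "l \<ge> 1"
  shows "monic (z \<otimes> w) (k + l)"
proof -
  define y where "y = x [^] k"
  define y' where "y' = x [^] l"
  have c: "y \<in> carrier R" "y' \<in> carrier R" "z \<in> carrier R" "w \<in> carrier R"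
    using z w xc by (auto simp: monic_def y_def y'_def)
  have "y \<otimes> (y' \<ominus> w) \<in> L (k + l)"
    using w Lxpow[OF l] by (simp add: monic_def y_def y'_def)
  moreover have "w \<otimes> (y \<ominus> z) \<in> L (l + k)"
    using z monic_mult_L[OF w l k] by (simp add: monic_def y_def)
  ultimately have "y \<otimes> (y' \<ominus> w) \<oplus> w \<otimes> (y \<ominus> z) \<in> L (k + l)"
    using Ladd by (simp add: add.commute)
  moreover have "y \<otimes> (y' \<ominus> w) \<oplus> w \<otimes> (y \<ominus> z) = y \<otimes> y' \<ominus> z \<otimes> w"
    using c by (simp add: ring_nf)
  ultimately show ?thesis using c xc by (simp add: monic_def y_def y'_def nat_pow_mult)
qed

lemma monic_minus:
  assumes z: "monic z k" and a: "a \<in> L k"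
  shows "monic (z \<ominus> a) k"
proof -
  define y where "y = x [^] k"
  have c: "y \<in> carrier R" "z \<in> carrier R" "a \<in> carrier R"
    using z a xc Lcarr by (auto simp: monic_def y_def)
  have "(y \<ominus> z) \<oplus> a \<in> L k" using z a Ladd by (simp add: monic_def y_def)
  moreover have "(y \<ominus> z) \<oplus> a = y \<ominus> (z \<ominus> a)"
    using c by (simp add: ring_nf)
  ultimately show ?thesis using c by (simp add: monic_def y_def)
qed

lemma comb_scale:
  assumes w: "w \<in> carrier R" "\<And>a. a \<in> L l \<Longrightarrow> w \<otimes> a \<in> L (k + l)"
    and \<beta>: "\<And>i. i < p \<Longrightarrow> \<beta> i \<in> carrier R" and u: "u \<in> comb (L l) \<beta> p"
  shows "w \<otimes> u \<in> comb (L (k + l)) \<beta> p"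
  using u
proof (induct rule: comb.induct)
  case zero
  then show ?case using w by (simp add: comb.zero)
next
  case (gen c i)
  have "w \<otimes> (c \<otimes> \<beta> i) = (w \<otimes> c) \<otimes> \<beta> i" using gen w \<beta> Lcarr by (simp add: m_assoc)
  then show ?case using comb.gen[OF w(2)[OF gen(1)] gen(2)] by simp
next
  case (add u v)
  have "u \<in> carrier R" "v \<in> carrier R" using comb_carrier[OF Lc \<beta> add(1)] comb_carrier[OF Lc \<beta> add(3)] by auto
  then show ?case using add w comb.add by (simp add: r_distr)
qed

lemma comb_annihilated:
  assumes w: "w \<in> carrier R" "\<And>i. i < p \<Longrightarrow> w \<otimes> \<beta> i = \<zero>" "A \<subseteq> carrier R"
    and \<beta>: "\<And>i. i < p \<Longrightarrow> \<beta> i \<in> carrier R" and u: "u \<in> comb A \<beta> p"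
  shows "w \<otimes> u = \<zero>"
  using u
proof (induct rule: comb.induct)
  case zero
  then show ?case using w by simp
next
  case (gen c i)
  have "w \<otimes> (c \<otimes> \<beta> i) = c \<otimes> (w \<otimes> \<beta> i)" using gen w \<beta> by (simp add: m_lcomm subset_eq)
  then show ?case using gen w by auto
next
  case (add u v)
  have "u \<in> carrier R" "v \<in> carrier R" using comb_carrier[OF w(3) \<beta> add(1)] comb_carrier[OF w(3) \<beta> add(3)] by auto
  then show ?case using add w by (simp add: r_distr)
qed

lemma monic_annihilator:
  assumes "k \<ge> 1" "monic z k" "\<And>i. i < p \<Longrightarrow> \<beta> i \<in> carrier R"
    "\<And>i. i < p \<Longrightarrow> z \<otimes> \<beta> i \<in> comb (L k) \<beta> p"
  shows "\<exists>t\<ge>1. \<exists>z'. monic z' t \<and> (\<forall>i<p. z' \<otimes> \<beta> i = \<zero>)"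
  using assms
proof (induct p arbitrary: z k)
  case 0
  then show ?case by auto
next
  case (Suc p)
  note k = Suc.prems(1) and z = Suc.prems(2) and \<beta> = Suc.prems(3)
  have zc: "z \<in> carrier R" using z by (simp add: monic_def)
  have dec: "\<exists>v\<in>comb (L k) \<beta> p. \<exists>c\<in>L k. z \<otimes> \<beta> i = v \<oplus> c \<otimes> \<beta> p" if "i < Suc p" for i
    using comb_Suc[OF Lc L0 Ladd \<beta> Suc.prems(4)[OF that]] by metis
  obtain u c where u: "u \<in> comb (L k) \<beta> p" and c: "c \<in> L k" and e: "z \<otimes> \<beta> p = u \<oplus> c \<otimes> \<beta> p"
    using dec by blast
  have bp: "\<beta> p \<in> carrier R" and b: "\<And>i. i < p \<Longrightarrow> \<beta> i \<in> carrier R" using \<beta> by auto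
  have uc: "u \<in> carrier R" using comb_carrier[OF Lc b u] .
  have cc: "c \<in> carrier R" using c Lcarr by blast
  have zm: "monic (z \<ominus> c) k" by (rule monic_minus[OF z c])
  have z1: "monic ((z \<ominus> c) \<otimes> z) (k + k)" by (rule monic_mult[OF zm z k k])
  have eu: "(z \<ominus> c) \<otimes> \<beta> p = u"
  proof -
    define b' where "b' = \<beta> p"
    have b': "b' \<in> carrier R" using bp by (simp add: b'_def)
    have "(z \<ominus> c) \<otimes> b' = z \<otimes> b' \<ominus> c \<otimes> b'" using zc cc b' by (simp add: ring_nf)
    also have "\<dots> = (u \<oplus> c \<otimes> b') \<ominus> c \<otimes> b'" using e by (simp add: b'_def)
    also have "\<dots> = u" using uc cc b' by (simp add: ring_nf)
    finally show ?thesis by (simp add: b'_def)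
  qed
  have "(z \<ominus> c) \<otimes> z \<otimes> \<beta> i \<in> comb (L (k + k)) \<beta> p" if i: "i < p" for i
  proof -
    obtain v d where v: "v \<in> comb (L k) \<beta> p" and d: "d \<in> L k" and e2: "z \<otimes> \<beta> i = v \<oplus> d \<otimes> \<beta> p"
      using dec[of i] i by auto
    have vc: "v \<in> carrier R" using comb_carrier[OF Lc b v] .
    have dc: "d \<in> carrier R" using d Lcarr by blast
    have bi: "\<beta> i \<in> carrier R" using b i by simp
    have zcc: "z \<ominus> c \<in> carrier R" using zc cc by simp
    have "(z \<ominus> c) \<otimes> z \<otimes> \<beta> i = (z \<ominus> c) \<otimes> (v \<oplus> d \<otimes> \<beta> p)"
      using zcc zc bi e2 by (simp add: m_assoc)
    also have "\<dots> = (z \<ominus> c) \<otimes> v \<oplus> d \<otimes> ((z \<ominus> c) \<otimes> \<beta> p)"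
      using zcc vc dc bp by (simp add: r_distr m_lcomm)
    also have "\<dots> = (z \<ominus> c) \<otimes> v \<oplus> d \<otimes> u" by (simp add: eu)
    finally have "(z \<ominus> c) \<otimes> z \<otimes> \<beta> i = (z \<ominus> c) \<otimes> v \<oplus> d \<otimes> u" .
    moreover have "(z \<ominus> c) \<otimes> v \<in> comb (L (k + k)) \<beta> p"
      by (rule comb_scale[OF zcc monic_mult_L[OF zm k k] b v])
    moreover have "d \<otimes> u \<in> comb (L (k + k)) \<beta> p"
      by (rule comb_scale[OF dc Lmult[OF k k d] b u])
    ultimately show ?thesis using comb.add by simp
  qed
  from Suc.hyps[OF _ z1 b this] k obtain t z2 where t: "t \<ge> 1" and z2: "monic z2 t"
    and ann: "\<And>i. i < p \<Longrightarrow> z2 \<otimes> \<beta> i = \<zero>" by auto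
  have z2c: "z2 \<in> carrier R" using z2 by (simp add: monic_def)
  have "monic (z2 \<otimes> (z \<ominus> c)) (t + k)" by (rule monic_mult[OF z2 zm t k])
  moreover have "z2 \<otimes> (z \<ominus> c) \<otimes> \<beta> i = \<zero>" if i: "i < Suc p" for i
  proof (cases "i = p")
    case True
    have "z2 \<otimes> (z \<ominus> c) \<otimes> \<beta> p = z2 \<otimes> u" using eu z2c zc cc bp by (simp add: m_assoc)
    then show ?thesis using True comb_annihilated[OF z2c ann Lc b u] by simp
  next
    case False
    then have i: "i < p" using i by simp
    have "z2 \<otimes> (z \<ominus> c) \<otimes> \<beta> i = (z \<ominus> c) \<otimes> (z2 \<otimes> \<beta> i)" using z2c zc cc b[OF i] by (simp add: m_ac)
    then show ?thesis using ann[OF i] zc cc by simp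
  qed
  ultimately show ?case using t by (intro exI[of _ "t + k"]) auto
qed

lemma x_monic: "monic x 1"
  using xc L0 by (simp add: monic_def a_minus_def r_neg)

end

context cring
begin

subsection \<open>Total quotient rings\<close>

lemma nzdI: "s \<in> carrier R \<Longrightarrow> (\<And>a. a \<in> carrier R \<Longrightarrow> s \<otimes> a = \<zero> \<Longrightarrow> a = \<zero>) \<Longrightarrow> s \<in> nonzerodivisors R"
  by (simp add: nonzerodivisors_def)

lemma nzd_carr: "s \<in> nonzerodivisors R \<Longrightarrow> s \<in> carrier R"
  by (simp add: nonzerodivisors_def)

lemma nzd_zero: "s \<in> nonzerodivisors R \<Longrightarrow> a \<in> carrier R \<Longrightarrow> s \<otimes> a = \<zero> \<Longrightarrow> a = \<zero>"
  by (simp add: nonzerodivisors_def)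

lemma nzd_cancel:
  assumes "s \<in> nonzerodivisors R" "a \<in> carrier R" "b \<in> carrier R" "s \<otimes> a = s \<otimes> b"
  shows "a = b"
proof -
  have sc: "s \<in> carrier R" using assms nzd_carr by blast
  have "s \<otimes> (a \<ominus> b) = s \<otimes> a \<ominus> s \<otimes> b" using sc assms(2,3) by (simp add: ring_nf)
  then have "s \<otimes> (a \<ominus> b) = \<zero>" using assms sc by (simp add: a_minus_def r_neg)
  then have "a \<ominus> b = \<zero>" using nzd_zero[OF assms(1)] assms by simp
  then show ?thesis using assms by simp
qed

lemma nzd_one: "\<one> \<in> nonzerodivisors R"
  by (simp add: nonzerodivisors_def)

lemma nzd_mult:
  assumes "s \<in> nonzerodivisors R" "t \<in> nonzerodivisors R"
  shows "s \<otimes> t \<in> nonzerodivisors R"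
proof (rule nzdI)
  have c: "s \<in> carrier R" "t \<in> carrier R" using assms nzd_carr by auto
  then show "s \<otimes> t \<in> carrier R" by simp
  fix a assume a: "a \<in> carrier R" "s \<otimes> t \<otimes> a = \<zero>"
  then have "s \<otimes> (t \<otimes> a) = \<zero>" using c by (simp add: m_assoc)
  then have "t \<otimes> a = \<zero>" using nzd_zero[OF assms(1)] c a by simp
  then show "a = \<zero>" using nzd_zero[OF assms(2)] a by simp
qed

abbreviation fc where "fc \<equiv> frac_class R"

lemma frac_rel_trans:
  assumes "((a, s), (b, t)) \<in> frac_rel R" "((b, t), (c, u)) \<in> frac_rel R"
  shows "((a, s), (c, u)) \<in> frac_rel R"
proof -
  have cc: "a \<in> carrier R" "b \<in> carrier R" "c \<in> carrier R"
    and n: "s \<in> nonzerodivisors R" "t \<in> nonzerodivisors R" "u \<in> nonzerodivisors R"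
    and e: "a \<otimes> t = b \<otimes> s" "b \<otimes> u = c \<otimes> t"
    using assms by (auto simp: frac_rel_def)
  have nc: "s \<in> carrier R" "t \<in> carrier R" "u \<in> carrier R" using n nzd_carr by auto
  have "t \<otimes> (a \<otimes> u) = (a \<otimes> t) \<otimes> u" using cc nc by (simp add: m_ac)
  also have "\<dots> = (b \<otimes> u) \<otimes> s" using e(1) cc nc by (simp add: m_ac)
  also have "\<dots> = t \<otimes> (c \<otimes> s)" using e(2) cc nc by (simp add: m_ac)
  finally have "a \<otimes> u = c \<otimes> s" using nzd_cancel[OF n(2)] cc nc by simp
  then show ?thesis using cc n by (simp add: frac_rel_def)
qed

lemma frac_rel_sym: "(p, p') \<in> frac_rel R \<Longrightarrow> (p', p) \<in> frac_rel R"
  by (auto simp: frac_rel_def)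

lemma fc_eq_iff:
  assumes "a \<in> carrier R" "b \<in> carrier R" "s \<in> nonzerodivisors R" "t \<in> nonzerodivisors R"
  shows "fc a s = fc b t \<longleftrightarrow> a \<otimes> t = b \<otimes> s"
proof
  assume e: "fc a s = fc b t"
  have "(b, t) \<in> fc b t" using assms by (simp add: frac_class_def frac_rel_def)
  then have "(b, t) \<in> fc a s" using e by simp
  then show "a \<otimes> t = b \<otimes> s" by (simp add: frac_class_def frac_rel_def)
next
  assume "a \<otimes> t = b \<otimes> s"
  then have r: "((a, s), (b, t)) \<in> frac_rel R" using assms by (simp add: frac_rel_def)
  show "fc a s = fc b t"
  proof (rule Set.set_eqI)
    fix p :: "'a \<times> 'a"
    obtain c u where p: "p = (c, u)" by (cases p)
    show "p \<in> fc a s \<longleftrightarrow> p \<in> fc b t"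
      unfolding p frac_class_def using frac_rel_trans[OF r, of c u] frac_rel_trans[OF frac_rel_sym[OF r], of c u] by auto
  qed
qed

text \<open>\<open>frac_mult\<close> and \<open>frac_add\<close> are images of sets of
  representatives; this reduces their evaluation to one representative together with a
  well-definedness check.\<close>

lemma fc_image:
  assumes P: "(a, s) \<in> P" and eq: "\<And>b t. (b, t) \<in> P \<Longrightarrow> fc b t = fc a s"
  shows "frac_rel R `` P = fc a s"
proof
  show "frac_rel R `` P \<subseteq> fc a s"
  proof
    fix z assume "z \<in> frac_rel R `` P"
    then obtain b t where b: "(b, t) \<in> P" "((b, t), z) \<in> frac_rel R" by auto
    then have "z \<in> fc b t" unfolding frac_class_def by blast
    then show "z \<in> fc a s" using eq[OF b(1)] by simp
  qed
  show "fc a s \<subseteq> frac_rel R `` P" using P unfolding frac_class_def by blast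
qed

lemma fc_memD:
  assumes "(b, t) \<in> fc a s"
  shows "b \<in> carrier R" "t \<in> nonzerodivisors R" "a \<otimes> t = b \<otimes> s"
  using assms by (auto simp: frac_class_def frac_rel_def)

lemma fc_mem: "a \<in> carrier R \<Longrightarrow> s \<in> nonzerodivisors R \<Longrightarrow> (a, s) \<in> fc a s"
  by (simp add: frac_class_def frac_rel_def)

lemma frac_mult_fc:
  assumes "a \<in> carrier R" "b \<in> carrier R" "s \<in> nonzerodivisors R" "t \<in> nonzerodivisors R"
  shows "frac_mult R (fc a s) (fc b t) = fc (a \<otimes> b) (s \<otimes> t)"
  unfolding frac_mult_def
proof (rule fc_image)
  show "(a \<otimes> b, s \<otimes> t) \<in> {p. \<exists>a' s' b' t'. p = (a' \<otimes> b', s' \<otimes> t') \<and> (a', s') \<in> fc a s \<and> (b', t') \<in> fc b t}"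
    using fc_mem assms by blast
  fix x y assume "(x, y) \<in> {p. \<exists>a' s' b' t'. p = (a' \<otimes> b', s' \<otimes> t') \<and> (a', s') \<in> fc a s \<and> (b', t') \<in> fc b t}"
  then obtain a' s' b' t' where xy: "x = a' \<otimes> b'" "y = s' \<otimes> t'" and m: "(a', s') \<in> fc a s" "(b', t') \<in> fc b t" by blast
  note A = fc_memD[OF m(1)] and B = fc_memD[OF m(2)]
  have cc: "s \<in> carrier R" "t \<in> carrier R" "s' \<in> carrier R" "t' \<in> carrier R" using A B assms nzd_carr by auto
  have "(a' \<otimes> b') \<otimes> (s \<otimes> t) = (a' \<otimes> s) \<otimes> (b' \<otimes> t)" using A B cc by (simp add: m_ac)
  also have "\<dots> = (a \<otimes> s') \<otimes> (b \<otimes> t')" using A B by simp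
  also have "\<dots> = (a \<otimes> b) \<otimes> (s' \<otimes> t')" using assms cc by (simp add: m_ac)
  finally show "fc x y = fc (a \<otimes> b) (s \<otimes> t)"
    unfolding xy using A B assms by (subst fc_eq_iff) (auto intro: nzd_mult)
qed

lemma frac_add_fc:
  assumes "a \<in> carrier R" "b \<in> carrier R" "s \<in> nonzerodivisors R" "t \<in> nonzerodivisors R"
  shows "frac_add R (fc a s) (fc b t) = fc (a \<otimes> t \<oplus> b \<otimes> s) (s \<otimes> t)"
  unfolding frac_add_def
proof (rule fc_image)
  show "(a \<otimes> t \<oplus> b \<otimes> s, s \<otimes> t) \<in> {p. \<exists>a' s' b' t'. p = (a' \<otimes> t' \<oplus> b' \<otimes> s', s' \<otimes> t') \<and> (a', s') \<in> fc a s \<and> (b', t') \<in> fc b t}"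
    using fc_mem assms by blast
  fix x y assume "(x, y) \<in> {p. \<exists>a' s' b' t'. p = (a' \<otimes> t' \<oplus> b' \<otimes> s', s' \<otimes> t') \<and> (a', s') \<in> fc a s \<and> (b', t') \<in> fc b t}"
  then obtain a' s' b' t' where xy: "x = a' \<otimes> t' \<oplus> b' \<otimes> s'" "y = s' \<otimes> t'" and m: "(a', s') \<in> fc a s" "(b', t') \<in> fc b t" by blast
  note A = fc_memD[OF m(1)] and B = fc_memD[OF m(2)]
  have cc: "s \<in> carrier R" "t \<in> carrier R" "s' \<in> carrier R" "t' \<in> carrier R" using A B assms nzd_carr by auto
  have "(a' \<otimes> t' \<oplus> b' \<otimes> s') \<otimes> (s \<otimes> t) = (a' \<otimes> s) \<otimes> (t \<otimes> t') \<oplus> (b' \<otimes> t) \<otimes> (s \<otimes> s')"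
    using A(1) B(1) cc by (simp add: ring_nf)
  also have "\<dots> = (a \<otimes> s') \<otimes> (t \<otimes> t') \<oplus> (b \<otimes> t') \<otimes> (s \<otimes> s')" using A B by simp
  also have "\<dots> = (a \<otimes> t \<oplus> b \<otimes> s) \<otimes> (s' \<otimes> t')"
    using assms(1,2) cc by (simp add: ring_nf)
  finally show "fc x y = fc (a \<otimes> t \<oplus> b \<otimes> s) (s \<otimes> t)"
    unfolding xy using A B assms cc by (subst fc_eq_iff) (auto intro: nzd_mult)
qed

lemma tqr_simps:
  "carrier (total_quotient_ring R) = {fc a s | a s. a \<in> carrier R \<and> s \<in> nonzerodivisors R}"
  "x \<otimes>\<^bsub>total_quotient_ring R\<^esub> y = frac_mult R x y" "x \<oplus>\<^bsub>total_quotient_ring R\<^esub> y = frac_add R x y"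
  "\<one>\<^bsub>total_quotient_ring R\<^esub> = fc \<one> \<one>" "\<zero>\<^bsub>total_quotient_ring R\<^esub> = fc \<zero> \<one>"
  by (simp_all add: total_quotient_ring_def)

lemma fc_carrier: "a \<in> carrier R \<Longrightarrow> s \<in> nonzerodivisors R \<Longrightarrow> fc a s \<in> carrier (total_quotient_ring R)"
  unfolding tqr_simps(1) by blast

lemma tqr_cring: "cring (total_quotient_ring R)"
proof (rule cringI)
  let ?Q = "total_quotient_ring R"
  note S = tqr_simps(2-) fc_carrier frac_mult_fc frac_add_fc nzd_mult nzd_one nzd_carr
  show "abelian_group ?Q"
  proof (rule abelian_groupI)
    fix x y assume "x \<in> carrier ?Q" "y \<in> carrier ?Q"
    then obtain a s b t where "a \<in> carrier R" "s \<in> nonzerodivisors R" "x = fc a s" "b \<in> carrier R" "t \<in> nonzerodivisors R" "y = fc b t"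
      by (auto simp: tqr_simps(1))
    then show "x \<oplus>\<^bsub>?Q\<^esub> y \<in> carrier ?Q" "x \<oplus>\<^bsub>?Q\<^esub> y = y \<oplus>\<^bsub>?Q\<^esub> x"
      by (auto simp: S a_comm m_comm)
  next
    show "\<zero>\<^bsub>?Q\<^esub> \<in> carrier ?Q" by (auto simp: S)
  next
    fix x y z assume "x \<in> carrier ?Q" "y \<in> carrier ?Q" "z \<in> carrier ?Q"
    then obtain a s b t c u where "a \<in> carrier R" "s \<in> nonzerodivisors R" "x = fc a s" "b \<in> carrier R" "t \<in> nonzerodivisors R" "y = fc b t"
      "c \<in> carrier R" "u \<in> nonzerodivisors R" "z = fc c u"
      by (auto simp: tqr_simps(1))
    then show "x \<oplus>\<^bsub>?Q\<^esub> y \<oplus>\<^bsub>?Q\<^esub> z = x \<oplus>\<^bsub>?Q\<^esub> (y \<oplus>\<^bsub>?Q\<^esub> z)"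
      by (simp add: S l_distr r_distr m_ac a_ac)
  next
    fix x assume "x \<in> carrier ?Q"
    then obtain a s where x: "a \<in> carrier R" "s \<in> nonzerodivisors R" "x = fc a s" by (auto simp: tqr_simps(1))
    then show "\<zero>\<^bsub>?Q\<^esub> \<oplus>\<^bsub>?Q\<^esub> x = x" by (simp add: S)
    have "fc (\<ominus> a) s \<oplus>\<^bsub>?Q\<^esub> x = \<zero>\<^bsub>?Q\<^esub>"
      using x by (simp add: S fc_eq_iff l_minus l_neg)
    then show "\<exists>y\<in>carrier ?Q. y \<oplus>\<^bsub>?Q\<^esub> x = \<zero>\<^bsub>?Q\<^esub>" using x fc_carrier by blast
  qed
  show "comm_monoid ?Q"
  proof (rule comm_monoidI)
    fix x y assume "x \<in> carrier ?Q" "y \<in> carrier ?Q"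
    then obtain a s b t where "a \<in> carrier R" "s \<in> nonzerodivisors R" "x = fc a s" "b \<in> carrier R" "t \<in> nonzerodivisors R" "y = fc b t"
      by (auto simp: tqr_simps(1))
    then show "x \<otimes>\<^bsub>?Q\<^esub> y \<in> carrier ?Q" "x \<otimes>\<^bsub>?Q\<^esub> y = y \<otimes>\<^bsub>?Q\<^esub> x"
      by (auto simp: S m_comm)
  next
    show "\<one>\<^bsub>?Q\<^esub> \<in> carrier ?Q" by (auto simp: S)
  next
    fix x y z assume "x \<in> carrier ?Q" "y \<in> carrier ?Q" "z \<in> carrier ?Q"
    then obtain a s b t c u where "a \<in> carrier R" "s \<in> nonzerodivisors R" "x = fc a s" "b \<in> carrier R" "t \<in> nonzerodivisors R" "y = fc b t"
      "c \<in> carrier R" "u \<in> nonzerodivisors R" "z = fc c u"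
      by (auto simp: tqr_simps(1))
    then show "x \<otimes>\<^bsub>?Q\<^esub> y \<otimes>\<^bsub>?Q\<^esub> z = x \<otimes>\<^bsub>?Q\<^esub> (y \<otimes>\<^bsub>?Q\<^esub> z)"
      by (simp add: S m_assoc)
  next
    fix x assume "x \<in> carrier ?Q"
    then obtain a s where x: "a \<in> carrier R" "s \<in> nonzerodivisors R" "x = fc a s" by (auto simp: tqr_simps(1))
    then show "\<one>\<^bsub>?Q\<^esub> \<otimes>\<^bsub>?Q\<^esub> x = x" by (simp add: S)
  qed
  fix x y z assume "x \<in> carrier ?Q" "y \<in> carrier ?Q" "z \<in> carrier ?Q"
  then obtain a s b t c u where "a \<in> carrier R" "s \<in> nonzerodivisors R" "x = fc a s" "b \<in> carrier R" "t \<in> nonzerodivisors R" "y = fc b t"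
    "c \<in> carrier R" "u \<in> nonzerodivisors R" "z = fc c u"
    by (auto simp: tqr_simps(1))
  then show "(x \<oplus>\<^bsub>?Q\<^esub> y) \<otimes>\<^bsub>?Q\<^esub> z = x \<otimes>\<^bsub>?Q\<^esub> z \<oplus>\<^bsub>?Q\<^esub> y \<otimes>\<^bsub>?Q\<^esub> z"
    by (simp add: S fc_eq_iff l_distr r_distr m_ac)
qed

lemma frac_map_hom: "frac_map R \<in> ring_hom R (total_quotient_ring R)"
  by (rule ring_hom_memI) (auto simp: frac_map_def fc_carrier tqr_simps(2-) frac_mult_fc frac_add_fc nzd_one)

lemma frac_map_zero_iff: "a \<in> carrier R \<Longrightarrow> frac_map R a = \<zero>\<^bsub>total_quotient_ring R\<^esub> \<longleftrightarrow> a = \<zero>"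
  by (simp add: frac_map_def tqr_simps fc_eq_iff nzd_one)

lemma frac_map_unit:
  assumes "s \<in> nonzerodivisors R"
  shows "frac_map R s \<in> Units (total_quotient_ring R)"
proof -
  interpret Q: cring "total_quotient_ring R" by (rule tqr_cring)
  have sc: "s \<in> carrier R" using assms nzd_carr by blast
  have "fc \<one> s \<otimes>\<^bsub>total_quotient_ring R\<^esub> fc s \<one> = \<one>\<^bsub>total_quotient_ring R\<^esub>"
    using assms sc by (simp add: tqr_simps frac_mult_fc nzd_one fc_eq_iff)
  moreover have "fc s \<one> \<otimes>\<^bsub>total_quotient_ring R\<^esub> fc \<one> s = \<one>\<^bsub>total_quotient_ring R\<^esub>"
    using assms sc by (simp add: tqr_simps frac_mult_fc nzd_one fc_eq_iff)
  ultimately show ?thesis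
    unfolding frac_map_def Units_def using fc_carrier[OF sc nzd_one] fc_carrier[OF one_closed assms] by blast
qed

lemma frac_map_denominator:
  assumes "y \<in> carrier (total_quotient_ring R)"
  shows "\<exists>s\<in>nonzerodivisors R. \<exists>a\<in>carrier R. frac_map R s \<otimes>\<^bsub>total_quotient_ring R\<^esub> y = frac_map R a"
proof -
  obtain a s where y: "a \<in> carrier R" "s \<in> nonzerodivisors R" "y = fc a s" using assms by (auto simp: tqr_simps(1))
  have "frac_map R s \<otimes>\<^bsub>total_quotient_ring R\<^esub> y = frac_map R a"
    using y nzd_carr[OF y(2)] by (simp add: frac_map_def tqr_simps frac_mult_fc nzd_one fc_eq_iff m_comm)
  then show ?thesis using y by blast
qed

subsection \<open>The nilradical\<close>

lemma nilradical_ideal: "ideal (nilradical R) R"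
proof (rule ideal_criterion)
  show "nilradical R \<subseteq> carrier R" by (auto simp: nilradical_def)
  show "\<zero> \<in> nilradical R" unfolding nilradical_def by (auto intro!: exI[of _ "1::nat"])
next
  fix a b assume "a \<in> nilradical R" "b \<in> nilradical R"
  then obtain k l :: nat where a: "a \<in> carrier R" "a [^] k = \<zero>" and b: "b \<in> carrier R" "b [^] l = \<zero>"
    by (auto simp: nilradical_def)
  \<comment> \<open>Replaces the binomial theorem: the factors \<open>a + b\<close> are distributed
    one after the other, and in total degree at least \<open>k + l\<close> every resulting monomial
    contains \<open>a^k\<close> or \<open>b^l\<close>.\<close>
  have "k + l \<le> i + j + e \<Longrightarrow> a [^] i \<otimes> b [^] j \<otimes> (a \<oplus> b) [^] e = \<zero>" for e i j :: nat
  proof (induct e arbitrary: i j)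
    case 0
    then have "k \<le> i \<or> l \<le> j" by linarith
    then show ?case
    proof
      assume "k \<le> i"
      then have "a [^] i = \<zero>" using nat_pow_mult[OF a(1), of k "i - k"] a by simp
      then show ?thesis using a b by simp
    next
      assume "l \<le> j"
      then have "b [^] j = \<zero>" using nat_pow_mult[OF b(1), of l "j - l"] b by simp
      then show ?thesis using a b by simp
    qed
  next
    case (Suc e)
    have 1: "a [^] Suc i \<otimes> b [^] j \<otimes> (a \<oplus> b) [^] e = \<zero>" by (rule Suc.hyps) (use Suc.prems in simp)
    have 2: "a [^] i \<otimes> b [^] Suc j \<otimes> (a \<oplus> b) [^] e = \<zero>" by (rule Suc.hyps) (use Suc.prems in simp)
    define A B C where "A = a [^] i" and "B = b [^] j" and "C = (a \<oplus> b) [^] e"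
    have cc: "A \<in> carrier R" "B \<in> carrier R" "C \<in> carrier R" using a b by (auto simp: A_def B_def C_def)
    have "A \<otimes> B \<otimes> (C \<otimes> (a \<oplus> b)) = (A \<otimes> a) \<otimes> B \<otimes> C \<oplus> A \<otimes> (B \<otimes> b) \<otimes> C"
      using cc a(1) b(1) by (simp add: l_distr r_distr m_ac)
    then show ?case using 1 2 by (simp add: A_def B_def C_def)
  qed
  from this[of 0 0 "k + l"] have "(a \<oplus> b) [^] (k + l) = \<zero>" using a b by simp
  then show "a \<oplus> b \<in> nilradical R" using a b by (auto simp: nilradical_def)
next
  fix a r assume "a \<in> nilradical R" and r: "r \<in> carrier R"
  then obtain k :: nat where a: "a \<in> carrier R" "a [^] k = \<zero>" by (auto simp: nilradical_def)
  have "(r \<otimes> a) [^] k = \<zero>" using a r by (simp add: nat_pow_distrib)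
  then show "r \<otimes> a \<in> nilradical R" using a r by (auto simp: nilradical_def)
qed

end

subsection \<open>Integral elements\<close>

text \<open>The abstract situation: \<^term>\<open>S\<close> is the total quotient ring of \<^term>\<open>R\<close> modulo its
  nilradical, \<^term>\<open>h\<close> is the canonical map, and \<^term>\<open>T\<close> represents the residue field.\<close>

locale frac_setup = ring_hom_cring R S h + noetherian_ring R
  for R (structure) and S (structure) and h :: "'a \<Rightarrow> 'c" +
  fixes m T :: "'a set"
  assumes max_m: "maximalideal m R"
    and max_unique: "maximalideal M R \<Longrightarrow> M = m"
    and T_fin: "finite T" and T_carr: "T \<subseteq> carrier R"
    and T_repr: "r \<in> carrier R \<Longrightarrow> \<exists>\<tau>\<in>T. r \<ominus> \<tau> \<in> m"
    and T_distinct: "\<tau> \<in> T \<Longrightarrow> \<tau>' \<in> T \<Longrightarrow> \<tau> \<noteq> \<tau>' \<Longrightarrow> \<tau> \<ominus> \<tau>' \<notin> m"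
    and dim: "primeideal P R \<Longrightarrow> primeideal P' R \<Longrightarrow> P' \<subset> P \<Longrightarrow> P = m"
    and ker: "x \<in> carrier R \<Longrightarrow> h x = \<zero>\<^bsub>S\<^esub> \<longleftrightarrow> (\<exists>k::nat. x [^] k = \<zero>)"
    and frac: "y \<in> carrier S \<Longrightarrow> \<exists>d\<in>carrier R. h d \<in> Units S \<and> (\<exists>r\<in>carrier R. h d \<otimes>\<^bsub>S\<^esub> y = h r)"
    and nzd: "d \<in> carrier R \<Longrightarrow> (\<And>r. r \<in> carrier R \<Longrightarrow> h d \<otimes>\<^bsub>S\<^esub> h r = \<zero>\<^bsub>S\<^esub> \<Longrightarrow> h r = \<zero>\<^bsub>S\<^esub>) \<Longrightarrow> h d \<in> Units S"
begin

abbreviation mult_S (infixl \<open>\<otimes>\<^sub>S\<close> 70) where "x \<otimes>\<^sub>S y \<equiv> x \<otimes>\<^bsub>S\<^esub> y"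
abbreviation add_S (infixl \<open>\<oplus>\<^sub>S\<close> 65) where "x \<oplus>\<^sub>S y \<equiv> x \<oplus>\<^bsub>S\<^esub> y"
abbreviation minus_S (infixl \<open>\<ominus>\<^sub>S\<close> 65) where "x \<ominus>\<^sub>S y \<equiv> x \<ominus>\<^bsub>S\<^esub> y"
abbreviation pow_S (infixr \<open>[^]\<^sub>S\<close> 75) where "x [^]\<^sub>S k \<equiv> x [^]\<^bsub>S\<^esub> (k::nat)"
abbreviation zero_S (\<open>\<zero>\<^sub>S\<close>) where "\<zero>\<^sub>S \<equiv> \<zero>\<^bsub>S\<^esub>"
abbreviation one_S (\<open>\<one>\<^sub>S\<close>) where "\<one>\<^sub>S \<equiv> \<one>\<^bsub>S\<^esub>"

lemma m_ideal: "ideal m R"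
  using max_m by (rule maximalideal.axioms)

lemma m_carr: "x \<in> m \<Longrightarrow> x \<in> carrier R"
  using m_ideal R.ideal_sub by blast

lemma one_notin_m: "\<one> \<notin> m"
  using ideal.one_imp_carrier[OF m_ideal] maximalideal.I_notcarr[OF max_m] by blast

lemma proper_ideal_subset_m: "ideal B R \<Longrightarrow> \<one> \<notin> B \<Longrightarrow> B \<subseteq> m"
  using R.exists_maximalideal_supset max_unique by blast

lemma unit_iff_notin_m: "x \<in> carrier R \<Longrightarrow> x \<in> Units R \<longleftrightarrow> x \<notin> m"
proof
  assume x: "x \<in> carrier R" "x \<in> Units R"
  show "x \<notin> m"
  proof
    assume "x \<in> m"
    then have "inv x \<otimes> x \<in> m" using R.ideal_mult_mem[OF m_ideal _ R.Units_inv_closed[OF x(2)]] by blast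
    then show False using x one_notin_m by simp
  qed
next
  assume x: "x \<in> carrier R" "x \<notin> m"
  then have "\<one> \<in> PIdl x"
    using proper_ideal_subset_m[OF R.cgenideal_ideal] R.cgenideal_self by blast
  then obtain r where "r \<in> carrier R" "\<one> = r \<otimes> x" unfolding cgenideal_def by blast
  then show "x \<in> Units R" using x unfolding Units_def by (auto simp: R.m_comm intro!: bexI[of _ r])
qed

lemma one_not_zero_S: "\<one>\<^sub>S \<noteq> \<zero>\<^sub>S"
proof
  assume "\<one>\<^sub>S = \<zero>\<^sub>S"
  then have "h \<one> = \<zero>\<^sub>S" by simp
  then obtain k :: nat where "\<one> [^] k = \<zero>" using ker by blast
  then have "\<one> = \<zero>" by simp
  then show False using one_notin_m R.ideal_zero_mem[OF m_ideal] by simp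
qed

text \<open>Equivalently, \<open>d\<close> is a nonzerodivisor modulo the nilradical.\<close>

definition reg :: "'a \<Rightarrow> bool" where
  "reg d \<longleftrightarrow> d \<in> carrier R \<and> h d \<in> Units S"

lemma regD: "reg d \<Longrightarrow> d \<in> carrier R" "reg d \<Longrightarrow> h d \<in> Units S"
  by (auto simp: reg_def)

lemma reg_mult: "reg d \<Longrightarrow> reg e \<Longrightarrow> reg (d \<otimes> e)"
  by (simp add: reg_def)

lemma reg_pow: "reg d \<Longrightarrow> reg (d [^] (k::nat))"
  by (induct k) (auto simp: reg_def)

lemma reg_one: "reg \<one>"
  by (simp add: reg_def)

lemma reg_unit: "u \<in> Units R \<Longrightarrow> reg u"
proof -
  assume u: "u \<in> Units R"
  then have "h (inv u) \<otimes>\<^sub>S h u = \<one>\<^sub>S" using hom_mult[of "inv u" u] R.Units_closed by simp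
  moreover have "h (inv u) \<otimes>\<^sub>S h u = h u \<otimes>\<^sub>S h (inv u)"
    using u R.Units_closed by (simp add: S.m_comm)
  ultimately have "h u \<in> Units S"
    using u R.Units_closed unfolding Units_def[of S] by (auto intro!: bexI[of _ "h (inv u)"])
  then show ?thesis using u R.Units_closed by (simp add: reg_def)
qed

lemma regE:
  assumes "y \<in> carrier S"
  obtains d r where "reg d" "r \<in> carrier R" "h d \<otimes>\<^sub>S y = h r"
  using frac[OF assms] by (auto simp: reg_def)

text \<open>The almost integral elements, that is, the complete integral closure of the image of
  \<open>R\<close> in \<open>S\<close>. Agreement with integrality is
  \<open>RB_iff_integral\<close>.\<close>

definition RB :: "'c set" where
  "RB = {y \<in> carrier S. \<exists>d. reg d \<and> (\<forall>k::nat. h d \<otimes>\<^sub>S y [^]\<^sub>S k \<in> h ` carrier R)}"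

lemma RB_carr: "y \<in> RB \<Longrightarrow> y \<in> carrier S"
  by (simp add: RB_def)

text \<open>Used for ideals \<open>B\<close> with a regular element: such an ideal is a faithful
  module on which \<open>y\<close> acts, and it is finitely generated because \<open>R\<close> is
  Noetherian.\<close>

definition stable :: "'a set \<Rightarrow> 'c \<Rightarrow> bool" where
  "stable B y \<longleftrightarrow> (\<forall>b\<in>B. \<exists>b'\<in>B. y \<otimes>\<^sub>S h b = h b')"

lemma stable_pow:
  assumes "B \<subseteq> carrier R" "stable B y" "y \<in> carrier S" "b \<in> B"
  shows "\<exists>b'\<in>B. y [^]\<^sub>S (k::nat) \<otimes>\<^sub>S h b = h b'"
proof (induct k)
  case 0
  then show ?case using assms by (auto intro!: bexI[of _ b])
next
  case (Suc k)
  then obtain b' where b': "b' \<in> B" "y [^]\<^sub>S k \<otimes>\<^sub>S h b = h b'" by blast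
  obtain b'' where b'': "b'' \<in> B" "y \<otimes>\<^sub>S h b' = h b''" using assms(2) b'(1) unfolding stable_def by blast
  have hb: "h b \<in> carrier S" using assms by auto
  have "y [^]\<^sub>S Suc k \<otimes>\<^sub>S h b = y \<otimes>\<^sub>S (y [^]\<^sub>S k \<otimes>\<^sub>S h b)"
    using assms(3) hb by (simp add: S.m_ac)
  then show ?case using b' b'' by auto
qed

lemma RB_if_stable:
  assumes "B \<subseteq> carrier R" "stable B y" "y \<in> carrier S" "d \<in> B" "reg d"
  shows "y \<in> RB"
proof -
  have "h d \<otimes>\<^sub>S y [^]\<^sub>S k \<in> h ` carrier R" for k :: nat
  proof -
    obtain b' where "b' \<in> B" "y [^]\<^sub>S k \<otimes>\<^sub>S h d = h b'" using stable_pow[OF assms(1-4)] by blast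
    moreover have "h d \<otimes>\<^sub>S y [^]\<^sub>S k = y [^]\<^sub>S k \<otimes>\<^sub>S h d"
      using assms regD by (simp add: S.m_comm)
    ultimately show ?thesis using assms(1) by auto
  qed
  then show ?thesis unfolding RB_def using assms by blast
qed

text \<open>One ideal for several elements at once is what makes \<open>RB\<close> closed under sums
  and products. A new element \<open>y\<close> is accommodated by shrinking the ideal to the
  elements on which all powers of \<open>y\<close> act within it; the earlier elements commute with
  \<open>y\<close> and so preserve the smaller ideal as well.\<close>

lemma exists_stable_ideal:
  assumes "finite F" "F \<subseteq> RB"
  shows "\<exists>B. ideal B R \<and> (\<exists>d\<in>B. reg d) \<and> (\<forall>y\<in>F. stable B y)"
  using assms
proof (induct F)
  case empty
  show ?case using R.oneideal reg_one by (intro exI[of _ "carrier R"]) auto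
next
  case (insert y F)
  then obtain B d where B: "ideal B R" and d: "d \<in> B" "reg d" and st: "\<And>f. f \<in> F \<Longrightarrow> stable B f" by auto
  have Bc: "\<And>b. b \<in> B \<Longrightarrow> b \<in> carrier R" using R.ideal_sub[OF B] by blast
  have yc: "y \<in> carrier S" using insert RB_carr by auto
  have ykc: "y [^]\<^sub>S k \<in> carrier S" for k :: nat using yc by simp
  \<comment> \<open>Including the power \<open>0\<close> keeps the image of \<open>B'\<close> inside
    the image of \<open>B\<close>.\<close>
  define B' where "B' = {b \<in> carrier R. \<forall>k::nat. \<exists>b'\<in>B. y [^]\<^sub>S k \<otimes>\<^sub>S h b = h b'}"
  have B'D: "\<exists>b'\<in>B. y [^]\<^sub>S k \<otimes>\<^sub>S h b = h b'" if "b \<in> B'" for b and k :: nat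
    using that by (simp add: B'_def)
  have B'I: "ideal B' R"
  proof (rule R.ideal_criterion)
    show "B' \<subseteq> carrier R" by (auto simp: B'_def)
    show "\<zero> \<in> B'" using R.ideal_zero_mem[OF B] ykc by (auto simp: B'_def intro!: bexI[of _ \<zero>])
  next
    fix a b assume a: "a \<in> B'" and b: "b \<in> B'"
    have "\<exists>b'\<in>B. y [^]\<^sub>S k \<otimes>\<^sub>S h (a \<oplus> b) = h b'" for k :: nat
    proof -
      obtain a' b' where "a' \<in> B" "b' \<in> B" "y [^]\<^sub>S k \<otimes>\<^sub>S h a = h a'" "y [^]\<^sub>S k \<otimes>\<^sub>S h b = h b'"
        using a b unfolding B'_def by blast
      then show ?thesis using a b ykc Bc R.ideal_add_mem[OF B]
        by (auto simp: B'_def S.r_distr intro!: bexI[of _ "a' \<oplus> b'"])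
    qed
    then show "a \<oplus> b \<in> B'" using a b by (simp add: B'_def)
  next
    fix a r assume a: "a \<in> B'" and r: "r \<in> carrier R"
    have "\<exists>b'\<in>B. y [^]\<^sub>S k \<otimes>\<^sub>S h (r \<otimes> a) = h b'" for k :: nat
    proof -
      obtain a' where a': "a' \<in> B" "y [^]\<^sub>S k \<otimes>\<^sub>S h a = h a'"
        using a unfolding B'_def by blast
      have "y [^]\<^sub>S k \<otimes>\<^sub>S h (r \<otimes> a) = h r \<otimes>\<^sub>S (y [^]\<^sub>S k \<otimes>\<^sub>S h a)"
        using a r ykc by (simp add: B'_def S.m_lcomm)
      also have "\<dots> = h (r \<otimes> a')" using a' r Bc by simp
      finally show ?thesis using R.ideal_mult_mem[OF B a'(1) r] by blast
    qed
    then show "r \<otimes> a \<in> B'" using a r by (simp add: B'_def)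
  qed
  have sub: "h b \<in> h ` B" if b: "b \<in> B'" for b
  proof -
    obtain b' where "b' \<in> B" "y [^]\<^sub>S (0::nat) \<otimes>\<^sub>S h b = h b'" using B'D[OF b] by blast
    then show ?thesis using b by (auto simp: B'_def)
  qed
  obtain e where e: "reg e" "\<And>k::nat. h e \<otimes>\<^sub>S y [^]\<^sub>S k \<in> h ` carrier R"
    using insert unfolding RB_def by blast
  \<comment> \<open>The factor \<open>e\<close> clears the denominators of all powers of
    \<open>y\<close>, and the factor \<open>d\<close> brings the result into
    \<open>B\<close>.\<close>
  have "d \<otimes> e \<in> B'"
  proof -
    have "\<exists>b'\<in>B. y [^]\<^sub>S k \<otimes>\<^sub>S h (d \<otimes> e) = h b'" for k :: nat
    proof -
      obtain r where r: "r \<in> carrier R" "h e \<otimes>\<^sub>S y [^]\<^sub>S k = h r" using e(2) by blast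
      have "y [^]\<^sub>S k \<otimes>\<^sub>S h (d \<otimes> e) = h d \<otimes>\<^sub>S (h e \<otimes>\<^sub>S y [^]\<^sub>S k)"
        using d e(1) ykc regD by (simp add: S.m_ac)
      also have "\<dots> = h (r \<otimes> d)" using r d regD by (simp add: S.m_comm)
      finally show ?thesis using R.ideal_mult_mem[OF B d(1) r(1)] by blast
    qed
    then show ?thesis using d e(1) regD by (simp add: B'_def)
  qed
  moreover have "reg (d \<otimes> e)" by (rule reg_mult[OF d(2) e(1)])
  moreover have "stable B' y" unfolding stable_def
  proof
    fix b assume b: "b \<in> B'"
    obtain b1 where b1: "b1 \<in> B" "y [^]\<^sub>S (1::nat) \<otimes>\<^sub>S h b = h b1" using B'D[OF b] by blast
    have hb: "h b \<in> carrier S" using b by (simp add: B'_def)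
    have "b1 \<in> B'"
    proof -
      have "\<exists>b'\<in>B. y [^]\<^sub>S k \<otimes>\<^sub>S h b1 = h b'" for k :: nat
      proof -
        have "y [^]\<^sub>S k \<otimes>\<^sub>S h b1 = y [^]\<^sub>S Suc k \<otimes>\<^sub>S h b"
          using b1(2) yc hb by (simp add: S.m_assoc flip: b1(2))
        then show ?thesis using B'D[OF b, of "Suc k"] by simp
      qed
      then show ?thesis using b1 Bc by (simp add: B'_def)
    qed
    then show "\<exists>b'\<in>B'. y \<otimes>\<^sub>S h b = h b'" using b1(2) yc by auto
  qed
  moreover have "stable B' f" if f: "f \<in> F" for f unfolding stable_def
  proof
    fix b assume b: "b \<in> B'"
    have fc: "f \<in> carrier S" using f insert RB_carr by auto
    have hb: "h b \<in> carrier S" using b by (simp add: B'_def)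
    obtain b0 where b0: "b0 \<in> B" "h b = h b0" using sub[OF b] by blast
    obtain b1 where b1: "b1 \<in> B" "f \<otimes>\<^sub>S h b0 = h b1" using st[OF f] b0(1) unfolding stable_def by blast
    have "b1 \<in> B'"
    proof -
      have "\<exists>b'\<in>B. y [^]\<^sub>S k \<otimes>\<^sub>S h b1 = h b'" for k :: nat
      proof -
        obtain b' where b': "b' \<in> B" "y [^]\<^sub>S k \<otimes>\<^sub>S h b = h b'" using B'D[OF b] by blast
        have "y [^]\<^sub>S k \<otimes>\<^sub>S h b1 = f \<otimes>\<^sub>S (y [^]\<^sub>S k \<otimes>\<^sub>S h b)"
          using fc hb ykc b0(2) by (simp add: S.m_lcomm flip: b1(2))
        then show ?thesis using b' st[OF f] unfolding stable_def by auto
      qed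
      then show ?thesis using b1 Bc by (simp add: B'_def)
    qed
    then show "\<exists>b'\<in>B'. f \<otimes>\<^sub>S h b = h b'" using b1(2) b0(2) by auto
  qed
  ultimately show ?case using B'I by (intro exI[of _ B']) blast
qed

lemma h_RB: "r \<in> carrier R \<Longrightarrow> h r \<in> RB"
  by (rule RB_if_stable[of "carrier R" _ \<one>]) (auto simp: stable_def reg_one simp flip: hom_mult)

lemma RB_add: "y \<in> RB \<Longrightarrow> z \<in> RB \<Longrightarrow> y \<oplus>\<^sub>S z \<in> RB"
  and RB_mult: "y \<in> RB \<Longrightarrow> z \<in> RB \<Longrightarrow> y \<otimes>\<^sub>S z \<in> RB"
proof -
  assume yz: "y \<in> RB" "z \<in> RB"
  then obtain B d where B: "ideal B R" and d: "d \<in> B" "reg d" and st: "stable B y" "stable B z"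
    using exists_stable_ideal[of "{y, z}"] by auto
  have Bc: "B \<subseteq> carrier R" using R.ideal_sub[OF B] .
  have c: "y \<in> carrier S" "z \<in> carrier S" using yz RB_carr by auto
  have "stable B (y \<oplus>\<^sub>S z)" unfolding stable_def
  proof
    fix b assume b: "b \<in> B"
    obtain b1 b2 where "b1 \<in> B" "b2 \<in> B" "y \<otimes>\<^sub>S h b = h b1" "z \<otimes>\<^sub>S h b = h b2"
      using st b unfolding stable_def by blast
    then show "\<exists>b'\<in>B. (y \<oplus>\<^sub>S z) \<otimes>\<^sub>S h b = h b'"
      using c b Bc R.ideal_add_mem[OF B, of b1 b2] by (intro bexI[of _ "b1 \<oplus> b2"]) (auto simp: S.l_distr subset_eq)
  qed
  then show "y \<oplus>\<^sub>S z \<in> RB" using RB_if_stable[OF Bc _ _ d] c by simp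
  have "stable B (y \<otimes>\<^sub>S z)" unfolding stable_def
  proof
    fix b assume b: "b \<in> B"
    obtain b2 where b2: "b2 \<in> B" "z \<otimes>\<^sub>S h b = h b2" using st b unfolding stable_def by blast
    obtain b1 where b1: "b1 \<in> B" "y \<otimes>\<^sub>S h b2 = h b1" using st b2(1) unfolding stable_def by blast
    have "(y \<otimes>\<^sub>S z) \<otimes>\<^sub>S h b = h b1"
      using b1 b2 c b Bc by (simp add: S.m_assoc subset_eq)
    then show "\<exists>b'\<in>B. (y \<otimes>\<^sub>S z) \<otimes>\<^sub>S h b = h b'" using b1 by blast
  qed
  then show "y \<otimes>\<^sub>S z \<in> RB" using RB_if_stable[OF Bc _ _ d] c by simp
qed

lemma RB_zero: "\<zero>\<^sub>S \<in> RB" and RB_one: "\<one>\<^sub>S \<in> RB"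
  using h_RB[of \<zero>] h_RB[of \<one>] by auto

lemma RB_neg: "y \<in> RB \<Longrightarrow> \<ominus>\<^bsub>S\<^esub> y \<in> RB"
proof -
  assume y: "y \<in> RB"
  have "h (\<ominus> \<one>) \<otimes>\<^sub>S y \<in> RB" by (rule RB_mult[OF h_RB y]) simp
  then show ?thesis using RB_carr[OF y] by (simp add: S.l_minus)
qed

lemma RB_minus: "y \<in> RB \<Longrightarrow> z \<in> RB \<Longrightarrow> y \<ominus>\<^sub>S z \<in> RB"
  by (simp add: a_minus_def RB_add RB_neg)

lemma RB_pow: "y \<in> RB \<Longrightarrow> y [^]\<^sub>S (k::nat) \<in> RB"
  by (induct k) (auto simp: RB_one RB_mult)

abbreviation RBr where "RBr \<equiv> S\<lparr>carrier := RB\<rparr>"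

lemma RBr_cring: "cring RBr"
proof -
  have "subring RB S"
    by (rule S.subringI) (auto simp: RB_carr RB_one RB_neg RB_mult RB_add)
  then have "subcring RB S" by (rule S.subcringI')
  then show ?thesis using S.subcring_iff[of RB] RB_carr by blast
qed

sublocale RBr: cring RBr by (rule RBr_cring)

lemma maxRB:
  assumes M: "maximalideal M RBr"
  shows maxRB_sub: "M \<subseteq> RB" and maxRB_zero: "\<zero>\<^sub>S \<in> M"
    and maxRB_add: "\<And>a b. a \<in> M \<Longrightarrow> b \<in> M \<Longrightarrow> a \<oplus>\<^sub>S b \<in> M"
    and maxRB_mult: "\<And>a r. a \<in> M \<Longrightarrow> r \<in> RB \<Longrightarrow> r \<otimes>\<^sub>S a \<in> M"
    and maxRB_one: "\<one>\<^sub>S \<notin> M"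
    and maxRB_prime: "\<And>a b. a \<in> RB \<Longrightarrow> b \<in> RB \<Longrightarrow> a \<otimes>\<^sub>S b \<in> M \<Longrightarrow> a \<in> M \<or> b \<in> M"
    and maxRB_minus: "\<And>a b. a \<in> M \<Longrightarrow> b \<in> M \<Longrightarrow> a \<ominus>\<^sub>S b \<in> M"
    and maxRB_inv: "\<And>a. a \<in> RB \<Longrightarrow> a \<notin> M \<Longrightarrow> \<exists>r\<in>RB. r \<otimes>\<^sub>S a \<ominus>\<^sub>S \<one>\<^sub>S \<in> M"
proof -
  have I: "ideal M RBr" using M by (rule maximalideal.axioms)
  show sub: "M \<subseteq> RB" using RBr.ideal_sub[OF I] by simp
  show "\<zero>\<^sub>S \<in> M" using RBr.ideal_zero_mem[OF I] by simp
  show add: "\<And>a b. a \<in> M \<Longrightarrow> b \<in> M \<Longrightarrow> a \<oplus>\<^sub>S b \<in> M" using RBr.ideal_add_mem[OF I] by simp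
  show mult: "\<And>a r. a \<in> M \<Longrightarrow> r \<in> RB \<Longrightarrow> r \<otimes>\<^sub>S a \<in> M" using RBr.ideal_mult_mem[OF I] by simp
  show "\<one>\<^sub>S \<notin> M" using ideal.one_imp_carrier[OF I] maximalideal.I_notcarr[OF M] by auto
  show "\<And>a b. a \<in> RB \<Longrightarrow> b \<in> RB \<Longrightarrow> a \<otimes>\<^sub>S b \<in> M \<Longrightarrow> a \<in> M \<or> b \<in> M"
    using primeideal.I_prime[OF RBr.maximalideal_prime[OF M]] by simp
  show minus: "a \<ominus>\<^sub>S b \<in> M" if "a \<in> M" "b \<in> M" for a b
  proof -
    have c: "a \<in> carrier S" "b \<in> carrier S" using that sub RB_carr by auto
    have "(\<ominus>\<^bsub>S\<^esub> \<one>\<^sub>S) \<otimes>\<^sub>S b \<in> M" using mult[OF that(2) RB_neg[OF RB_one]] .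
    then have "a \<oplus>\<^sub>S (\<ominus>\<^bsub>S\<^esub> \<one>\<^sub>S) \<otimes>\<^sub>S b \<in> M" using add that by blast
    then show ?thesis using c by (simp add: S.l_minus a_minus_def)
  qed
  fix a assume a: "a \<in> RB" "a \<notin> M"
  obtain r where r: "r \<in> RB" "r \<otimes>\<^sub>S a \<ominus>\<^bsub>RBr\<^esub> \<one>\<^sub>S \<in> M"
    using RBr.maximalideal_inverse_mod[OF M, of a] a by auto
  \<comment> \<open>Negation in \<open>RBr\<close> is not by definition that of \<open>S\<close>;
    adding \<open>1\<close> back gives an identity that involves only the shared addition.\<close>
  define e where "e = r \<otimes>\<^sub>S a \<ominus>\<^bsub>RBr\<^esub> \<one>\<^sub>S"
  have e: "e \<in> M" using r e_def by simp
  have ra: "r \<otimes>\<^sub>S a \<in> RB" using r a RB_mult by simp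
  have "e \<oplus>\<^bsub>RBr\<^esub> \<one>\<^bsub>RBr\<^esub> = r \<otimes>\<^sub>S a"
    unfolding e_def a_minus_def using ra RBr.l_neg[OF RBr.one_closed]
      RBr.a_assoc[OF _ RBr.a_inv_closed[OF RBr.one_closed] RBr.one_closed, of "r \<otimes>\<^sub>S a"]
      RBr.r_zero[of "r \<otimes>\<^sub>S a"] by simp
  then have "r \<otimes>\<^sub>S a = e \<oplus>\<^sub>S \<one>\<^sub>S" by simp
  moreover have "e \<oplus>\<^sub>S \<one>\<^sub>S \<ominus>\<^sub>S \<one>\<^sub>S = e"
  proof -
    have ec: "e \<in> carrier S" using e sub RB_carr by auto
    then show ?thesis by (simp add: S.ring_nf)
  qed
  ultimately show "\<exists>r\<in>RB. r \<otimes>\<^sub>S a \<ominus>\<^sub>S \<one>\<^sub>S \<in> M"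
    using e r(1) by (intro bexI[of _ r]) simp_all
qed

end

lemma (in ring_hom_cring) comb_hom:
  assumes "A \<subseteq> carrier R" "\<And>k. k < p \<Longrightarrow> \<beta> k \<in> carrier R" "u \<in> R.comb A \<beta> p"
  shows "h u \<in> S.comb (h ` A) (\<lambda>k. h (\<beta> k)) p"
  using assms(3)
proof (induct rule: R.comb.induct)
  case zero
  then show ?case by (simp add: S.comb.zero)
next
  case (gen c k)
  then show ?case using S.comb.gen[of "h c" "h ` A" k p "\<lambda>k. h (\<beta> k)"] assms by auto
next
  case (add u v)
  have "u \<in> carrier R" "v \<in> carrier R"
    using R.comb_carrier[OF assms(1,2) add(1)] R.comb_carrier[OF assms(1,2) add(3)] by auto
  then show ?case using add by (auto intro: S.comb.add)
qed

lemma (in cring) comb_mono: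
  assumes "A \<subseteq> B" "u \<in> comb A \<beta> p"
  shows "u \<in> comb B \<beta> p"
  using assms(2) by (induct rule: comb.induct) (use assms(1) in \<open>auto intro: comb.intros\<close>)

lemma (in noetherian_ring) ideal_generators:
  assumes "ideal B R"
  obtains \<beta> and p :: nat where "\<And>k. k < p \<Longrightarrow> \<beta> k \<in> carrier R" "B = Idl (\<beta> ` {..<p})"
proof -
  obtain A where A: "A \<subseteq> carrier R" "finite A" "B = Idl A" using finetely_gen[OF assms] by blast
  obtain \<beta> where "bij_betw \<beta> {0..<card A} A" using ex_bij_betw_nat_finite[OF A(2)] by blast
  then have e: "A = \<beta> ` {..<card A}" by (auto simp: bij_betw_def lessThan_atLeast0)
  then show thesis using A that[of "card A" \<beta>] by auto
qed

inductive_set (in frac_setup) span :: "'c \<Rightarrow> nat \<Rightarrow> 'c set" for y :: 'c and t :: nat where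
  zero: "\<zero>\<^sub>S \<in> span y t"
| gen: "r \<in> carrier R \<Longrightarrow> j < t \<Longrightarrow> h r \<otimes>\<^sub>S y [^]\<^sub>S j \<in> span y t"
| add: "u \<in> span y t \<Longrightarrow> v \<in> span y t \<Longrightarrow> u \<oplus>\<^sub>S v \<in> span y t"

context frac_setup
begin

lemma span_carr: "y \<in> carrier S \<Longrightarrow> u \<in> span y t \<Longrightarrow> u \<in> carrier S"
  by (rotate_tac, induct rule: span.induct) auto

lemma span_pow: "j < t \<Longrightarrow> y \<in> carrier S \<Longrightarrow> y [^]\<^sub>S j \<in> span y t"
  using span.gen[of \<one> j t y] by simp

lemma span_scale: "y \<in> carrier S \<Longrightarrow> u \<in> span y t \<Longrightarrow> r \<in> carrier R \<Longrightarrow> h r \<otimes>\<^sub>S u \<in> span y t"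
proof -
  assume y: "y \<in> carrier S" and u: "u \<in> span y t" and r: "r \<in> carrier R"
  from u show ?thesis
  proof (induct rule: span.induct)
    case zero then show ?case using r by (simp add: span.zero)
  next
    case (gen s j)
    have "h r \<otimes>\<^sub>S (h s \<otimes>\<^sub>S y [^]\<^sub>S j) = h (r \<otimes> s) \<otimes>\<^sub>S y [^]\<^sub>S j" using gen r y by (simp add: S.m_assoc)
    then show ?case using span.gen[of "r \<otimes> s" j t y] gen r by simp
  next
    case (add u v)
    then show ?case using r span_carr[OF y] by (simp add: S.r_distr span.add)
  qed
qed

lemma span_minus:
  assumes "y \<in> carrier S" "u \<in> span y t" "v \<in> span y t"
  shows "u \<ominus>\<^sub>S v \<in> span y t"
proof -
  have "h (\<ominus> \<one>) \<otimes>\<^sub>S v \<in> span y t" by (rule span_scale) (use assms in auto)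
  then have "u \<oplus>\<^sub>S h (\<ominus> \<one>) \<otimes>\<^sub>S v \<in> span y t" by (rule span.add[OF assms(2)])
  then show ?thesis using span_carr[OF assms(1) assms(3)] by (simp add: S.l_minus a_minus_def)
qed

lemma span_mult_gen:
  assumes y: "y \<in> carrier S" and z: "z \<in> carrier S" "\<And>j. j < t \<Longrightarrow> z \<otimes>\<^sub>S y [^]\<^sub>S j \<in> span y t'"
    and u: "u \<in> span y t"
  shows "z \<otimes>\<^sub>S u \<in> span y t'"
  using u
proof (induct rule: span.induct)
  case zero then show ?case using z by (simp add: span.zero)
next
  case (gen s j)
  have "z \<otimes>\<^sub>S (h s \<otimes>\<^sub>S y [^]\<^sub>S j) = h s \<otimes>\<^sub>S (z \<otimes>\<^sub>S y [^]\<^sub>S j)" using gen z y by (simp add: S.m_lcomm)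
  then show ?case using span_scale[OF y z(2)[OF gen(2)] gen(1)] by simp
next
  case (add u v)
  then show ?case using z span_carr[OF y] by (simp add: S.r_distr span.add)
qed

lemma span_mult:
  assumes y: "y \<in> carrier S" and u: "u \<in> span y k" and v: "v \<in> span y l"
  shows "u \<otimes>\<^sub>S v \<in> span y (k + l)"
proof (rule span_mult_gen[OF y span_carr[OF y u] _ v])
  fix j assume j: "j < l"
  have "y [^]\<^sub>S j \<otimes>\<^sub>S u \<in> span y (k + l)"
  proof (rule span_mult_gen[OF y _ _ u])
    fix i assume i: "i < k"
    show "y [^]\<^sub>S j \<otimes>\<^sub>S y [^]\<^sub>S i \<in> span y (k + l)"
      using span_pow[of "j + i" "k + l" y] i j y by (simp add: S.nat_pow_mult)
  qed (use y in simp)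
  then show "u \<otimes>\<^sub>S y [^]\<^sub>S j \<in> span y (k + l)" using span_carr[OF y u] y by (simp add: S.m_comm)
qed

lemma span_x:
  assumes y: "y \<in> carrier S" and u: "u \<in> span y k"
  shows "y \<otimes>\<^sub>S u \<in> span y (Suc k)"
proof (rule span_mult_gen[OF y y _ u])
  fix i assume "i < k"
  then show "y \<otimes>\<^sub>S y [^]\<^sub>S i \<in> span y (Suc k)" using span_pow[of "Suc i" "Suc k" y] y by (simp add: S.m_comm)
qed

lemma span_denominator:
  assumes y: "y \<in> carrier S"
  shows "\<exists>d. reg d \<and> (\<forall>u\<in>span y t. h d \<otimes>\<^sub>S u \<in> h ` carrier R)"
proof -
  obtain a b where a: "reg a" and b: "b \<in> carrier R" and e: "h a \<otimes>\<^sub>S y = h b" using regE[OF y] by blast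
  have ac: "a \<in> carrier R" using regD a by blast
  have "h (a [^] t) \<otimes>\<^sub>S u \<in> h ` carrier R" if "u \<in> span y t" for u
    using that
  proof (induct rule: span.induct)
    case zero
    then show ?case using ac image_eqI[of "\<zero>\<^sub>S" h \<zero>] by simp
  next
    case (gen r j)
    have "h (a [^] t) = h (a [^] (t - j)) \<otimes>\<^sub>S h a [^]\<^sub>S j"
      using gen ac by (simp add: S.nat_pow_mult)
    then have "h (a [^] t) \<otimes>\<^sub>S (h r \<otimes>\<^sub>S y [^]\<^sub>S j) = h (a [^] (t - j)) \<otimes>\<^sub>S h r \<otimes>\<^sub>S (h a \<otimes>\<^sub>S y) [^]\<^sub>S j"
      using gen ac y by (simp add: S.nat_pow_distrib S.m_ac)
    also have "\<dots> = h (a [^] (t - j) \<otimes> r \<otimes> b [^] j)" using gen ac b e by simp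
    finally show ?case by (rule image_eqI) (use gen ac b in simp)
  next
    case (add u v)
    then obtain r s where "r \<in> carrier R" "s \<in> carrier R" "h (a [^] t) \<otimes>\<^sub>S u = h r" "h (a [^] t) \<otimes>\<^sub>S v = h s" by blast
    then have "h (a [^] t) \<otimes>\<^sub>S (u \<oplus>\<^sub>S v) = h (r \<oplus> s)" "r \<oplus> s \<in> carrier R"
      using add span_carr[OF y] ac by (simp_all add: S.r_distr)
    then show ?case by blast
  qed
  then show ?thesis using reg_pow[OF a] by blast
qed

text \<open>The condition \<open>t >= 1\<close> puts \<open>1\<close> into the span, so all powers
  of \<open>z\<close> remain inside it and share its common denominator.\<close>

lemma RB_if_span_stable:
  assumes y: "y \<in> carrier S" and z: "z \<in> carrier S" and t: "t \<ge> 1"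
    and st: "\<And>j. j < t \<Longrightarrow> z \<otimes>\<^sub>S y [^]\<^sub>S j \<in> span y t"
  shows "z \<in> RB"
proof -
  obtain d where d: "reg d" "\<And>u. u \<in> span y t \<Longrightarrow> h d \<otimes>\<^sub>S u \<in> h ` carrier R"
    using span_denominator[OF y] by blast
  have "z [^]\<^sub>S k \<in> span y t" for k :: nat
  proof (induct k)
    case 0
    then show ?case using span_pow[of 0 t y] t y by simp
  next
    case (Suc k)
    have "z \<otimes>\<^sub>S z [^]\<^sub>S k \<in> span y t" by (rule span_mult_gen[OF y z st Suc])
    then show ?case using z by (simp add: S.m_comm)
  qed
  then show ?thesis unfolding RB_def using d z by blast
qed

text \<open>From left to right, a stable ideal is finitely generated, so
  \<open>monic_annihilator\<close> yields a monic expression in \<open>y\<close> that kills it; the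
  regular element of the ideal forces that expression to be zero. Conversely, an integral equation
  makes the span of the lower powers stable under \<open>y\<close>.\<close>

lemma RB_iff_integral:
  assumes y: "y \<in> carrier S"
  shows "y \<in> RB \<longleftrightarrow> (\<exists>t\<ge>1. y [^]\<^sub>S (t::nat) \<in> span y t)"
proof
  assume "\<exists>t\<ge>1. y [^]\<^sub>S (t::nat) \<in> span y t"
  then obtain t :: nat where t: "t \<ge> 1" "y [^]\<^sub>S t \<in> span y t" by blast
  show "y \<in> RB"
  proof (rule RB_if_span_stable[OF y y t(1)])
    fix j assume j: "j < t"
    have e: "y \<otimes>\<^sub>S y [^]\<^sub>S j = y [^]\<^sub>S Suc j" using y by (simp add: S.m_comm)
    show "y \<otimes>\<^sub>S y [^]\<^sub>S j \<in> span y t"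
    proof (cases "Suc j = t")
      case True
      then show ?thesis unfolding e using t by simp
    next
      case False
      then show ?thesis unfolding e using span_pow[of "Suc j" t y] j y by simp
    qed
  qed
next
  assume yRB: "y \<in> RB"
  then obtain B d where B: "ideal B R" and d: "d \<in> B" "reg d" and st: "stable B y"
    using exists_stable_ideal[of "{y}"] by auto
  obtain \<beta> and p :: nat where \<beta>: "\<And>k. k < p \<Longrightarrow> \<beta> k \<in> carrier R" and BE: "B = Idl (\<beta> ` {..<p})"
    using ideal_generators[OF B] by blast
  interpret lower_terms S "span y" y
  proof unfold_locales
    fix k show "span y k \<subseteq> carrier S" using span_carr[OF y] by blast
  qed (use y in \<open>auto intro: span.zero span_minus span_mult span_x\<close>)
  have hB: "h b \<in> S.comb (h ` carrier R) (\<lambda>k. h (\<beta> k)) p" if "b \<in> B" for b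
    using comb_hom[of "carrier R" p \<beta> b] \<beta> R.genideal_subset_comb[of p \<beta>] that BE by blast
  have sub: "h ` carrier R \<subseteq> span y 1"
  proof
    fix z assume "z \<in> h ` carrier R"
    then obtain r where "r \<in> carrier R" "z = h r" by blast
    then show "z \<in> span y 1" using span.gen[of r 0 1 y] by simp
  qed
  have "\<exists>t\<ge>1. \<exists>z'. monic z' t \<and> (\<forall>i<p. z' \<otimes>\<^sub>S h (\<beta> i) = \<zero>\<^sub>S)"
  proof (rule monic_annihilator[OF _ x_monic])
    fix i assume i: "i < p"
    show "h (\<beta> i) \<in> carrier S" using \<beta> i by simp
    have "\<beta> i \<in> B" unfolding BE using R.genideal_self[of "\<beta> ` {..<p}"] \<beta> i by auto
    then obtain b' where "b' \<in> B" "y \<otimes>\<^sub>S h (\<beta> i) = h b'" using st unfolding stable_def by blast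
    then show "y \<otimes>\<^sub>S h (\<beta> i) \<in> S.comb (span y 1) (\<lambda>i. h (\<beta> i)) p"
      using S.comb_mono[OF sub hB] by simp
  qed simp
  then obtain t z' where t: "t \<ge> 1" and z: "monic z' t" and ann: "\<And>i. i < p \<Longrightarrow> z' \<otimes>\<^sub>S h (\<beta> i) = \<zero>\<^sub>S" by blast
  have zc: "z' \<in> carrier S" using z by (simp add: monic_def)
  have "z' \<otimes>\<^sub>S h d = \<zero>\<^sub>S"
    by (rule comb_annihilated[OF zc ann _ _ hB[OF d(1)]]) (use \<beta> in auto)
  then have "h d \<otimes>\<^sub>S z' = h d \<otimes>\<^sub>S \<zero>\<^sub>S" using zc regD[OF d(2)] by (simp add: S.m_comm)
  then have "z' = \<zero>\<^sub>S" using zc regD[OF d(2)] S.Units_l_cancel by blast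
  then have "y [^]\<^sub>S t \<in> span y t" using z y by (simp add: monic_def a_minus_def)
  then show "\<exists>t\<ge>1. y [^]\<^sub>S (t::nat) \<in> span y t" using t by blast
qed

text \<open>Lying over. Otherwise \<open>a\<close> has an inverse \<open>b\<close> modulo
  \<open>M\<close>. Multiplying an integral equation of \<open>b\<close> by \<open>a^t\<close>
  writes \<open>(a b)^t\<close> as a sum of terms \<open>r a^(t-j) (a b)^j\<close> with
  \<open>j < t\<close>. Since \<open>a b\<close> is \<open>1\<close> modulo \<open>M\<close>, this
  makes \<open>1\<close> congruent to an element of \<open>m\<close>, and so places the image of a
  unit of \<open>R\<close> in \<open>M\<close>.\<close>

lemma h_m_subset_max:
  assumes M: "maximalideal M RBr" and a: "a \<in> m"
  shows "h a \<in> M"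
proof (rule ccontr)
  assume nin: "h a \<notin> M"
  have ac: "a \<in> carrier R" using a m_carr by blast
  obtain b where b: "b \<in> RB" "b \<otimes>\<^sub>S h a \<ominus>\<^sub>S \<one>\<^sub>S \<in> M"
    using maxRB_inv[OF M h_RB[OF ac] nin] by blast
  have bc: "b \<in> carrier S" using RB_carr b by blast
  define c where "c = h a \<otimes>\<^sub>S b"
  have cc: "c \<in> carrier S" using bc ac by (simp add: c_def)
  have cRB: "c \<in> RB" using b h_RB[OF ac] RB_mult by (simp add: c_def)
  have c1: "c \<ominus>\<^sub>S \<one>\<^sub>S \<in> M" using b bc ac by (simp add: c_def S.m_comm)
  have ck: "c [^]\<^sub>S j \<ominus>\<^sub>S \<one>\<^sub>S \<in> M" for j :: nat
  proof (induct j)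
    case 0
    then show ?case using maxRB_zero[OF M] by (simp add: a_minus_def S.r_neg)
  next
    case (Suc j)
    define e where "e = c [^]\<^sub>S j"
    have ec: "e \<in> carrier S" using cc by (simp add: e_def)
    have "c \<otimes>\<^sub>S (e \<ominus>\<^sub>S \<one>\<^sub>S) \<oplus>\<^sub>S (c \<ominus>\<^sub>S \<one>\<^sub>S) \<in> M"
      using maxRB_add[OF M maxRB_mult[OF M _ cRB] c1] Suc by (simp add: e_def)
    moreover have "c \<otimes>\<^sub>S (e \<ominus>\<^sub>S \<one>\<^sub>S) \<oplus>\<^sub>S (c \<ominus>\<^sub>S \<one>\<^sub>S) = e \<otimes>\<^sub>S c \<ominus>\<^sub>S \<one>\<^sub>S"
      using ec cc by (simp add: S.ring_nf)
    ultimately show ?case by (simp add: e_def)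
  qed
  obtain t :: nat where t: "t \<ge> 1" "b [^]\<^sub>S t \<in> span b t" using RB_iff_integral[OF bc] b by blast
  have "\<exists>r\<in>m. h a [^]\<^sub>S t \<otimes>\<^sub>S u \<ominus>\<^sub>S h r \<in> M" if "u \<in> span b t" for u
    using that
  proof (induct rule: span.induct)
    case zero
    then show ?case using ac maxRB_zero[OF M] R.ideal_zero_mem[OF m_ideal]
      by (intro bexI[of _ \<zero>]) (auto simp: a_minus_def)
  next
    case (gen r j)
    define s where "s = a [^] (t - j) \<otimes> r"
    have sc: "s \<in> carrier R" using ac gen by (simp add: s_def)
    obtain i where i: "t - j = Suc i" using gen by (metis Suc_diff_Suc)
    have "s = (a [^] i \<otimes> r) \<otimes> a" using ac gen by (simp add: s_def i R.m_ac)
    then have sm: "s \<in> m" using R.ideal_mult_mem[OF m_ideal a] ac gen by simp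
    have "h a [^]\<^sub>S t = h a [^]\<^sub>S (t - j) \<otimes>\<^sub>S h a [^]\<^sub>S j"
      using gen ac by (simp add: S.nat_pow_mult)
    then have e: "h a [^]\<^sub>S t \<otimes>\<^sub>S (h r \<otimes>\<^sub>S b [^]\<^sub>S j) = h s \<otimes>\<^sub>S c [^]\<^sub>S j"
      using gen ac bc by (simp add: s_def c_def S.nat_pow_distrib S.m_ac)
    have "h s \<otimes>\<^sub>S (c [^]\<^sub>S j \<ominus>\<^sub>S \<one>\<^sub>S) \<in> M" by (rule maxRB_mult[OF M ck h_RB[OF sc]])
    moreover have "h s \<otimes>\<^sub>S (c [^]\<^sub>S j \<ominus>\<^sub>S \<one>\<^sub>S) = h s \<otimes>\<^sub>S c [^]\<^sub>S j \<ominus>\<^sub>S h s"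
      using sc cc by (simp add: a_minus_def S.r_distr S.r_minus)
    ultimately show ?case using sm e by auto
  next
    case (add u v)
    then obtain r s where rs: "r \<in> m" "s \<in> m" and e: "h a [^]\<^sub>S t \<otimes>\<^sub>S u \<ominus>\<^sub>S h r \<in> M" "h a [^]\<^sub>S t \<otimes>\<^sub>S v \<ominus>\<^sub>S h s \<in> M" by blast
    define A where "A = h a [^]\<^sub>S t"
    define r' where "r' = h r"
    define s' where "s' = h s"
    have cs: "A \<in> carrier S" "u \<in> carrier S" "v \<in> carrier S" "r' \<in> carrier S" "s' \<in> carrier S"
      using ac rs m_carr add span_carr[OF bc] by (auto simp: A_def r'_def s'_def)
    have "(A \<otimes>\<^sub>S u \<ominus>\<^sub>S r') \<oplus>\<^sub>S (A \<otimes>\<^sub>S v \<ominus>\<^sub>S s') \<in> M" using maxRB_add[OF M e] by (simp add: A_def r'_def s'_def)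
    moreover have "(A \<otimes>\<^sub>S u \<ominus>\<^sub>S r') \<oplus>\<^sub>S (A \<otimes>\<^sub>S v \<ominus>\<^sub>S s') = A \<otimes>\<^sub>S (u \<oplus>\<^sub>S v) \<ominus>\<^sub>S (r' \<oplus>\<^sub>S s')"
      using cs by (simp add: S.ring_nf)
    moreover have "r' \<oplus>\<^sub>S s' = h (r \<oplus> s)" using rs m_carr by (simp add: r'_def s'_def)
    ultimately show ?case using R.ideal_add_mem[OF m_ideal rs] A_def by auto
  qed
  from this[OF t(2)] obtain r where r: "r \<in> m" "h a [^]\<^sub>S t \<otimes>\<^sub>S b [^]\<^sub>S t \<ominus>\<^sub>S h r \<in> M" by blast
  have rc: "r \<in> carrier R" using r m_carr by blast
  have e: "h a [^]\<^sub>S t \<otimes>\<^sub>S b [^]\<^sub>S t = c [^]\<^sub>S t" using ac bc by (simp add: c_def S.nat_pow_distrib)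
  define r' where "r' = h r"
  define c' where "c' = c [^]\<^sub>S t"
  have cs: "r' \<in> carrier S" "c' \<in> carrier S" using rc cc by (auto simp: r'_def c'_def)
  have "(c' \<ominus>\<^sub>S r') \<ominus>\<^sub>S (c' \<ominus>\<^sub>S \<one>\<^sub>S) \<in> M" using maxRB_minus[OF M _ ck] r(2) by (simp add: e r'_def c'_def)
  moreover have "(c' \<ominus>\<^sub>S r') \<ominus>\<^sub>S (c' \<ominus>\<^sub>S \<one>\<^sub>S) = \<one>\<^sub>S \<ominus>\<^sub>S r'"
    using cs by (simp add: S.ring_nf)
  moreover have "\<one>\<^sub>S \<ominus>\<^sub>S r' = h (\<one> \<ominus> r)" using rc by (simp add: r'_def a_minus_def)
  ultimately have inM: "h (\<one> \<ominus> r) \<in> M" by simp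
  have "\<one> \<ominus> r \<notin> m"
    using R.ideal_mem_of_minus_mem[OF m_ideal _ r(1) R.one_closed] one_notin_m by blast
  then have u: "\<one> \<ominus> r \<in> Units R" using unit_iff_notin_m[of "\<one> \<ominus> r"] rc by simp
  then have "h (inv (\<one> \<ominus> r)) \<otimes>\<^sub>S h (\<one> \<ominus> r) \<in> M"
    using maxRB_mult[OF M inM h_RB] by blast
  moreover have "h (inv (\<one> \<ominus> r)) \<otimes>\<^sub>S h (\<one> \<ominus> r) = h (inv (\<one> \<ominus> r) \<otimes> (\<one> \<ominus> r))"
    using u R.Units_closed by (intro hom_mult[symmetric]) auto
  ultimately show False using maxRB_one[OF M] u by simp
qed

lemma h_in_max_iff:
  assumes M: "maximalideal M RBr" and r: "r \<in> carrier R"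
  shows "h r \<in> M \<longleftrightarrow> r \<in> m"
proof
  assume hr: "h r \<in> M"
  show "r \<in> m"
  proof (rule ccontr)
    assume "r \<notin> m"
    then have u: "r \<in> Units R" using unit_iff_notin_m r by blast
    then have "h (inv r) \<otimes>\<^sub>S h r \<in> M" using maxRB_mult[OF M hr h_RB] by blast
    moreover have "h (inv r) \<otimes>\<^sub>S h r = h (inv r \<otimes> r)" using u r by (intro hom_mult[symmetric]) auto
    ultimately show False using maxRB_one[OF M] u by simp
  qed
qed (rule h_m_subset_max[OF M])

lemma reg_cancel:
  assumes d: "reg d" and y: "y \<in> carrier S" and e: "h d \<otimes>\<^sub>S y = \<zero>\<^sub>S"
  shows "y = \<zero>\<^sub>S"
proof -
  have "h d \<otimes>\<^sub>S y = h d \<otimes>\<^sub>S \<zero>\<^sub>S" using e regD[OF d] by simp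
  then show ?thesis using S.Units_l_cancel[OF regD(2)[OF d] y S.zero_closed] by blast
qed

lemma h_sq_zero:
  assumes "x \<in> carrier R" "h (x \<otimes> x) = \<zero>\<^sub>S"
  shows "h x = \<zero>\<^sub>S"
proof -
  obtain k :: nat where "(x \<otimes> x) [^] k = \<zero>" using ker[of "x \<otimes> x"] assms by auto
  then have "x [^] (k + k) = \<zero>" using assms(1) by (simp add: R.nat_pow_distrib R.nat_pow_mult)
  then show ?thesis using ker assms(1) by blast
qed

text \<open>The witness maximises the double annihilator of \<open>y \<oplus> \<kappa>\<close>.\<close>

lemma exists_regular_complement:
  assumes y: "y \<in> carrier R"
  obtains \<kappa> where "\<kappa> \<in> carrier R" "h (y \<otimes> \<kappa>) = \<zero>\<^sub>S" "reg (y \<oplus> \<kappa>)"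
proof -
  define D where "D \<kappa> = {z \<in> carrier R. \<forall>u\<in>carrier R. h (u \<otimes> (y \<oplus> \<kappa>)) = \<zero>\<^sub>S \<longrightarrow> h (u \<otimes> z) = \<zero>\<^sub>S}" for \<kappa>
  define K where "K = {\<kappa> \<in> carrier R. h (y \<otimes> \<kappa>) = \<zero>\<^sub>S}"
  have DI: "ideal (D \<kappa>) R" for \<kappa>
  proof (rule R.ideal_criterion)
    fix a r assume a: "a \<in> D \<kappa>" and r: "r \<in> carrier R"
    have "h (u \<otimes> (r \<otimes> a)) = \<zero>\<^sub>S" if u: "u \<in> carrier R" "h (u \<otimes> (y \<oplus> \<kappa>)) = \<zero>\<^sub>S" for u
    proof -
      have ac: "a \<in> carrier R" and e0: "h (u \<otimes> a) = \<zero>\<^sub>S" using a u unfolding D_def by blast+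
      have "h (u \<otimes> (r \<otimes> a)) = h r \<otimes>\<^sub>S h (u \<otimes> a)" using ac r u(1) by (simp add: S.m_lcomm)
      then show ?thesis using e0 r by (simp del: hom_mult)
    qed
    then show "r \<otimes> a \<in> D \<kappa>" using a r unfolding D_def by blast
  next
    fix a b assume "a \<in> D \<kappa>" "b \<in> D \<kappa>"
    then show "a \<oplus> b \<in> D \<kappa>"
      unfolding D_def by (auto simp: R.r_distr simp del: hom_mult)
  qed (auto simp: D_def)
  have "\<zero> \<in> K" using y by (simp add: K_def)
  then obtain M where M: "M \<in> D ` K" "\<And>X. X \<in> D ` K \<Longrightarrow> M \<subseteq> X \<Longrightarrow> X = M"
    using exists_maximal_in_family[of "D ` K"] DI by blast
  then obtain \<kappa> where \<kappa>: "\<kappa> \<in> K" "M = D \<kappa>" by blast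
  have kc: "\<kappa> \<in> carrier R" "h (y \<otimes> \<kappa>) = \<zero>\<^sub>S" using \<kappa> by (auto simp: K_def)
  have "h (y \<oplus> \<kappa>) \<in> Units S"
  proof (rule nzd)
    show "y \<oplus> \<kappa> \<in> carrier R" using y kc by simp
    fix u assume u: "u \<in> carrier R" and e: "h (y \<oplus> \<kappa>) \<otimes>\<^sub>S h u = \<zero>\<^sub>S"
    define Y where "Y = h y"
    define k where "k = h \<kappa>"
    define U where "U = h u"
    have c: "Y \<in> carrier S" "k \<in> carrier S" "U \<in> carrier S" using y kc u by (auto simp: Y_def k_def U_def)
    have e: "(Y \<oplus>\<^sub>S k) \<otimes>\<^sub>S U = \<zero>\<^sub>S" using e y kc by (simp add: Y_def k_def U_def)
    have yk: "Y \<otimes>\<^sub>S k = \<zero>\<^sub>S" using kc y by (simp add: Y_def k_def)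
    \<comment> \<open>The image of \<open>R\<close> is reduced, so a product vanishes as soon as its
      square does; the same device is used for \<open>V U\<close> below.\<close>
    have "(Y \<otimes>\<^sub>S U) \<otimes>\<^sub>S (Y \<otimes>\<^sub>S U) = U \<otimes>\<^sub>S (Y \<otimes>\<^sub>S ((Y \<oplus>\<^sub>S k) \<otimes>\<^sub>S U)) \<ominus>\<^sub>S U \<otimes>\<^sub>S U \<otimes>\<^sub>S (Y \<otimes>\<^sub>S k)"
      using c by (simp add: S.ring_nf)
    also have "\<dots> = \<zero>\<^sub>S" unfolding e yk using c by (simp add: a_minus_def)
    finally have "h (y \<otimes> u) = \<zero>\<^sub>S" using h_sq_zero[of "y \<otimes> u"] y u by (simp add: Y_def U_def)
    then have YU: "Y \<otimes>\<^sub>S U = \<zero>\<^sub>S" using y u by (simp add: Y_def U_def)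
    have "k \<otimes>\<^sub>S U = (Y \<oplus>\<^sub>S k) \<otimes>\<^sub>S U \<ominus>\<^sub>S Y \<otimes>\<^sub>S U" using c by (simp add: S.ring_nf)
    then have kU: "k \<otimes>\<^sub>S U = \<zero>\<^sub>S" unfolding e YU by (simp add: a_minus_def)
    \<comment> \<open>An annihilator \<open>u\<close> of \<open>y + \<kappa>\<close> may be added to
      \<open>\<kappa>\<close>, and this does not shrink the double annihilator. Maximality then puts
      \<open>u\<close> into \<open>D \<kappa>\<close>, so \<open>u\<close> annihilates itself and
      its image is zero.\<close>
    have ku: "\<kappa> \<oplus> u \<in> K"
      using kc u y YU yk c by (simp add: K_def S.r_distr Y_def U_def k_def)
    have key: "h (v \<otimes> u) = \<zero>\<^sub>S \<and> h (v \<otimes> (y \<oplus> \<kappa>)) = \<zero>\<^sub>S"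
      if v: "v \<in> carrier R" "h (v \<otimes> (y \<oplus> (\<kappa> \<oplus> u))) = \<zero>\<^sub>S" for v
    proof -
      define V where "V = h v"
      have Vc: "V \<in> carrier S" using v by (simp add: V_def)
      have ev: "V \<otimes>\<^sub>S (Y \<oplus>\<^sub>S (k \<oplus>\<^sub>S U)) = \<zero>\<^sub>S" using v y kc u by (simp add: V_def Y_def U_def k_def)
      have "(V \<otimes>\<^sub>S U) \<otimes>\<^sub>S (V \<otimes>\<^sub>S U) = V \<otimes>\<^sub>S U \<otimes>\<^sub>S (V \<otimes>\<^sub>S (Y \<oplus>\<^sub>S (k \<oplus>\<^sub>S U))) \<ominus>\<^sub>S V \<otimes>\<^sub>S V \<otimes>\<^sub>S (Y \<otimes>\<^sub>S U) \<ominus>\<^sub>S V \<otimes>\<^sub>S V \<otimes>\<^sub>S (k \<otimes>\<^sub>S U)"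
        using c Vc by (simp add: S.ring_nf)
      also have "\<dots> = \<zero>\<^sub>S" unfolding ev YU kU using c Vc by (simp add: a_minus_def)
      finally have vu: "h (v \<otimes> u) = \<zero>\<^sub>S" using h_sq_zero[of "v \<otimes> u"] v u by (simp add: V_def U_def)
      then have VU: "V \<otimes>\<^sub>S U = \<zero>\<^sub>S" using v u by (simp add: V_def U_def)
      have "V \<otimes>\<^sub>S (Y \<oplus>\<^sub>S k) = V \<otimes>\<^sub>S (Y \<oplus>\<^sub>S (k \<oplus>\<^sub>S U)) \<ominus>\<^sub>S V \<otimes>\<^sub>S U"
        using c Vc by (simp add: S.ring_nf)
      also have "\<dots> = \<zero>\<^sub>S" unfolding ev VU by (simp add: a_minus_def)
      finally show ?thesis using vu v y kc by (simp add: V_def Y_def k_def)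
    qed
    have "D \<kappa> \<subseteq> D (\<kappa> \<oplus> u)"
    proof
      fix z assume z: "z \<in> D \<kappa>"
      have "h (v \<otimes> z) = \<zero>\<^sub>S" if "v \<in> carrier R" "h (v \<otimes> (y \<oplus> (\<kappa> \<oplus> u))) = \<zero>\<^sub>S" for v
        using key[OF that] z that(1) unfolding D_def by blast
      then show "z \<in> D (\<kappa> \<oplus> u)" using z unfolding D_def by blast
    qed
    then have "D (\<kappa> \<oplus> u) = D \<kappa>" using M(2)[of "D (\<kappa> \<oplus> u)"] ku \<kappa>(2) by blast
    moreover have "u \<in> D (\<kappa> \<oplus> u)" using key u unfolding D_def by blast
    ultimately have "u \<in> D \<kappa>" by simp
    moreover have "h (u \<otimes> (y \<oplus> \<kappa>)) = \<zero>\<^sub>S" using e u y kc c by (simp add: Y_def k_def U_def S.m_comm)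
    ultimately have "h (u \<otimes> u) = \<zero>\<^sub>S" using u unfolding D_def by blast
    then show "h u = \<zero>\<^sub>S" by (rule h_sq_zero[OF u])
  qed
  then show thesis using that[of \<kappa>] kc y by (simp add: reg_def)
qed

subsection \<open>Regular elements have finite quotients\<close>

text \<open>A regular element lies in no minimal prime. The products \<open>a^i s\<close> with
  \<open>s\<close> outside \<open>P\<close> form a multiplicative set, which misses zero because
  \<open>a\<close> is regular and nilpotents lie in \<open>P\<close>. An ideal maximal among those
  disjoint from it is prime, is contained in \<open>P\<close> and omits \<open>a\<close>.\<close>

lemma smaller_prime_avoiding:
  assumes P: "primeideal P R" and a: "a \<in> P" "reg a"
  obtains P' where "primeideal P' R" "P' \<subset> P"
proof -
  have PI: "ideal P R" using P by (rule primeideal.axioms)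
  have ac: "a \<in> carrier R" using regD a by blast
  have oneP: "\<one> \<notin> P" using ideal.one_imp_carrier[OF PI] primeideal.I_notcarr[OF P] by blast
  have Pprime: "x \<in> P \<or> z \<in> P" if "x \<in> carrier R" "z \<in> carrier R" "x \<otimes> z \<in> P" for x z
    by (rule primeideal.I_prime[OF P that])
  define F where "F = {I. ideal I R \<and> (\<forall>i::nat. \<forall>s\<in>carrier R - P. a [^] i \<otimes> s \<notin> I)}"
  have powP: "s \<in> P" if "s \<in> carrier R" "s [^] (k::nat) \<in> P" for s k
    using that(2)
  proof (induct k)
    case (Suc k)
    then show ?case using Pprime[of "s [^] k" s] that(1) by auto
  qed (use oneP in simp)
  have "a [^] i \<otimes> s \<noteq> \<zero>" if s: "s \<in> carrier R - P" for i :: nat and s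
  proof
    assume "a [^] i \<otimes> s = \<zero>"
    moreover have "h (a [^] i) \<otimes>\<^sub>S h s = h (a [^] i \<otimes> s)"
      by (rule hom_mult[symmetric]) (use s ac in auto)
    ultimately have "h (a [^] i) \<otimes>\<^sub>S h s = \<zero>\<^sub>S" by (simp only: hom_zero)
    then have "h s = \<zero>\<^sub>S" using reg_cancel[OF reg_pow[OF a(2)]] s by blast
    then obtain k :: nat where "s [^] k = \<zero>" using ker[of s] s by blast
    then have "s \<in> P" using powP[of s k] s R.ideal_zero_mem[OF PI] by simp
    then show False using s by simp
  qed
  then have "{\<zero>} \<in> F" using R.zeroideal by (simp add: F_def)
  then have F0: "F \<noteq> {}" by blast
  have FI: "\<And>I. I \<in> F \<Longrightarrow> ideal I R" by (simp add: F_def)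
  obtain P' where P': "P' \<in> F" and max: "\<And>X. X \<in> F \<Longrightarrow> P' \<subseteq> X \<Longrightarrow> X = P'"
    using exists_maximal_in_family[OF F0 FI] by blast
  have I': "ideal P' R" and av: "\<And>(i::nat) s. s \<in> carrier R \<Longrightarrow> s \<notin> P \<Longrightarrow> a [^] i \<otimes> s \<notin> P'"
    using P' by (auto simp: F_def)
  have meets: "\<exists>(i::nat) s. s \<in> carrier R - P \<and> a [^] i \<otimes> s \<in> R.adjoin P' u" if u: "u \<in> carrier R" "u \<notin> P'" for u
  proof -
    have "R.adjoin P' u \<notin> F"
      using max[of "R.adjoin P' u"] R.adjoin_supset[OF I' u(1)] R.adjoin_mem[OF I' u(1)] u(2) by blast
    then show ?thesis using R.adjoin_ideal[OF I' u(1)] by (auto simp: F_def)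
  qed
  have pr: "primeideal P' R"
  proof (rule primeidealI[OF I' R.is_cring])
    show "carrier R \<noteq> P'" using av[of \<one> 0] oneP by auto
    fix u v assume u: "u \<in> carrier R" and v: "v \<in> carrier R" and uv: "u \<otimes> v \<in> P'"
    show "u \<in> P' \<or> v \<in> P'"
    proof (rule ccontr)
      assume n: "\<not> (u \<in> P' \<or> v \<in> P')"
      obtain i j :: nat and s t where s: "s \<in> carrier R - P" "a [^] i \<otimes> s \<in> R.adjoin P' u"
        and t: "t \<in> carrier R - P" "a [^] j \<otimes> t \<in> R.adjoin P' v" using meets u v n by meson
      obtain p r where p: "p \<in> P'" "r \<in> carrier R" "a [^] i \<otimes> s = p \<oplus> r \<otimes> u"
        using s(2) unfolding R.adjoin_def by blast
      obtain p' r' where p': "p' \<in> P'" "r' \<in> carrier R" "a [^] j \<otimes> t = p' \<oplus> r' \<otimes> v"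
        using t(2) unfolding R.adjoin_def by blast
      have pc: "p \<in> carrier R" "p' \<in> carrier R" "r \<in> carrier R" "r' \<in> carrier R"
        using p p' R.ideal_sub[OF I'] by auto
      have "a [^] (i + j) \<otimes> (s \<otimes> t) = (a [^] i \<otimes> s) \<otimes> (a [^] j \<otimes> t)"
        using ac s t by (simp add: R.m_ac flip: R.nat_pow_mult)
      also have "\<dots> = (p \<oplus> r \<otimes> u) \<otimes> (p' \<oplus> r' \<otimes> v)" using p p' by simp
      also have "\<dots> = (p' \<oplus> r' \<otimes> v) \<otimes> p \<oplus> ((r \<otimes> u) \<otimes> p' \<oplus> (r \<otimes> r') \<otimes> (u \<otimes> v))"
        using pc u v by (simp add: R.ring_nf)
      also have "\<dots> \<in> P'"
        using pc u v by (intro R.ideal_add_mem[OF I'] R.ideal_mult_mem[OF I' p(1)] R.ideal_mult_mem[OF I' p'(1)] R.ideal_mult_mem[OF I' uv]) auto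
      finally have "a [^] (i + j) \<otimes> (s \<otimes> t) \<in> P'" .
      moreover have "s \<otimes> t \<notin> P" using Pprime s t by blast
      ultimately show False using av s t by blast
    qed
  qed
  have "P' \<subseteq> P"
  proof
    fix s assume s: "s \<in> P'"
    then have sc: "s \<in> carrier R" using R.ideal_sub[OF I'] by blast
    show "s \<in> P"
    proof (rule ccontr)
      assume "s \<notin> P"
      then have "a [^] (0::nat) \<otimes> s \<notin> P'" using av sc by blast
      then show False using s sc by simp
    qed
  qed
  moreover have "a \<notin> P'" using av[of \<one> 1] oneP ac by simp
  ultimately have "P' \<subset> P" using a by blast
  then show thesis using that pr by blast
qed

text \<open>Representatives may repeat classes, so such sets for two quotients can be combined
  without choosing a transversal.\<close>

definition fin_quot :: "'a set \<Rightarrow> bool" where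
  "fin_quot B \<longleftrightarrow> (\<exists>E. finite E \<and> E \<subseteq> carrier R \<and> (\<forall>r\<in>carrier R. \<exists>e\<in>E. r \<ominus> e \<in> B))"

text \<open>An ideal maximal among those with infinite quotient is prime.\<close>

lemma fin_quot_regular:
  assumes a: "reg a"
  shows "fin_quot (PIdl a)"
proof (rule ccontr)
  assume nf: "\<not> fin_quot (PIdl a)"
  have ac: "a \<in> carrier R" using regD a by blast
  define F where "F = {B. ideal B R \<and> a \<in> B \<and> \<not> fin_quot B}"
  have "PIdl a \<in> F" using nf R.cgenideal_ideal[OF ac] R.cgenideal_self[OF ac] by (simp add: F_def)
  then have F0: "F \<noteq> {}" by blast
  have FI: "\<And>I. I \<in> F \<Longrightarrow> ideal I R" by (simp add: F_def)
  obtain B where B: "B \<in> F" and max: "\<And>X. X \<in> F \<Longrightarrow> B \<subseteq> X \<Longrightarrow> X = B"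
    using exists_maximal_in_family[OF F0 FI] by blast
  have BI: "ideal B R" and aB: "a \<in> B" and nB: "\<not> fin_quot B" using B by (auto simp: F_def)
  have bigger: "fin_quot X" if "ideal X R" "B \<subseteq> X" "z \<in> X" "z \<notin> B" for X z
    using max[of X] that aB by (auto simp: F_def)
  have pr: "primeideal B R"
  proof (rule primeidealI[OF BI R.is_cring])
    have "fin_quot (carrier R)" unfolding fin_quot_def by (intro exI[of _ "{\<zero>}"]) auto
    then show "carrier R \<noteq> B" using nB by auto
    fix x y assume x: "x \<in> carrier R" and y: "y \<in> carrier R" and xy: "x \<otimes> y \<in> B"
    show "x \<in> B \<or> y \<in> B"
    proof (rule ccontr)
      assume n: "\<not> (x \<in> B \<or> y \<in> B)"
      \<comment> \<open>\<open>C\<close> is the colon ideal \<open>(B : x)\<close>. The quotient by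
        \<open>B\<close> is assembled from those by \<open>B + xR\<close> and by \<open>C\<close>,
        both strictly larger than \<open>B\<close> and hence of finite index.\<close>
      define C where "C = {z \<in> carrier R. x \<otimes> z \<in> B}"
      have CI: "ideal C R" unfolding C_def by (rule ideal.helper_max_prime[OF BI R.is_cring x])
      have "fin_quot (R.adjoin B x)"
        using bigger[OF R.adjoin_ideal[OF BI x] R.adjoin_supset[OF BI x] R.adjoin_mem[OF BI x]] n by blast
      then obtain E1 where E1: "finite E1" "E1 \<subseteq> carrier R" "\<And>r. r \<in> carrier R \<Longrightarrow> \<exists>e\<in>E1. r \<ominus> e \<in> R.adjoin B x"
        unfolding fin_quot_def by blast
      have "B \<subseteq> C" using R.ideal_mult_mem[OF BI _ x] R.ideal_sub[OF BI] by (auto simp: C_def)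
      moreover have "y \<in> C" using y xy by (simp add: C_def)
      ultimately have "fin_quot C" using bigger[OF CI] n by blast
      then obtain E2 where E2: "finite E2" "E2 \<subseteq> carrier R" "\<And>r. r \<in> carrier R \<Longrightarrow> \<exists>e\<in>E2. r \<ominus> e \<in> C"
        unfolding fin_quot_def by blast
      have "\<exists>e\<in>(\<lambda>(e1, e2). e1 \<oplus> x \<otimes> e2) ` (E1 \<times> E2). r \<ominus> e \<in> B" if r: "r \<in> carrier R" for r
      proof -
        obtain e1 where e1: "e1 \<in> E1" "r \<ominus> e1 \<in> R.adjoin B x" using E1(3)[OF r] by blast
        then obtain b c where b: "b \<in> B" and c: "c \<in> carrier R" and e: "r \<ominus> e1 = b \<oplus> c \<otimes> x"
          unfolding R.adjoin_def by blast
        obtain e2 where e2: "e2 \<in> E2" "c \<ominus> e2 \<in> C" using E2(3)[OF c] by blast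
        have cc: "e1 \<in> carrier R" "e2 \<in> carrier R" "b \<in> carrier R"
          using e1 e2 E1(2) E2(2) b R.ideal_sub[OF BI] by auto
        have "r \<ominus> (e1 \<oplus> x \<otimes> e2) = (r \<ominus> e1) \<ominus> x \<otimes> e2"
          using r cc x by (simp add: R.ring_nf)
        also have "\<dots> = (b \<oplus> c \<otimes> x) \<ominus> x \<otimes> e2" by (simp add: e)
        also have "\<dots> = b \<oplus> x \<otimes> (c \<ominus> e2)" using r cc x c by (simp add: R.ring_nf)
        also have "\<dots> \<in> B" using R.ideal_add_mem[OF BI b] e2(2) by (simp add: C_def)
        finally show ?thesis using e1(1) e2(1) by force
      qed
      moreover have "(\<lambda>(e1, e2). e1 \<oplus> x \<otimes> e2) ` (E1 \<times> E2) \<subseteq> carrier R" using E1(2) E2(2) x by (auto simp: subset_eq)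
      moreover have "finite ((\<lambda>(e1, e2). e1 \<oplus> x \<otimes> e2) ` (E1 \<times> E2))" using E1(1) E2(1) by simp
      ultimately have "fin_quot B" unfolding fin_quot_def by blast
      then show False using nB by simp
    qed
  qed
  \<comment> \<open>A prime containing a regular element is not minimal, so in dimension one it is
    \<open>m\<close>, whose quotient is the finite residue field.\<close>
  obtain P' where "primeideal P' R" "P' \<subset> B" using smaller_prime_avoiding[OF pr aB a] .
  then have "B = m" using dim[OF pr] by blast
  moreover have "fin_quot m" unfolding fin_quot_def using T_fin T_carr T_repr by blast
  ultimately show False using nB by simp
qed

text \<open>The representatives modulo \<open>a\<close> serve as digits of truncated
  \<open>a\<close>-adic expansions: \<open>s\<close> digits cover all classes modulo
  \<open>a^s\<close>.\<close>

lemma regular_power_representatives: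
  assumes a: "reg a"
  obtains L :: nat where "L \<ge> 1"
    "\<And>s::nat. \<exists>E. finite E \<and> E \<subseteq> carrier R \<and> card E \<le> L ^ s \<and> (\<forall>r\<in>carrier R. \<exists>e\<in>E. \<exists>b\<in>carrier R. r = e \<oplus> a [^] s \<otimes> b)"
proof -
  have ac: "a \<in> carrier R" using regD a by blast
  obtain E where E: "finite E" "E \<subseteq> carrier R" "\<And>r. r \<in> carrier R \<Longrightarrow> \<exists>e\<in>E. r \<ominus> e \<in> PIdl a"
    using fin_quot_regular[OF a] unfolding fin_quot_def by blast
  have Er: "\<exists>e\<in>E. \<exists>b\<in>carrier R. r = e \<oplus> a \<otimes> b" if r: "r \<in> carrier R" for r
  proof -
    obtain e b where e: "e \<in> E" and b: "b \<in> carrier R" and eq: "r \<ominus> e = b \<otimes> a"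
      using E(3)[OF r] unfolding cgenideal_def by blast
    have ec: "e \<in> carrier R" using e E by blast
    have "r = e \<oplus> (r \<ominus> e)" using r ec by (simp add: R.ring_nf)
    then have "r = e \<oplus> a \<otimes> b" using eq b ac by (simp add: R.m_comm)
    then show ?thesis using e b by blast
  qed
  have "card E \<ge> 1" using Er[OF R.zero_closed] E(1) by (auto simp: Suc_le_eq card_gt_0_iff)
  moreover have "\<exists>E'. finite E' \<and> E' \<subseteq> carrier R \<and> card E' \<le> card E ^ s \<and> (\<forall>r\<in>carrier R. \<exists>e\<in>E'. \<exists>b\<in>carrier R. r = e \<oplus> a [^] s \<otimes> b)" for s :: nat
  proof (induct s)
    case 0
    have "\<forall>r\<in>carrier R. \<exists>e\<in>{\<zero>}. \<exists>b\<in>carrier R. r = e \<oplus> a [^] (0::nat) \<otimes> b" by auto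
    then show ?case by (intro exI[of _ "{\<zero>}"]) auto
  next
    case (Suc s)
    then obtain E' where E': "finite E'" "E' \<subseteq> carrier R" "card E' \<le> card E ^ s"
      "\<And>r. r \<in> carrier R \<Longrightarrow> \<exists>e\<in>E'. \<exists>b\<in>carrier R. r = e \<oplus> a [^] s \<otimes> b" by blast
    define G where "G = (\<lambda>(e, e'). e \<oplus> a \<otimes> e') ` (E \<times> E')"
    have "finite G" unfolding G_def using E E' by simp
    moreover have "G \<subseteq> carrier R" unfolding G_def using E(2) E'(2) ac by (auto simp: subset_eq)
    moreover have "card G \<le> card E ^ Suc s"
    proof -
      have "card G \<le> card (E \<times> E')" unfolding G_def using E E' by (intro card_image_le) simp
      also have "\<dots> \<le> card E * card E ^ s" using E'(3) by (simp add: card_cartesian_product)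
      finally show ?thesis by simp
    qed
    moreover have "\<exists>e\<in>G. \<exists>b\<in>carrier R. r = e \<oplus> a [^] Suc s \<otimes> b" if r: "r \<in> carrier R" for r
    proof -
      obtain e b where e: "e \<in> E" and b: "b \<in> carrier R" and eq: "r = e \<oplus> a \<otimes> b" using Er[OF r] by blast
      obtain e' b' where e': "e' \<in> E'" and b': "b' \<in> carrier R" and eq': "b = e' \<oplus> a [^] s \<otimes> b'" using E'(4)[OF b] by blast
      define y where "y = a [^] s"
      have cc: "e \<in> carrier R" "e' \<in> carrier R" "y \<in> carrier R" using e e' E(2) E'(2) ac by (auto simp: y_def)
      have "r = (e \<oplus> a \<otimes> e') \<oplus> (y \<otimes> a) \<otimes> b'"
        unfolding eq eq' y_def[symmetric] using cc b' ac by (simp add: R.ring_nf)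
      then have "r = (e \<oplus> a \<otimes> e') \<oplus> a [^] Suc s \<otimes> b'" by (simp add: y_def)
      moreover have "e \<oplus> a \<otimes> e' \<in> G" unfolding G_def using e e' by auto
      ultimately show ?thesis using b' by blast
    qed
    ultimately show ?case by blast
  qed
  ultimately show thesis using that[of "card E"] by blast
qed

section \<open>Polynomial relations with a unit coefficient\<close>

text \<open>The value is the sum of \<open>g i y^(k-1-i)\<close> over \<open>i < k\<close>, so
  \<open>g 0\<close> is the leading coefficient. The partial sums of a vanishing polynomial are the
  integral elements needed later.\<close>

fun horner :: "(nat \<Rightarrow> 'a) \<Rightarrow> 'c \<Rightarrow> nat \<Rightarrow> 'c" where
  "horner g y 0 = \<zero>\<^sub>S"
| "horner g y (Suc k) = y \<otimes>\<^sub>S horner g y k \<oplus>\<^sub>S h (g k)"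

text \<open>The homogenised polynomial, the sum of \<open>g i a^i b^(k-1-i)\<close> over
  \<open>i < k\<close>; it tests a relation for the fraction \<open>y = b/a\<close> inside
  \<open>R\<close>.\<close>

fun hom_horner :: "(nat \<Rightarrow> 'a) \<Rightarrow> 'a \<Rightarrow> 'a \<Rightarrow> nat \<Rightarrow> 'a" where
  "hom_horner g a b 0 = \<zero>"
| "hom_horner g a b (Suc k) = b \<otimes> hom_horner g a b k \<oplus> g k \<otimes> a [^] k"

lemma horner_carr: "y \<in> carrier S \<Longrightarrow> (\<And>i. i < k \<Longrightarrow> g i \<in> carrier R) \<Longrightarrow> horner g y k \<in> carrier S"
  by (induct k) auto

lemma hom_horner_carr:
  "a \<in> carrier R \<Longrightarrow> b \<in> carrier R \<Longrightarrow> (\<And>i. i < k \<Longrightarrow> g i \<in> carrier R) \<Longrightarrow> hom_horner g a b k \<in> carrier R"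
  by (induct k) auto

lemma hom_horner_diff:
  assumes ab: "a \<in> carrier R" "b \<in> carrier R"
  shows "(\<And>i. i < k \<Longrightarrow> g i \<in> carrier R) \<Longrightarrow> (\<And>i. i < k \<Longrightarrow> g' i \<in> carrier R) \<Longrightarrow>
    hom_horner (\<lambda>i. g i \<ominus> g' i) a b k = hom_horner g a b k \<ominus> hom_horner g' a b k"
proof (induct k)
  case 0
  then show ?case by (simp add: a_minus_def)
next
  case (Suc k)
  define G G' y c c' where "G = hom_horner g a b k" and "G' = hom_horner g' a b k" and "y = a [^] k"
    and "c = g k" and "c' = g' k"
  have cc: "G \<in> carrier R" "G' \<in> carrier R" "y \<in> carrier R" "c \<in> carrier R" "c' \<in> carrier R"
    using Suc.prems ab by (auto simp: G_def G'_def y_def c_def c'_def intro!: hom_horner_carr)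
  have "b \<otimes> (G \<ominus> G') \<oplus> (c \<ominus> c') \<otimes> y = (b \<otimes> G \<oplus> c \<otimes> y) \<ominus> (b \<otimes> G' \<oplus> c' \<otimes> y)"
    using cc ab by (simp add: R.ring_nf)
  then show ?case using Suc by (simp add: G_def G'_def y_def c_def c'_def)
qed

lemma hom_horner_scale:
  assumes ab: "a \<in> carrier R" "b \<in> carrier R" and c: "c \<in> carrier R"
  shows "(\<And>i. i < k \<Longrightarrow> g i \<in> carrier R) \<Longrightarrow> (\<And>i. i < k \<Longrightarrow> g' i = c \<otimes> g i) \<Longrightarrow>
    hom_horner g' a b k = c \<otimes> hom_horner g a b k"
proof (induct k)
  case 0
  then show ?case using c by simp
next
  case (Suc k)
  define G y d where "G = hom_horner g a b k" and "y = a [^] k" and "d = g k"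
  have cc: "G \<in> carrier R" "y \<in> carrier R" "d \<in> carrier R"
    using Suc.prems ab by (auto simp: G_def y_def d_def intro!: hom_horner_carr)
  have "b \<otimes> (c \<otimes> G) \<oplus> (c \<otimes> d) \<otimes> y = c \<otimes> (b \<otimes> G \<oplus> d \<otimes> y)"
    using cc ab c by (simp add: R.ring_nf)
  then show ?case using Suc by (simp add: G_def y_def d_def)
qed

lemma hom_horner_horner:
  assumes ab: "a \<in> carrier R" "b \<in> carrier R" and y: "y \<in> carrier S" and e: "h a \<otimes>\<^sub>S y = h b"
  shows "(\<And>i. i \<le> k \<Longrightarrow> g i \<in> carrier R) \<Longrightarrow>
    h (hom_horner g a b (Suc k)) = h (a [^] k) \<otimes>\<^sub>S horner g y (Suc k)"
proof (induct k)
  case 0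
  then show ?case using ab y by simp
next
  case (Suc k)
  define A H c z where "A = h (a [^] k)" and "H = horner g y (Suc k)" and "c = h (g (Suc k))" and "z = h a"
  have cc: "A \<in> carrier S" "H \<in> carrier S" "c \<in> carrier S" "z \<in> carrier S"
    using Suc.prems ab y horner_carr[OF y, of "Suc k" g] by (auto simp: A_def H_def c_def z_def)
  have gc: "hom_horner g a b (Suc k) \<in> carrier R"
    using Suc.prems by (intro hom_horner_carr ab) auto
  have "h (hom_horner g a b (Suc (Suc k))) = (z \<otimes>\<^sub>S y) \<otimes>\<^sub>S (A \<otimes>\<^sub>S H) \<oplus>\<^sub>S c \<otimes>\<^sub>S (A \<otimes>\<^sub>S z)"
    using Suc ab gc e by (simp add: A_def H_def c_def z_def del: hom_horner.simps(2) horner.simps(2) add: hom_horner.simps(2)[of _ _ _ "Suc k"])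
  also have "\<dots> = (A \<otimes>\<^sub>S z) \<otimes>\<^sub>S (y \<otimes>\<^sub>S H \<oplus>\<^sub>S c)"
    using cc y by (simp add: S.ring_nf)
  also have "\<dots> = h (a [^] Suc k) \<otimes>\<^sub>S horner g y (Suc (Suc k))"
    using ab by (simp add: A_def H_def c_def z_def)
  finally show ?case .
qed

text \<open>Multiplication by a partial Horner sum preserves the span of \<open>1, y, \<dots>, y\<^bsup>t-1\<^esup>\<close>.\<close>

lemma horner_in_RB:
  assumes y: "y \<in> carrier S" and g: "\<And>i. g i \<in> carrier R" and rel: "horner g y (Suc t) = \<zero>\<^sub>S"
    and t: "t \<ge> 1" and k: "k \<le> Suc t"
  shows "horner g y k \<in> RB"
proof -
  have hc: "horner g y i \<in> carrier S" for i using horner_carr[OF y] g by blast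
  have low: "j + i \<le> t \<Longrightarrow> y [^]\<^sub>S j \<otimes>\<^sub>S horner g y i \<in> span y t" for i j
  proof (induct i arbitrary: j)
    case 0
    then show ?case using y by (simp add: span.zero)
  next
    case (Suc i)
    define H Y c where "H = horner g y i" and "Y = y [^]\<^sub>S j" and "c = h (g i)"
    have cc: "H \<in> carrier S" "Y \<in> carrier S" "c \<in> carrier S" using hc y g by (auto simp: H_def Y_def c_def)
    have "Y \<otimes>\<^sub>S (y \<otimes>\<^sub>S H \<oplus>\<^sub>S c) = (Y \<otimes>\<^sub>S y) \<otimes>\<^sub>S H \<oplus>\<^sub>S c \<otimes>\<^sub>S Y"
      using cc y by (simp add: S.ring_nf)
    moreover have "(Y \<otimes>\<^sub>S y) \<otimes>\<^sub>S H \<in> span y t" using Suc.hyps[of "Suc j"] Suc.prems by (simp add: Y_def H_def)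
    moreover have "c \<otimes>\<^sub>S Y \<in> span y t" using span.gen[of "g i" j t y] g Suc.prems by (simp add: c_def Y_def)
    ultimately show ?case using span.add by (simp add: H_def Y_def c_def)
  qed
  \<comment> \<open>For large exponents direct expansion would leave the span. The recursion is run
    backwards instead, starting from the vanishing full sum and trading a factor \<open>y\<close>
    for the next partial sum.\<close>
  have high: "i \<le> Suc t \<Longrightarrow> j < t \<Longrightarrow> Suc t \<le> j + i \<Longrightarrow> e = Suc t - i \<Longrightarrow> y [^]\<^sub>S j \<otimes>\<^sub>S horner g y i \<in> span y t" for i j e
  proof (induct e arbitrary: i j)
    case 0
    then have "i = Suc t" by simp
    then show ?case using y rel by (simp add: span.zero del: horner.simps)
  next
    case (Suc e)
    then obtain j' where j': "j = Suc j'" by (cases j) auto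
    define H Y c where "H = horner g y i" and "Y = y [^]\<^sub>S j'" and "c = h (g i)"
    have cc: "H \<in> carrier S" "Y \<in> carrier S" "c \<in> carrier S" using hc y g by (auto simp: H_def Y_def c_def)
    have "(Y \<otimes>\<^sub>S y) \<otimes>\<^sub>S H = Y \<otimes>\<^sub>S (y \<otimes>\<^sub>S H \<oplus>\<^sub>S c) \<ominus>\<^sub>S c \<otimes>\<^sub>S Y"
      using cc y by (simp add: S.ring_nf)
    moreover have "Y \<otimes>\<^sub>S (y \<otimes>\<^sub>S H \<oplus>\<^sub>S c) \<in> span y t"
      using Suc.hyps[of "Suc i" j'] Suc.prems j' by (simp add: H_def Y_def c_def)
    moreover have "c \<otimes>\<^sub>S Y \<in> span y t" using span.gen[of "g i" j' t y] g Suc.prems j' by (simp add: c_def Y_def)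
    ultimately show ?case using span_minus[OF y] by (simp add: H_def Y_def j')
  qed
  show ?thesis
  proof (rule RB_if_span_stable[OF y hc t])
    fix j assume j: "j < t"
    have "y [^]\<^sub>S j \<otimes>\<^sub>S horner g y k \<in> span y t"
      using low[of j k] high[OF k j _ refl] by (cases "j + k \<le> t") auto
    then show "horner g y k \<otimes>\<^sub>S y [^]\<^sub>S j \<in> span y t" using hc y by (simp add: S.m_comm)
  qed
qed

lemma add_m_notin_m:
  assumes "u \<in> carrier R" "u \<notin> m" "v \<in> m"
  shows "u \<oplus> v \<notin> m" "u \<ominus> v \<notin> m"
proof -
  have vc: "v \<in> carrier R" using assms m_carr by blast
  show "u \<ominus> v \<notin> m" using R.ideal_mem_of_minus_mem[OF m_ideal _ assms(3) assms(1)] assms by blast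
  show "u \<oplus> v \<notin> m"
  proof
    assume "u \<oplus> v \<in> m"
    then have "(u \<oplus> v) \<ominus> v \<in> m" using R.ideal_minus_mem[OF m_ideal] assms by blast
    moreover have "(u \<oplus> v) \<ominus> v = u" using assms(1) vc by (simp add: R.ring_nf)
    ultimately show False using assms by simp
  qed
qed

text \<open>The elements are the \<open>a\<close>-adic expansions with \<open>r\<close> digits from
  \<open>T\<close>. The exponent \<open>l\<close> is the first place where two expansions differ;
  the cofactor lies outside \<open>m\<close> because distinct digits are incongruent modulo
  \<open>m\<close>.\<close>

lemma many_separated:
  assumes a: "a \<in> m" "reg a"
  shows "\<exists>U. finite U \<and> U \<subseteq> carrier R \<and> card U = card T ^ r \<and>
    (\<forall>u\<in>U. \<forall>v\<in>U. u \<noteq> v \<longrightarrow> (\<exists>l<r. \<exists>w\<in>carrier R - m. u \<ominus> v = a [^] (l::nat) \<otimes> w))"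
proof (induct r)
  case 0
  show ?case by (intro exI[of _ "{\<zero>}"]) auto
next
  case (Suc r)
  then obtain U where U: "finite U" "U \<subseteq> carrier R" "card U = card T ^ r"
    "\<And>u v. u \<in> U \<Longrightarrow> v \<in> U \<Longrightarrow> u \<noteq> v \<Longrightarrow> \<exists>l<r. \<exists>w\<in>carrier R - m. u \<ominus> v = a [^] (l::nat) \<otimes> w" by blast
  have ac: "a \<in> carrier R" using regD a by blast
  define f where "f = (\<lambda>(\<tau>, u). \<tau> \<oplus> a \<otimes> u)"
  have sep: "\<exists>l<Suc r. \<exists>w\<in>carrier R - m. f (\<tau>, u) \<ominus> f (\<tau>', u') = a [^] (l::nat) \<otimes> w"
    if t: "\<tau> \<in> T" "\<tau>' \<in> T" and u: "u \<in> U" "u' \<in> U" and ne: "(\<tau>, u) \<noteq> (\<tau>', u')" for \<tau> \<tau>' u u'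
  proof (cases "\<tau> = \<tau>'")
    case False
    have cc: "\<tau> \<in> carrier R" "\<tau>' \<in> carrier R" "u \<in> carrier R" "u' \<in> carrier R" using t u T_carr U by auto
    have "f (\<tau>, u) \<ominus> f (\<tau>', u') = (\<tau> \<ominus> \<tau>') \<oplus> (u \<ominus> u') \<otimes> a"
      unfolding f_def prod.case using cc ac by (simp add: R.ring_nf)
    moreover have "(\<tau> \<ominus> \<tau>') \<oplus> (u \<ominus> u') \<otimes> a \<notin> m"
      by (rule add_m_notin_m) (use cc T_distinct[OF t False] R.ideal_mult_mem[OF m_ideal a(1)] in auto)
    ultimately show ?thesis using cc ac
      by (intro exI[of _ 0] conjI bexI[of _ "(\<tau> \<ominus> \<tau>') \<oplus> (u \<ominus> u') \<otimes> a"]) auto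
  next
    case True
    then have uu: "u \<noteq> u'" using ne by simp
    obtain l w where l: "l < r" and w: "w \<in> carrier R - m" and e: "u \<ominus> u' = a [^] (l::nat) \<otimes> w"
      using U(4)[OF u uu] by blast
    have cc: "\<tau> \<in> carrier R" "u \<in> carrier R" "u' \<in> carrier R" using t u T_carr U by auto
    have "f (\<tau>, u) \<ominus> f (\<tau>', u') = a \<otimes> (u \<ominus> u')"
      unfolding f_def prod.case True[symmetric] using cc ac by (simp add: R.ring_nf)
    also have "\<dots> = a [^] Suc l \<otimes> w" using e w ac by (simp add: R.m_ac)
    finally show ?thesis using l w by (intro exI[of _ "Suc l"]) auto
  qed
  have nz: "a [^] (l::nat) \<otimes> w \<noteq> \<zero>" if w: "w \<in> carrier R - m" for l w
  proof
    assume z: "a [^] l \<otimes> w = \<zero>"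
    have "reg w" using w unit_iff_notin_m[of w] reg_unit by blast
    then have "reg (a [^] l \<otimes> w)" using reg_mult reg_pow a by blast
    then have "reg \<zero>" by (simp only: z)
    then have "\<one>\<^sub>S = \<zero>\<^sub>S" using reg_cancel[of \<zero> "\<one>\<^sub>S"] by simp
    then show False using one_not_zero_S by blast
  qed
  have fc: "f p \<in> carrier R" if "p \<in> T \<times> U" for p
    using that T_carr U ac by (auto simp: f_def subset_eq)
  have ne: "f p \<noteq> f p'" if pp: "p \<in> T \<times> U" "p' \<in> T \<times> U" "p \<noteq> p'" for p p'
  proof
    assume "f p = f p'"
    then have "f p \<ominus> f p' = \<zero>" using fc[OF pp(1)] fc[OF pp(2)] by simp
    moreover have "\<exists>l<Suc r. \<exists>w\<in>carrier R - m. f p \<ominus> f p' = a [^] (l::nat) \<otimes> w"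
      using sep[of "fst p" "fst p'" "snd p" "snd p'"] pp by (simp add: mem_Times_iff)
    ultimately show False using nz by metis
  qed
  then have "inj_on f (T \<times> U)" unfolding inj_on_def by blast
  then have "card (f ` (T \<times> U)) = card T ^ Suc r" using U(3) by (simp add: card_image card_cartesian_product)
  moreover have "finite (f ` (T \<times> U))" using T_fin U by simp
  moreover have "f ` (T \<times> U) \<subseteq> carrier R" using fc by blast
  moreover have "\<exists>l<Suc r. \<exists>w\<in>carrier R - m. u \<ominus> v = a [^] (l::nat) \<otimes> w"
    if uv: "u \<in> f ` (T \<times> U)" "v \<in> f ` (T \<times> U)" "u \<noteq> v" for u v
  proof -
    obtain \<tau> x \<tau>' x' where "\<tau> \<in> T" "\<tau>' \<in> T" "x \<in> U" "x' \<in> U" "u = f (\<tau>, x)" "v = f (\<tau>', x')" using uv by blast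
    then show ?thesis using sep[of \<tau> \<tau>' x x'] uv(3) by blast
  qed
  ultimately show ?case by (intro exI[of _ "f ` (T \<times> U)"]) blast
qed

lemma card_T: "card T \<ge> 2"
proof -
  obtain t0 where t0: "t0 \<in> T" "\<zero> \<ominus> t0 \<in> m" using T_repr by blast
  obtain t1 where t1: "t1 \<in> T" "\<one> \<ominus> t1 \<in> m" using T_repr by blast
  have c: "t0 \<in> carrier R" "t1 \<in> carrier R" using t0 t1 T_carr by auto
  have "t0 \<noteq> t1"
  proof
    assume e: "t0 = t1"
    have "(\<one> \<ominus> t1) \<ominus> (\<zero> \<ominus> t0) \<in> m" using R.ideal_minus_mem[OF m_ideal t1(2) t0(2)] .
    moreover have "(\<one> \<ominus> t1) \<ominus> (\<zero> \<ominus> t0) = \<one>" unfolding e using c by (simp add: R.ring_nf)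
    ultimately show False using one_notin_m by simp
  qed
  then have "card {t0, t1} = 2" by simp
  moreover have "card {t0, t1} \<le> card T" using t0 t1 T_fin by (intro card_mono) auto
  ultimately show ?thesis by simp
qed

text \<open>Pigeonhole: more combinations \<open>\<Sum> g\<^sub>i a\<^sup>i b\<^bsup>t-i\<^esup>\<close> with separated coefficients \<open>g\<^sub>i\<close> are available than
  there are classes modulo \<open>a\<^bsup>2t\<^esup>\<close>; a collision, divided by the largest possible power of \<open>a\<close>, has a
  unit coefficient.\<close>

lemma exists_unit_relation:
  assumes y: "y \<in> carrier S"
  shows "\<exists>t g. t \<ge> 1 \<and> (\<forall>i. g i \<in> carrier R) \<and> horner g y (Suc t) = \<zero>\<^sub>S \<and> (\<exists>k\<le>t. g k \<notin> m)"
proof -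
  obtain a b where a: "reg a" and b: "b \<in> carrier R" and e: "h a \<otimes>\<^sub>S y = h b" using regE[OF y] by blast
  have ac: "a \<in> carrier R" using regD a by blast
  show ?thesis
  proof (cases "a \<in> m")
    case False
    \<comment> \<open>Here \<open>a\<close> is a unit, and the relation \<open>a y - b = 0\<close>
      already has a unit coefficient.\<close>
    define g where "g = (\<lambda>i::nat. if i = 0 then a else \<ominus> b)"
    have "horner g y (Suc 1) = y \<otimes>\<^sub>S h a \<oplus>\<^sub>S h (\<ominus> b)" using y ac by (simp add: g_def)
    also have "\<dots> = \<zero>\<^sub>S" using e y ac b by (simp add: S.m_comm S.r_neg)
    finally have "horner g y (Suc 1) = \<zero>\<^sub>S" .
    moreover have "\<forall>i. g i \<in> carrier R" "g 0 \<notin> m" using ac b False by (auto simp: g_def)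
    ultimately show ?thesis by (intro exI[of _ 1] exI[of _ g]) auto
  next
    case am: True
    obtain L where L: "L \<ge> (1::nat)"
      "\<And>s::nat. \<exists>E. finite E \<and> E \<subseteq> carrier R \<and> card E \<le> L ^ s \<and> (\<forall>r\<in>carrier R. \<exists>e\<in>E. \<exists>b\<in>carrier R. r = e \<oplus> a [^] s \<otimes> b)"
      using regular_power_representatives[OF a] by blast
    \<comment> \<open>There are \<open>t + 1\<close> coefficients with \<open>t\<close> digits each,
      hence \<open>q^(t (t+1))\<close> combinations, against at most
      \<open>L^(2 t) = (L L)^t\<close> classes. It suffices that \<open>q^(t+1)\<close> exceeds
      \<open>L L\<close>, and for \<open>t = L L\<close> this follows from
      \<open>2^(t+1) > t + 1\<close>.\<close>
    define t where "t = L * L"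
    have t: "t \<ge> 1" using L(1) by (simp add: t_def)
    obtain E where E: "finite E" "card E \<le> L ^ (t + t)" "\<And>r. r \<in> carrier R \<Longrightarrow> \<exists>e\<in>E. \<exists>b\<in>carrier R. r = e \<oplus> a [^] (t + t) \<otimes> b" "E \<subseteq> carrier R"
      using L(2)[of "t + t"] by blast
    obtain U where U: "finite U" "U \<subseteq> carrier R" "card U = card T ^ t"
      "\<And>u v. u \<in> U \<Longrightarrow> v \<in> U \<Longrightarrow> u \<noteq> v \<Longrightarrow> \<exists>l<t. \<exists>w\<in>carrier R - m. u \<ominus> v = a [^] (l::nat) \<otimes> w"
      using many_separated[OF am a, of t] by blast
    define D where "D = PiE {..t} (\<lambda>_. U)"
    have Dc: "g i \<in> carrier R" if "g \<in> D" "i < Suc t" for g i using that U(2) by (auto simp: D_def PiE_def Pi_def)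
    have gc: "hom_horner g a b (Suc t) \<in> carrier R" if "g \<in> D" for g
      by (rule hom_horner_carr[OF ac b]) (use Dc[OF that] in auto)
    define F where "F g = (SOME e. e \<in> E \<and> (\<exists>c\<in>carrier R. hom_horner g a b (Suc t) = e \<oplus> a [^] (t + t) \<otimes> c))" for g
    have F: "F g \<in> E \<and> (\<exists>c\<in>carrier R. hom_horner g a b (Suc t) = F g \<oplus> a [^] (t + t) \<otimes> c)" if "g \<in> D" for g
      unfolding F_def by (rule someI_ex) (use E(3)[OF gc[OF that]] in blast)
    have "card E < card D"
    proof -
      have "L * L < 2 ^ Suc t" using less_exp[of "Suc t"] by (simp add: t_def)
      also have "\<dots> \<le> card T ^ Suc t" using card_T by (intro power_mono) auto
      finally have "(L * L) ^ t < (card T ^ Suc t) ^ t" using t by (intro power_strict_mono) auto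
      moreover have "L ^ (t + t) = (L * L) ^ t" by (simp add: power_add power_mult_distrib)
      moreover have "card D = (card T ^ t) ^ Suc t"
        by (simp add: D_def card_PiE U(3) del: power_Suc)
      moreover have "(card T ^ t) ^ Suc t = (card T ^ Suc t) ^ t"
        by (simp only: power_mult[symmetric] mult.commute)
      ultimately show ?thesis using E(2) by simp
    qed
    then have "\<not> inj_on F D"
      using card_inj_on_le[of F D E] E(1) F by (metis image_subsetI leD)
    then obtain g g' where g: "g \<in> D" "g' \<in> D" "g \<noteq> g'" "F g = F g'" unfolding inj_on_def by blast
    obtain c c' where c: "c \<in> carrier R" "c' \<in> carrier R"
      and hg: "hom_horner g a b (Suc t) = F g \<oplus> a [^] (t + t) \<otimes> c"
      and hg': "hom_horner g' a b (Suc t) = F g \<oplus> a [^] (t + t) \<otimes> c'" using F g by metis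
    define \<alpha> where "\<alpha> = c \<ominus> c'"
    have \<alpha>: "\<alpha> \<in> carrier R" using c by (simp add: \<alpha>_def)
    have diff: "hom_horner (\<lambda>i. g i \<ominus> g' i) a b (Suc t) = a [^] (t + t) \<otimes> \<alpha>"
    proof -
      define f z where "f = F g" and "z = a [^] (t + t)"
      have cc: "f \<in> carrier R" "z \<in> carrier R" using F[OF g(1)] E(4) ac by (auto simp: f_def z_def)
      have "hom_horner (\<lambda>i. g i \<ominus> g' i) a b (Suc t) = (f \<oplus> z \<otimes> c) \<ominus> (f \<oplus> z \<otimes> c')"
        using hom_horner_diff[OF ac b, of "Suc t" g g'] Dc[OF g(1)] Dc[OF g(2)] hg hg' by (simp add: f_def z_def del: hom_horner.simps)
      also have "\<dots> = z \<otimes> (c \<ominus> c')" using cc c by (simp add: R.ring_nf)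
      finally show ?thesis by (simp add: z_def \<alpha>_def)
    qed
    define K where "K = {i. i \<le> t \<and> g i \<noteq> g' i}"
    have "K \<noteq> {}"
    proof
      assume "K = {}"
      then have "g i = g' i" for i using g(1,2) by (cases "i \<le> t") (auto simp: K_def D_def PiE_def extensional_def)
      then show False using g(3) by blast
    qed
    have Kf: "finite K" by (simp add: K_def)
    have gU: "g i \<in> U" "g' i \<in> U" if "i \<le> t" for i using g(1,2) that by (auto simp: D_def)
    have "\<forall>i\<in>K. \<exists>l w. l < t \<and> w \<in> carrier R - m \<and> g i \<ominus> g' i = a [^] (l::nat) \<otimes> w"
      using U(4) gU unfolding K_def by blast
    then obtain l w where lw: "\<And>i. i \<in> K \<Longrightarrow> l i < t \<and> w i \<in> carrier R - m \<and> g i \<ominus> g' i = a [^] (l i :: nat) \<otimes> w i"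
      by metis
    \<comment> \<open>The largest power of \<open>a\<close> visibly common to all differences; at an
      index attaining the minimum the quotient is a unit.\<close>
    define l0 where "l0 = Min (l ` K)"
    have "l0 \<in> l ` K" unfolding l0_def using Kf \<open>K \<noteq> {}\<close> by (intro Min_in) auto
    then obtain k0 where k0: "k0 \<in> K" "l k0 = l0" by blast
    have l0: "l0 \<le> l i" if "i \<in> K" for i unfolding l0_def using Kf that by auto
    have l0t: "l0 < t" using lw[OF k0(1)] k0(2) by simp
    define u where "u i = (if i \<in> K then a [^] (l i - l0) \<otimes> w i else \<zero>)" for i
    have uc: "u i \<in> carrier R" for i using lw ac by (auto simp: u_def)
    have au: "g i \<ominus> g' i = a [^] l0 \<otimes> u i" if i: "i < Suc t" for i
    proof (cases "i \<in> K")
      case True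
      have "a [^] l0 \<otimes> (a [^] (l i - l0) \<otimes> w i) = (a [^] l0 \<otimes> a [^] (l i - l0)) \<otimes> w i"
        using lw[OF True] ac by (simp add: R.m_assoc)
      also have "\<dots> = a [^] l i \<otimes> w i" using l0[OF True] ac by (simp add: R.nat_pow_mult)
      finally show ?thesis using lw[OF True] True by (simp add: u_def)
    next
      case False
      then have "g i = g' i" using i by (simp add: K_def)
      then show ?thesis using False ac Dc[OF g(2) i] by (simp add: u_def)
    qed
    \<comment> \<open>Cancelling \<open>a^(l0+t)\<close> from the collision modulo
      \<open>a^(2 t)\<close> leaves the factor \<open>a^(t-l0)\<close>. Every separation exponent is
      below \<open>t\<close>, so this is a positive power of \<open>a\<close> and \<open>x\<close>
      lies in \<open>m\<close>.\<close>
    define x where "x = a [^] (t - l0) \<otimes> \<alpha>"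
    have xc: "x \<in> carrier R" using ac \<alpha> by (simp add: x_def)
    have xm: "x \<in> m"
    proof -
      obtain i where i: "t - l0 = Suc i" using l0t by (metis Suc_diff_Suc)
      have "x = (a [^] i \<otimes> \<alpha>) \<otimes> a" using ac \<alpha> by (simp add: x_def i R.m_ac)
      then show ?thesis using R.ideal_mult_mem[OF m_ideal am] ac \<alpha> by simp
    qed
    have hu: "horner u y (Suc t) = h x"
    proof -
      define H where "H = horner u y (Suc t)"
      have Hc: "H \<in> carrier S" unfolding H_def by (rule horner_carr[OF y uc])
      have "hom_horner (\<lambda>i. g i \<ominus> g' i) a b (Suc t) = a [^] l0 \<otimes> hom_horner u a b (Suc t)"
        by (rule hom_horner_scale[OF ac b _ uc au]) (use ac in auto)
      then have "h (a [^] (t + t) \<otimes> \<alpha>) = h (a [^] l0 \<otimes> hom_horner u a b (Suc t))" using diff by (simp del: hom_horner.simps)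
      also have "\<dots> = h (a [^] l0) \<otimes>\<^sub>S h (hom_horner u a b (Suc t))"
        by (rule hom_mult) (use ac hom_horner_carr[OF ac b, of "Suc t" u] uc in \<open>auto simp del: hom_horner.simps\<close>)
      also have "\<dots> = h (a [^] l0) \<otimes>\<^sub>S (h (a [^] t) \<otimes>\<^sub>S H)"
        unfolding H_def using hom_horner_horner[OF ac b y e, of t u] uc by (simp del: hom_horner.simps horner.simps)
      also have "\<dots> = h (a [^] (l0 + t)) \<otimes>\<^sub>S H"
        using ac Hc by (simp add: S.m_assoc flip: S.nat_pow_mult)
      finally have 1: "h (a [^] (t + t) \<otimes> \<alpha>) = h (a [^] (l0 + t)) \<otimes>\<^sub>S H" .
      have "a [^] (t + t) = a [^] (l0 + t) \<otimes> a [^] (t - l0)" using ac l0t by (simp add: R.nat_pow_mult)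
      then have "a [^] (t + t) \<otimes> \<alpha> = a [^] (l0 + t) \<otimes> x" using ac \<alpha> by (simp add: x_def R.m_assoc)
      then have "h (a [^] (l0 + t)) \<otimes>\<^sub>S h x = h (a [^] (l0 + t)) \<otimes>\<^sub>S H"
        using 1 hom_mult[of "a [^] (l0 + t)" x] ac xc by simp
      then have "h x = H"
        using S.Units_l_cancel[OF regD(2)[OF reg_pow[OF a]], of "h x" H] xc Hc by blast
      then show ?thesis by (simp add: H_def)
    qed
    \<comment> \<open>The error \<open>x\<close> is absorbed into the constant coefficient, at index
      \<open>t\<close>. This makes the relation exact and changes the coefficient only modulo
      \<open>m\<close>, so unit coefficients survive.\<close>
    define g2 where "g2 i = (if i = t then u t \<ominus> x else u i)" for i
    have g2c: "g2 i \<in> carrier R" for i using uc xc by (simp add: g2_def)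
    have "horner g2 y j = horner u y j" if "j \<le> t" for j
      using that by (induct j) (auto simp: g2_def)
    then have "horner g2 y (Suc t) = y \<otimes>\<^sub>S horner u y t \<oplus>\<^sub>S h (u t \<ominus> x)" by (simp add: g2_def)
    also have "\<dots> = horner u y (Suc t) \<ominus>\<^sub>S h x"
      using uc xc y horner_carr[OF y, of t u] by (simp add: a_minus_def S.a_assoc)
    also have "\<dots> = \<zero>\<^sub>S" unfolding hu using xc by (simp add: a_minus_def S.r_neg)
    finally have "horner g2 y (Suc t) = \<zero>\<^sub>S" .
    moreover have "g2 k0 \<notin> m"
    proof -
      have "u k0 \<notin> m" using k0 lw[OF k0(1)] by (simp add: u_def)
      then show ?thesis using add_m_notin_m(2)[OF uc _ xm] by (auto simp: g2_def)
    qed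
    moreover have "k0 \<le> t" using k0 by (simp add: K_def)
    ultimately show ?thesis using t g2c by blast
  qed
qed

text \<open>Let \<open>H i\<close> be the partial Horner sums of a relation whose coefficient
  \<open>g k\<close> is a unit. The sums \<open>H i\<close> and the products \<open>y H i\<close>
  are integral, and \<open>g k = H (k+1) - y H k\<close> lies outside \<open>M\<close>. Hence
  \<open>y H k\<close> or \<open>H (k+1)\<close> lies outside \<open>M\<close>, and \<open>v\<close>
  is \<open>H k\<close> or \<open>H (k+1)\<close> accordingly.\<close>

lemma valuation_property:
  assumes y: "y \<in> carrier S" and M: "maximalideal M RBr"
  shows "\<exists>v\<in>RB. y \<otimes>\<^sub>S v \<in> RB \<and> (v \<notin> M \<or> y \<otimes>\<^sub>S v \<notin> M)"
proof -
  obtain t g where t: "t \<ge> 1" and g: "\<And>i. g i \<in> carrier R" and rel: "horner g y (Suc t) = \<zero>\<^sub>S"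
    and k: "\<exists>k\<le>t. g k \<notin> m" using exists_unit_relation[OF y] by blast
  obtain k where k: "k \<le> t" "g k \<notin> m" using k by blast
  have RBh: "horner g y i \<in> RB" if "i \<le> Suc t" for i by (rule horner_in_RB[OF y g rel t that])
  have hc: "horner g y i \<in> carrier S" for i using horner_carr[OF y g] .
  have step: "y \<otimes>\<^sub>S horner g y i = horner g y (Suc i) \<ominus>\<^sub>S h (g i)" for i
  proof -
    define H c where "H = horner g y i" and "c = h (g i)"
    have cc: "H \<in> carrier S" "c \<in> carrier S" using hc g by (auto simp: H_def c_def)
    have "y \<otimes>\<^sub>S H = (y \<otimes>\<^sub>S H \<oplus>\<^sub>S c) \<ominus>\<^sub>S c" using cc y by (simp add: S.ring_nf)
    then show ?thesis by (simp add: H_def c_def)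
  qed
  have yRB: "y \<otimes>\<^sub>S horner g y i \<in> RB" if "i \<le> t" for i
    unfolding step by (rule RB_minus[OF RBh h_RB[OF g]]) (use that in simp)
  have nM: "h (g k) \<notin> M" using h_in_max_iff[OF M g] k by blast
  show ?thesis
  proof (cases "y \<otimes>\<^sub>S horner g y k \<in> M")
    case False
    then show ?thesis using RBh[of k] yRB[OF k(1)] k(1) by auto
  next
    case True
    have n: "horner g y (Suc k) \<notin> M"
    proof
      assume i: "horner g y (Suc k) \<in> M"
      define H c where "H = horner g y (Suc k)" and "c = h (g k)"
      have cc: "H \<in> carrier S" "c \<in> carrier S" using hc g by (auto simp: H_def c_def simp del: horner.simps)
      have "H \<ominus>\<^sub>S (H \<ominus>\<^sub>S c) \<in> M" using maxRB_minus[OF M i True] unfolding step H_def c_def .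
      moreover have "H \<ominus>\<^sub>S (H \<ominus>\<^sub>S c) = c" using cc by (simp add: S.ring_nf)
      ultimately show False using nM by (simp add: c_def)
    qed
    have "k \<noteq> t" using n rel maxRB_zero[OF M] by metis
    then have "Suc k \<le> t" using k by simp
    then show ?thesis using RBh[of "Suc k"] yRB[of "Suc k"] n by (auto simp del: horner.simps)
  qed
qed

subsection \<open>Local principality\<close>

text \<open>The fractions \<open>e = y/(y + \<kappa>)\<close> and
  \<open>f = \<kappa>/(y + \<kappa>)\<close> are complementary idempotents and thus integral, and
  they cannot both lie in \<open>M\<close>. If \<open>e\<close> is outside \<open>M\<close>, scaling
  by \<open>1/(y + \<kappa>)\<close> normalises \<open>y\<close>; otherwise \<open>f\<close> is
  outside \<open>M\<close> and annihilates \<open>y\<close>.\<close>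

lemma local_generator_single:
  assumes y: "y \<in> carrier R" and M: "maximalideal M RBr"
  shows "(\<exists>w\<in>carrier S. w \<otimes>\<^sub>S h y \<in> RB \<and> w \<otimes>\<^sub>S h y \<notin> M) \<or> (\<exists>s\<in>RB. s \<notin> M \<and> s \<otimes>\<^sub>S h y = \<zero>\<^sub>S)"
proof -
  obtain \<kappa> where \<kappa>: "\<kappa> \<in> carrier R" "h (y \<otimes> \<kappa>) = \<zero>\<^sub>S" "reg (y \<oplus> \<kappa>)"
    using exists_regular_complement[OF y] .
  define i Y K where "i = inv\<^bsub>S\<^esub> (h (y \<oplus> \<kappa>))" and "Y = h y" and "K = h \<kappa>"
  have c: "i \<in> carrier S" "Y \<in> carrier S" "K \<in> carrier S"
    using \<kappa> y regD(2)[OF \<kappa>(3)] by (auto simp: i_def Y_def K_def simp del: hom_add)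
  have i1: "i \<otimes>\<^sub>S (Y \<oplus>\<^sub>S K) = \<one>\<^sub>S"
    using S.Units_l_inv[OF regD(2)[OF \<kappa>(3)]] y \<kappa>(1) by (simp add: i_def Y_def K_def)
  have YK: "Y \<otimes>\<^sub>S K = \<zero>\<^sub>S" using \<kappa> y by (simp add: Y_def K_def)
  define e f where "e = i \<otimes>\<^sub>S Y" and "f = i \<otimes>\<^sub>S K"
  have ec: "e \<in> carrier S" "f \<in> carrier S" using c by (auto simp: e_def f_def)
  have ef: "e \<oplus>\<^sub>S f = \<one>\<^sub>S" using i1 c by (simp add: e_def f_def S.r_distr)
  have "e \<otimes>\<^sub>S e = e \<otimes>\<^sub>S (e \<oplus>\<^sub>S f) \<ominus>\<^sub>S e \<otimes>\<^sub>S f" using ec by (simp add: S.ring_nf)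
  moreover have "e \<otimes>\<^sub>S f = i \<otimes>\<^sub>S i \<otimes>\<^sub>S (Y \<otimes>\<^sub>S K)" unfolding e_def f_def using c by (simp add: S.ring_nf)
  ultimately have ee: "e \<otimes>\<^sub>S e = e" unfolding ef YK using c ec by (simp add: a_minus_def)
  have "e [^]\<^sub>S (2::nat) = e" using ee ec by (simp add: numeral_2_eq_2)
  then have "e [^]\<^sub>S (2::nat) \<in> span e 2" using span_pow[of 1 2 e] ec by simp
  then have eRB: "e \<in> RB" using RB_iff_integral[OF ec(1)] by (auto intro!: exI[of _ 2])
  have "f = \<one>\<^sub>S \<ominus>\<^sub>S e" unfolding ef[symmetric] using ec by (simp add: S.ring_nf)
  then have fRB: "f \<in> RB" using RB_minus[OF RB_one eRB] by simp
  show ?thesis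
  proof (cases "e \<in> M")
    case False
    then show ?thesis using eRB c by (intro disjI1 bexI[of _ i]) (auto simp: e_def Y_def)
  next
    case True
    have "f \<notin> M" using maxRB_add[OF M True, of f] ef maxRB_one[OF M] by auto
    moreover have "f \<otimes>\<^sub>S Y = i \<otimes>\<^sub>S (Y \<otimes>\<^sub>S K)" unfolding f_def using c by (simp add: S.ring_nf)
    ultimately show ?thesis using fRB YK c by (intro disjI2 bexI[of _ f]) (auto simp: Y_def)
  qed
qed

text \<open>If \<open>w\<close> already normalises \<open>G\<close>, the valuation property of
  \<open>w y\<close> supplies a factor \<open>v\<close> such that \<open>v w\<close> normalises
  \<open>G\<close> and \<open>y\<close> together. If instead \<open>s\<close> annihilates
  \<open>G\<close> locally, only \<open>y\<close> matters, and its scaling factor or annihilator is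
  multiplied by \<open>s\<close>.\<close>

lemma local_generator:
  assumes "finite G" "G \<subseteq> carrier R" and M: "maximalideal M RBr"
  shows "(\<exists>w\<in>carrier S. (\<forall>g\<in>G. w \<otimes>\<^sub>S h g \<in> RB) \<and> (\<exists>g\<in>G. w \<otimes>\<^sub>S h g \<notin> M)) \<or>
    (\<exists>s\<in>RB. s \<notin> M \<and> (\<forall>g\<in>G. s \<otimes>\<^sub>S h g = \<zero>\<^sub>S))"
  using assms(1,2)
proof (induct G)
  case empty
  then show ?case using RB_one maxRB_one[OF M] by auto
next
  case (insert y G)
  have yc: "y \<in> carrier R" and hy: "h y \<in> carrier S" using insert by auto
  have Gc: "h g \<in> carrier S" if "g \<in> G" for g using insert that by auto
  from insert have "(\<exists>w\<in>carrier S. (\<forall>g\<in>G. w \<otimes>\<^sub>S h g \<in> RB) \<and> (\<exists>g\<in>G. w \<otimes>\<^sub>S h g \<notin> M)) \<or>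
    (\<exists>s\<in>RB. s \<notin> M \<and> (\<forall>g\<in>G. s \<otimes>\<^sub>S h g = \<zero>\<^sub>S))" by blast
  then show ?case
  proof
    assume "\<exists>w\<in>carrier S. (\<forall>g\<in>G. w \<otimes>\<^sub>S h g \<in> RB) \<and> (\<exists>g\<in>G. w \<otimes>\<^sub>S h g \<notin> M)"
    then obtain w g0 where w: "w \<in> carrier S" "\<And>g. g \<in> G \<Longrightarrow> w \<otimes>\<^sub>S h g \<in> RB" and g0: "g0 \<in> G" "w \<otimes>\<^sub>S h g0 \<notin> M" by blast
    obtain v where v: "v \<in> RB" "(w \<otimes>\<^sub>S h y) \<otimes>\<^sub>S v \<in> RB" "v \<notin> M \<or> (w \<otimes>\<^sub>S h y) \<otimes>\<^sub>S v \<notin> M"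
      using valuation_property[OF _ M, of "w \<otimes>\<^sub>S h y"] w hy by auto
    have vc: "v \<in> carrier S" using v RB_carr by blast
    have e1: "(v \<otimes>\<^sub>S w) \<otimes>\<^sub>S h g = v \<otimes>\<^sub>S (w \<otimes>\<^sub>S h g)" if "g \<in> G" for g
      using vc w Gc[OF that] by (simp add: S.m_assoc)
    have e2: "(v \<otimes>\<^sub>S w) \<otimes>\<^sub>S h y = (w \<otimes>\<^sub>S h y) \<otimes>\<^sub>S v"
      using vc w hy by (simp add: S.m_ac)
    have "\<forall>g\<in>insert y G. (v \<otimes>\<^sub>S w) \<otimes>\<^sub>S h g \<in> RB"
      using e1 e2 v(2) RB_mult[OF v(1) w(2)] by auto
    moreover have "\<exists>g\<in>insert y G. (v \<otimes>\<^sub>S w) \<otimes>\<^sub>S h g \<notin> M"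
    proof (cases "v \<in> M")
      case True
      then show ?thesis using v(3) e2 by auto
    next
      case False
      then have "v \<otimes>\<^sub>S (w \<otimes>\<^sub>S h g0) \<notin> M" using maxRB_prime[OF M v(1) w(2)[OF g0(1)]] g0(2) by blast
      then show ?thesis using e1[OF g0(1)] g0(1) by (intro bexI[of _ g0]) auto
    qed
    ultimately show ?thesis using vc w(1) by (intro disjI1 bexI[of _ "v \<otimes>\<^sub>S w"]) auto
  next
    assume "\<exists>s\<in>RB. s \<notin> M \<and> (\<forall>g\<in>G. s \<otimes>\<^sub>S h g = \<zero>\<^sub>S)"
    then obtain s where s: "s \<in> RB" "s \<notin> M" "\<And>g. g \<in> G \<Longrightarrow> s \<otimes>\<^sub>S h g = \<zero>\<^sub>S" by blast
    have sc: "s \<in> carrier S" using s RB_carr by blast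
    from local_generator_single[OF yc M] show ?thesis
    proof
      assume "\<exists>w\<in>carrier S. w \<otimes>\<^sub>S h y \<in> RB \<and> w \<otimes>\<^sub>S h y \<notin> M"
      then obtain w where w: "w \<in> carrier S" "w \<otimes>\<^sub>S h y \<in> RB" "w \<otimes>\<^sub>S h y \<notin> M" by blast
      have e1: "(s \<otimes>\<^sub>S w) \<otimes>\<^sub>S h g = \<zero>\<^sub>S" if "g \<in> G" for g
      proof -
        have "(s \<otimes>\<^sub>S w) \<otimes>\<^sub>S h g = w \<otimes>\<^sub>S (s \<otimes>\<^sub>S h g)" using sc w Gc[OF that] by (simp add: S.m_ac)
        then show ?thesis using s(3)[OF that] w by simp
      qed
      have e2: "(s \<otimes>\<^sub>S w) \<otimes>\<^sub>S h y = s \<otimes>\<^sub>S (w \<otimes>\<^sub>S h y)" using sc w hy by (simp add: S.m_assoc)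
      have "\<forall>g\<in>insert y G. (s \<otimes>\<^sub>S w) \<otimes>\<^sub>S h g \<in> RB" using e1 e2 RB_zero RB_mult[OF s(1) w(2)] by auto
      moreover have "(s \<otimes>\<^sub>S w) \<otimes>\<^sub>S h y \<notin> M" unfolding e2 using maxRB_prime[OF M s(1) w(2)] s(2) w(3) by blast
      ultimately show ?thesis using sc w(1) by (intro disjI1 bexI[of _ "s \<otimes>\<^sub>S w"]) auto
    next
      assume "\<exists>s\<in>RB. s \<notin> M \<and> s \<otimes>\<^sub>S h y = \<zero>\<^sub>S"
      then obtain s' where s': "s' \<in> RB" "s' \<notin> M" "s' \<otimes>\<^sub>S h y = \<zero>\<^sub>S" by blast
      have sc': "s' \<in> carrier S" using s' RB_carr by blast
      have e1: "(s \<otimes>\<^sub>S s') \<otimes>\<^sub>S h g = \<zero>\<^sub>S" if "g \<in> G" for g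
      proof -
        have "(s \<otimes>\<^sub>S s') \<otimes>\<^sub>S h g = s' \<otimes>\<^sub>S (s \<otimes>\<^sub>S h g)" using sc sc' Gc[OF that] by (simp add: S.m_ac)
        then show ?thesis using s(3)[OF that] sc' by simp
      qed
      have e2: "(s \<otimes>\<^sub>S s') \<otimes>\<^sub>S h y = \<zero>\<^sub>S" using sc sc' hy s'(3) by (simp add: S.m_assoc)
      have "s \<otimes>\<^sub>S s' \<notin> M" using maxRB_prime[OF M s(1) s'(1)] s(2) s'(2) by blast
      then show ?thesis using e1 e2 RB_mult[OF s(1) s'(1)] by (intro disjI2 bexI[of _ "s \<otimes>\<^sub>S s'"]) auto
    qed
  qed
qed

text \<open>Applied with \<open>N\<close> equal to \<open>RB\<close>, to a maximal ideal or to the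
  zero set, it carries statements about generators over to the ideals they generate.\<close>

lemma scaled_preimage_ideal:
  assumes w: "w \<in> carrier S" and N: "N \<subseteq> carrier S" "\<zero>\<^sub>S \<in> N"
    "\<And>a b. a \<in> N \<Longrightarrow> b \<in> N \<Longrightarrow> a \<oplus>\<^sub>S b \<in> N" "\<And>a r. a \<in> N \<Longrightarrow> r \<in> carrier R \<Longrightarrow> h r \<otimes>\<^sub>S a \<in> N"
  shows "ideal {x \<in> carrier R. w \<otimes>\<^sub>S h x \<in> N} R"
proof (rule R.ideal_criterion)
  fix a b assume "a \<in> {x \<in> carrier R. w \<otimes>\<^sub>S h x \<in> N}" "b \<in> {x \<in> carrier R. w \<otimes>\<^sub>S h x \<in> N}"
  then show "a \<oplus> b \<in> {x \<in> carrier R. w \<otimes>\<^sub>S h x \<in> N}" using w N(3) by (simp add: S.r_distr)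
next
  fix a r assume a: "a \<in> {x \<in> carrier R. w \<otimes>\<^sub>S h x \<in> N}" and r: "r \<in> carrier R"
  have "w \<otimes>\<^sub>S h (r \<otimes> a) = h r \<otimes>\<^sub>S (w \<otimes>\<^sub>S h a)" using a r w by (simp add: S.m_lcomm)
  then show "r \<otimes> a \<in> {x \<in> carrier R. w \<otimes>\<^sub>S h x \<in> N}" using N(4)[of "w \<otimes>\<^sub>S h a" r] a r by simp
qed (use w N(2) in auto)

end

section \<open>From local generation to integrality over an ideal\<close>

text \<open>For ideals \<open>J\<close> and \<open>I\<close> with \<open>J\<close> inside
  \<open>I\<close> this is the ideal \<open>(RB : I) J + ann(I)\<close> of \<open>RB\<close>. If it
  contains \<open>1\<close>, written as a sum of terms \<open>w j\<close> and an annihilator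
  \<open>s\<close>, then every \<open>x\<close> in \<open>I\<close> equals the sum of the
  \<open>(w x) j\<close>, an element of \<open>J RB\<close>.\<close>

inductive_set (in frac_setup) unit_span :: "'a set \<Rightarrow> 'a set \<Rightarrow> 'c set" for I J :: "'a set" where
  gen: "w \<in> carrier S \<Longrightarrow> (\<And>x. x \<in> I \<Longrightarrow> w \<otimes>\<^sub>S h x \<in> RB) \<Longrightarrow> j \<in> J \<Longrightarrow> w \<otimes>\<^sub>S h j \<in> unit_span I J"
| ann: "s \<in> RB \<Longrightarrow> (\<And>x. x \<in> I \<Longrightarrow> s \<otimes>\<^sub>S h x = \<zero>\<^sub>S) \<Longrightarrow> s \<in> unit_span I J"
| add: "u \<in> unit_span I J \<Longrightarrow> v \<in> unit_span I J \<Longrightarrow> u \<oplus>\<^sub>S v \<in> unit_span I J"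

context frac_setup
begin

lemma unit_span_RB: "J \<subseteq> I \<Longrightarrow> u \<in> unit_span I J \<Longrightarrow> u \<in> RB"
  by (rotate_tac, induct rule: unit_span.induct) (auto intro: RB_add)

lemma unit_span_ideal:
  assumes I: "ideal I R" and JI: "J \<subseteq> I"
  shows "ideal (unit_span I J) RBr"
proof (rule RBr.ideal_criterion)
  have Ic: "\<And>x. x \<in> I \<Longrightarrow> x \<in> carrier R" using R.ideal_sub[OF I] by blast
  show "unit_span I J \<subseteq> carrier RBr" using unit_span_RB[OF JI] by auto
  show "\<zero>\<^bsub>RBr\<^esub> \<in> unit_span I J" using unit_span.ann[OF RB_zero, of I J] Ic by simp
  fix a r assume a: "a \<in> unit_span I J" and "r \<in> carrier RBr"
  then have r: "r \<in> RB" by simp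
  have rc: "r \<in> carrier S" using r RB_carr by blast
  from a have "r \<otimes>\<^sub>S a \<in> unit_span I J"
  proof (induct rule: unit_span.induct)
    case (gen w j)
    have jc: "j \<in> carrier R" using gen JI Ic by blast
    have "(r \<otimes>\<^sub>S w) \<otimes>\<^sub>S h j \<in> unit_span I J"
    proof (rule unit_span.gen)
      fix x assume x: "x \<in> I"
      have "(r \<otimes>\<^sub>S w) \<otimes>\<^sub>S h x = r \<otimes>\<^sub>S (w \<otimes>\<^sub>S h x)" using rc gen(1) Ic[OF x] by (simp add: S.m_assoc)
      then show "(r \<otimes>\<^sub>S w) \<otimes>\<^sub>S h x \<in> RB" using RB_mult[OF r gen(2)[OF x]] by simp
    qed (use rc gen in auto)
    then show ?case using rc gen(1) jc by (simp add: S.m_assoc)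
  next
    case (ann s)
    have sc: "s \<in> carrier S" using ann RB_carr by blast
    show ?case
    proof (rule unit_span.ann[OF RB_mult[OF r ann(1)]])
      fix x assume x: "x \<in> I"
      have "(r \<otimes>\<^sub>S s) \<otimes>\<^sub>S h x = r \<otimes>\<^sub>S (s \<otimes>\<^sub>S h x)" using rc sc Ic[OF x] by (simp add: S.m_assoc)
      then show "(r \<otimes>\<^sub>S s) \<otimes>\<^sub>S h x = \<zero>\<^sub>S" using ann(2)[OF x] rc by simp
    qed
  next
    case (add u v)
    have "u \<in> carrier S" "v \<in> carrier S"
      using unit_span_RB[OF JI add(1)] unit_span_RB[OF JI add(3)] RB_carr by auto
    then show ?case using add rc by (simp add: S.r_distr unit_span.add)
  qed
  then show "r \<otimes>\<^bsub>RBr\<^esub> a \<in> unit_span I J" by simp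
qed (auto intro: unit_span.add)

text \<open>Since \<open>(w j) x b = j ((w x) b)\<close>, a term \<open>w j\<close> only needs
  stability of \<open>B\<close> under the single element \<open>w x\<close> of \<open>RB\<close>,
  and \<open>u\<close> involves finitely many such terms.\<close>

lemma unit_span_acts:
  assumes I: "ideal I R" and J: "ideal J R" and JI: "J \<subseteq> I" and x: "x \<in> I" and u: "u \<in> unit_span I J"
  shows "\<exists>F. finite F \<and> F \<subseteq> RB \<and> (\<forall>B. ideal B R \<longrightarrow> (\<forall>y\<in>F. stable B y) \<longrightarrow>
    (\<forall>b\<in>B. \<exists>c\<in>J \<cdot> B. u \<otimes>\<^sub>S h x \<otimes>\<^sub>S h b = h c))"
  using u
proof (induct rule: unit_span.induct)
  case (gen w j)
  have jc: "j \<in> carrier R" and xc: "x \<in> carrier R" using gen JI x R.ideal_sub[OF I] by auto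
  have "\<exists>c\<in>J \<cdot> B. (w \<otimes>\<^sub>S h j) \<otimes>\<^sub>S h x \<otimes>\<^sub>S h b = h c"
    if B: "ideal B R" and st: "stable B (w \<otimes>\<^sub>S h x)" and b: "b \<in> B" for B b
  proof -
    obtain b' where b': "b' \<in> B" "(w \<otimes>\<^sub>S h x) \<otimes>\<^sub>S h b = h b'" using st b unfolding stable_def by blast
    have bc: "b \<in> carrier R" "b' \<in> carrier R" using b b' R.ideal_sub[OF B] by auto
    have "(w \<otimes>\<^sub>S h j) \<otimes>\<^sub>S h x \<otimes>\<^sub>S h b = h j \<otimes>\<^sub>S ((w \<otimes>\<^sub>S h x) \<otimes>\<^sub>S h b)"
      using gen(1) jc xc bc by (simp add: S.m_ac)
    also have "\<dots> = h (j \<otimes> b')" using b' jc bc by simp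
    finally show ?thesis using ideal_prod.prod[OF gen(3) b'(1), of R] by blast
  qed
  then show ?case using gen(2)[OF x] by (intro exI[of _ "{w \<otimes>\<^sub>S h x}"]) auto
next
  case (ann s)
  have "\<exists>c\<in>J \<cdot> B. s \<otimes>\<^sub>S h x \<otimes>\<^sub>S h b = h c" if B: "ideal B R" and b: "b \<in> B" for B b
  proof -
    have "h b \<in> carrier S" using b R.ideal_sub[OF B] by auto
    then have "s \<otimes>\<^sub>S h x \<otimes>\<^sub>S h b = h \<zero>" using ann(2)[OF x] by simp
    then show ?thesis using R.ideal_zero_mem[OF R.ideal_prod_is_ideal[OF J B]] by blast
  qed
  then show ?case by (intro exI[of _ "{}"]) auto
next
  case (add u v)
  from add(2) obtain F1 where F1: "finite F1" "F1 \<subseteq> RB" and 1: "\<forall>B. ideal B R \<longrightarrow> (\<forall>y\<in>F1. stable B y) \<longrightarrow>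
    (\<forall>b\<in>B. \<exists>c\<in>J \<cdot> B. u \<otimes>\<^sub>S h x \<otimes>\<^sub>S h b = h c)" by (elim exE conjE)
  from add(4) obtain F2 where F2: "finite F2" "F2 \<subseteq> RB" and 2: "\<forall>B. ideal B R \<longrightarrow> (\<forall>y\<in>F2. stable B y) \<longrightarrow>
    (\<forall>b\<in>B. \<exists>c\<in>J \<cdot> B. v \<otimes>\<^sub>S h x \<otimes>\<^sub>S h b = h c)" by (elim exE conjE)
  have uc: "u \<in> carrier S" "v \<in> carrier S"
    using unit_span_RB[OF JI add(1)] unit_span_RB[OF JI add(3)] RB_carr by auto
  have xc: "x \<in> carrier R" using x R.ideal_sub[OF I] by auto
  have "\<exists>c\<in>J \<cdot> B. (u \<oplus>\<^sub>S v) \<otimes>\<^sub>S h x \<otimes>\<^sub>S h b = h c"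
    if B: "ideal B R" and st: "\<forall>y\<in>F1 \<union> F2. stable B y" and b: "b \<in> B" for B b
  proof -
    have st1: "\<forall>y\<in>F1. stable B y" and st2: "\<forall>y\<in>F2. stable B y" using st by auto
    obtain c1 c2 where c: "c1 \<in> J \<cdot> B" "c2 \<in> J \<cdot> B" and e: "u \<otimes>\<^sub>S h x \<otimes>\<^sub>S h b = h c1" "v \<otimes>\<^sub>S h x \<otimes>\<^sub>S h b = h c2"
      using 1[THEN spec, of B, THEN mp, OF B, THEN mp, OF st1, THEN bspec, OF b]
        2[THEN spec, of B, THEN mp, OF B, THEN mp, OF st2, THEN bspec, OF b] by blast
    have cc: "c1 \<in> carrier R" "c2 \<in> carrier R" using c R.ideal_prod_in_carrier[OF J B] by auto
    have "h b \<in> carrier S" using b R.ideal_sub[OF B] by auto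
    then have "(u \<oplus>\<^sub>S v) \<otimes>\<^sub>S h x \<otimes>\<^sub>S h b = h (c1 \<oplus> c2)"
      using uc xc cc e by (simp add: S.l_distr)
    then show ?thesis using ideal_prod.sum[OF c] by blast
  qed
  then show ?case using F1 F2 by (intro exI[of _ "F1 \<union> F2"]) auto
qed

lemma ideal_prod_subset_comb:
  assumes J: "ideal J R" and \<beta>: "\<And>k. k < p \<Longrightarrow> \<beta> k \<in> carrier R" and c: "c \<in> J \<cdot> (Idl (\<beta> ` {..<p}))"
  shows "c \<in> R.comb J \<beta> p"
  using c
proof (induct rule: ideal_prod.induct)
  case (prod j b)
  have jc: "j \<in> carrier R" using prod R.ideal_sub[OF J] by blast
  have "b \<in> R.comb (carrier R) \<beta> p" using R.genideal_subset_comb[of p \<beta>] \<beta> prod by blast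
  then show ?case
  proof (induct rule: R.comb.induct)
    case zero
    then show ?case using jc by (simp add: R.comb.zero)
  next
    case (gen r k)
    have "j \<otimes> (r \<otimes> \<beta> k) = (j \<otimes> r) \<otimes> \<beta> k" using jc gen \<beta> by (simp add: R.m_assoc)
    then show ?case using R.comb.gen[OF R.ideal_mult_mem'[OF J prod(1) gen(1)] gen(2)] by simp
  next
    case (add u v)
    have "u \<in> carrier R" "v \<in> carrier R"
      using R.comb_carrier[OF _ \<beta> add(1)] R.comb_carrier[OF _ \<beta> add(3)] by auto
    then show ?case using add jc by (simp add: R.r_distr R.comb.add)
  qed
next
  case (sum a b)
  then show ?case by (auto intro: R.comb.add)
qed

text \<open>By \<open>loc\<close> the ideal \<open>unit_span I J\<close> lies in no maximal ideal,
  so it contains \<open>1\<close>. Then \<open>x\<close> maps a stable ideal \<open>B\<close> with a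
  regular element into \<open>J B\<close>, up to the kernel of \<open>h\<close>, and Cayley-Hamilton
  on \<open>B\<close> gives the integral equation of \<open>x\<close> over \<open>J\<close>.\<close>

lemma integral_over_ideal:
  assumes I: "ideal I R" and J: "ideal J R" and JI: "J \<subseteq> I" and x: "x \<in> I"
    and loc: "\<And>M. maximalideal M RBr \<Longrightarrow>
      (\<exists>w\<in>carrier S. (\<forall>x\<in>I. w \<otimes>\<^sub>S h x \<in> RB) \<and> (\<exists>j\<in>J. w \<otimes>\<^sub>S h j \<notin> M)) \<or>
      (\<exists>s\<in>RB. s \<notin> M \<and> (\<forall>x\<in>I. s \<otimes>\<^sub>S h x = \<zero>\<^sub>S))"
  shows "\<exists>t\<ge>1. x [^] (t::nat) \<in> R.red_deg J I t"
proof -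
  have xR: "x \<in> carrier R" using x R.ideal_sub[OF I] by blast
  have "\<one>\<^sub>S \<in> unit_span I J"
  proof (rule ccontr)
    assume "\<one>\<^sub>S \<notin> unit_span I J"
    then obtain M where M: "maximalideal M RBr" and sub: "unit_span I J \<subseteq> M"
      using RBr.exists_maximalideal_supset[OF unit_span_ideal[OF I JI]] by auto
    from loc[OF M] show False
    proof
      assume "\<exists>w\<in>carrier S. (\<forall>x\<in>I. w \<otimes>\<^sub>S h x \<in> RB) \<and> (\<exists>j\<in>J. w \<otimes>\<^sub>S h j \<notin> M)"
      then show False using sub unit_span.gen[of _ I _ J] by blast
    next
      assume "\<exists>s\<in>RB. s \<notin> M \<and> (\<forall>x\<in>I. s \<otimes>\<^sub>S h x = \<zero>\<^sub>S)"
      then show False using sub unit_span.ann[of _ I J] by blast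
    qed
  qed
  from unit_span_acts[OF I J JI x this] obtain F where F: "finite F" "F \<subseteq> RB"
    and act: "\<And>B b. ideal B R \<Longrightarrow> \<forall>y\<in>F. stable B y \<Longrightarrow> b \<in> B \<Longrightarrow> \<exists>c\<in>J \<cdot> B. \<one>\<^sub>S \<otimes>\<^sub>S h x \<otimes>\<^sub>S h b = h c"
    by metis
  obtain B d where B: "ideal B R" and d: "d \<in> B" "reg d" and st: "\<forall>y\<in>F. stable B y"
    using exists_stable_ideal[OF F] by blast
  obtain \<beta> and p :: nat where \<beta>: "\<And>k. k < p \<Longrightarrow> \<beta> k \<in> carrier R" and BE: "B = Idl (\<beta> ` {..<p})"
    using ideal_generators[OF B] by blast
  have rdI: "ideal (R.red_deg J I k) R" for k by (rule R.red_deg_ideal[OF I J])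
  have rdc: "a \<in> carrier R" if "a \<in> R.red_deg J I k" for a k using that R.ideal_sub[OF rdI] by blast
  \<comment> \<open>Choosing the graded pieces \<open>J I^(k-1)\<close> as lower terms keeps track
    of the degree, so the monic relation lands in \<open>J I^(t-1)\<close> and not merely in
    \<open>J\<close>.\<close>
  interpret lower_terms S "\<lambda>k. h ` R.red_deg J I k" "h x"
  proof unfold_locales
    show "h x \<in> carrier S" using xR by simp
    fix k show "h ` R.red_deg J I k \<subseteq> carrier S" using rdc by auto
    show "\<zero>\<^sub>S \<in> h ` R.red_deg J I k" using R.ideal_zero_mem[OF rdI] image_eqI[of "\<zero>\<^sub>S" h \<zero>] by simp
  next
    fix a b k assume "a \<in> h ` R.red_deg J I k" "b \<in> h ` R.red_deg J I k"
    then obtain a' b' where ab: "a' \<in> R.red_deg J I k" "b' \<in> R.red_deg J I k" "a = h a'" "b = h b'" by blast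
    then have "a \<ominus>\<^sub>S b = h (a' \<ominus> b')" using rdc by (simp add: a_minus_def)
    then show "a \<ominus>\<^sub>S b \<in> h ` R.red_deg J I k" using R.ideal_minus_mem[OF rdI ab(1,2)] by blast
  next
    fix k l :: nat and a b assume k: "1 \<le> k" and l: "1 \<le> l"
      and "a \<in> h ` R.red_deg J I k" "b \<in> h ` R.red_deg J I l"
    then obtain a' b' where ab: "a' \<in> R.red_deg J I k" "b' \<in> R.red_deg J I l" "a = h a'" "b = h b'" by blast
    then have "a \<otimes>\<^sub>S b = h (a' \<otimes> b')" using rdc by simp
    moreover have "a' \<otimes> b' \<in> R.red_deg J I (k + l)"
      by (rule R.red_deg_pow_mult[OF I J k ab(1)]) (use R.red_deg_subset_pow[OF I JI l] ab in blast)
    ultimately show "a \<otimes>\<^sub>S b \<in> h ` R.red_deg J I (k + l)" by blast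
  next
    fix k :: nat and a assume k: "1 \<le> k" and "a \<in> h ` R.red_deg J I k"
    then obtain a' where a: "a' \<in> R.red_deg J I k" "a = h a'" by blast
    then have "h x \<otimes>\<^sub>S a = h (x \<otimes> a')" using rdc xR by simp
    moreover have "x \<in> ideal_pow R I 1" using x R.ideal_prod_one[OF I] by simp
    then have "x \<otimes> a' \<in> R.red_deg J I (Suc k)" using R.red_deg_pow_mult'[OF I J k a(1), of x 1] by simp
    ultimately show "h x \<otimes>\<^sub>S a \<in> h ` R.red_deg J I (Suc k)" by blast
  qed
  have Jc: "J \<subseteq> carrier R" using R.ideal_sub[OF J] .
  have J1: "h ` J = h ` R.red_deg J I 1" using R.ideal_prod_one[OF J] by (simp add: R.red_deg_def)
  have "\<exists>t\<ge>1. \<exists>z'. monic z' t \<and> (\<forall>i<p. z' \<otimes>\<^sub>S h (\<beta> i) = \<zero>\<^sub>S)"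
  proof (rule monic_annihilator[OF _ x_monic])
    fix i assume i: "i < p"
    show "h (\<beta> i) \<in> carrier S" using \<beta> i by simp
    have "\<beta> i \<in> B" unfolding BE using R.genideal_self[of "\<beta> ` {..<p}"] \<beta> i by auto
    then obtain c where c: "c \<in> J \<cdot> B" "\<one>\<^sub>S \<otimes>\<^sub>S h x \<otimes>\<^sub>S h (\<beta> i) = h c" using act[OF B st] by blast
    have "h c \<in> S.comb (h ` J) (\<lambda>k. h (\<beta> k)) p"
      using comb_hom[OF Jc \<beta> ideal_prod_subset_comb[OF J \<beta>]] c(1) BE by simp
    then show "h x \<otimes>\<^sub>S h (\<beta> i) \<in> S.comb (h ` R.red_deg J I 1) (\<lambda>i. h (\<beta> i)) p"
      using c(2) xR J1 by simp
  qed simp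
  then obtain t z' where t: "t \<ge> 1" and z: "monic z' t" and ann: "\<And>i. i < p \<Longrightarrow> z' \<otimes>\<^sub>S h (\<beta> i) = \<zero>\<^sub>S" by blast
  have zc: "z' \<in> carrier S" using z by (simp add: monic_def)
  have "d \<in> R.comb (carrier R) \<beta> p" using R.genideal_subset_comb[of p \<beta>] \<beta> d(1) BE by blast
  then have hd: "h d \<in> S.comb (h ` carrier R) (\<lambda>k. h (\<beta> k)) p" using comb_hom[of "carrier R" p \<beta> d] \<beta> by blast
  have "z' \<otimes>\<^sub>S h d = \<zero>\<^sub>S" by (rule comb_annihilated[OF zc ann _ _ hd]) (use \<beta> in auto)
  then have "h d \<otimes>\<^sub>S z' = \<zero>\<^sub>S" using zc regD[OF d(2)] by (simp add: S.m_comm)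
  then have "z' = \<zero>\<^sub>S" by (rule reg_cancel[OF d(2) zc])
  then have "h x [^]\<^sub>S t \<in> h ` R.red_deg J I t" using z xR by (simp add: monic_def a_minus_def)
  then obtain l where l: "l \<in> R.red_deg J I t" "h x [^]\<^sub>S t = h l" by blast
  have lc: "l \<in> carrier R" using l rdc by blast
  \<comment> \<open>The relation holds in \<open>S\<close>, that is, modulo nilpotents of
    \<open>R\<close>, which the last lemma on reductions removes.\<close>
  have "h (x [^] t \<ominus> l) = \<zero>\<^sub>S" using l(2) xR lc by (simp add: a_minus_def S.r_neg)
  then obtain s :: nat where "(x [^] t \<ominus> l) [^] s = \<zero>" using ker[of "x [^] t \<ominus> l"] xR lc by auto
  then show ?thesis by (rule R.power_mem_of_diff_nilpotent[OF I J JI x t l(1)])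
qed

subsection \<open>Normalised vectors and hyperplanes\<close>

text \<open>A pair \<open>(i, \<tau>)\<close> encodes the point \<open>(0, \<dots>, 0, 1, \<tau>\<^sub>i\<^sub>+\<^sub>1, \<dots>, \<tau>\<^sub>e)\<close> of projective \<open>e\<close>-space
  over the residue field, with the entry \<open>1\<close> at position \<open>i\<close>.\<close>

definition normvecs :: "nat \<Rightarrow> (nat \<times> (nat \<Rightarrow> 'a)) set" where
  "normvecs e = (SIGMA i:{..e}. PiE {i<..e} (\<lambda>_. T))"

lemma finite_normvecs: "finite (normvecs e)"
  unfolding normvecs_def using T_fin by (intro finite_SigmaI finite_PiE) auto

lemma card_normvecs: "card (normvecs e) = (\<Sum>i\<le>e. card T ^ i)"
proof -
  have "card (normvecs e) = (\<Sum>i\<le>e. card (PiE {i<..e} (\<lambda>_. T)))"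
    unfolding normvecs_def using T_fin by (subst card_SigmaI) (auto intro!: finite_PiE)
  also have "\<dots> = (\<Sum>i\<le>e. card T ^ (e - i))" by (simp add: card_PiE)
  also have "\<dots> = (\<Sum>i<Suc e. card T ^ (Suc e - Suc i))" by (simp add: lessThan_Suc_atMost)
  also have "\<dots> = (\<Sum>i<Suc e. card T ^ i)" by (rule sum.nat_diff_reindex)
  finally show ?thesis by (simp add: lessThan_Suc_atMost)
qed

text \<open>With \<open>i = fst p\<close>, the \<open>e\<close> coefficient vectors involved form a
  basis of the hyperplane orthogonal to the projective point encoded by \<open>p\<close>.\<close>

definition hyper :: "(nat \<Rightarrow> 'a) \<Rightarrow> nat \<Rightarrow> nat \<times> (nat \<Rightarrow> 'a) \<Rightarrow> 'a set" where
  "hyper x e p = (\<lambda>l. if l < fst p then x l else x l \<ominus> snd p l \<otimes> x (fst p)) ` ({..e} - {fst p})"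

text \<open>The pivot supplies the one direction missing from the hyperplane, so both together
  recover every \<open>x l\<close>.\<close>

lemma hyper_pivot:
  assumes A: "ideal A R" and x: "\<And>l. l \<le> e \<Longrightarrow> x l \<in> carrier R" and p: "p \<in> normvecs e"
    and sub: "hyper x e p \<subseteq> A" and piv: "x (fst p) \<in> A" and l: "l \<le> e"
  shows "x l \<in> A"
proof -
  obtain i \<tau> where pe: "p = (i, \<tau>)" by (cases p)
  have i: "i \<le> e" and \<tau>: "\<And>k. i < k \<Longrightarrow> k \<le> e \<Longrightarrow> \<tau> k \<in> carrier R"
    using p T_carr unfolding pe normvecs_def by (auto simp: PiE_def Pi_def)
  have mem: "(if k < i then x k else x k \<ominus> \<tau> k \<otimes> x i) \<in> A" if "k \<le> e" "k \<noteq> i" for k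
    using sub that unfolding hyper_def pe by auto
  consider "l < i" | "l = i" | "l > i" by linarith
  then show ?thesis
  proof cases
    case 1
    then show ?thesis using mem[OF l] by simp
  next
    case 2
    then show ?thesis using piv pe by simp
  next
    case 3
    then have "x l \<ominus> \<tau> l \<otimes> x i \<in> A" using mem[OF l] by simp
    moreover have "\<tau> l \<otimes> x i \<in> A" using R.ideal_mult_mem[OF A _ \<tau>[OF 3 l]] piv pe by simp
    ultimately show ?thesis using R.ideal_mem_of_minus_mem[OF A _ _ x[OF l]] by blast
  qed
qed

text \<open>Two distinct hyperplanes span the whole space. If the pivots differ, the smaller pivot
  occurs unchanged in the set belonging to the larger one. If they agree, subtracting the entries at
  an index where the digits differ gives a unit multiple of the pivot.\<close>

lemma hyper_unique:
  assumes A: "ideal A R" and x: "\<And>l. l \<le> e \<Longrightarrow> x l \<in> carrier R"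
    and p: "p \<in> normvecs e" "p' \<in> normvecs e" "p \<noteq> p'"
    and sub: "hyper x e p \<subseteq> A" "hyper x e p' \<subseteq> A" and l: "l \<le> e"
  shows "x l \<in> A"
proof -
  have less: "x l \<in> A" if "fst q < fst q'" "q \<in> normvecs e" "q' \<in> normvecs e" "hyper x e q \<subseteq> A" "hyper x e q' \<subseteq> A" for q q'
  proof -
    have "fst q \<le> e" using that(2) by (auto simp: normvecs_def)
    then have "x (fst q) \<in> hyper x e q'" using that(1) unfolding hyper_def
      by (intro image_eqI[of _ _ "fst q"]) auto
    then show ?thesis using hyper_pivot[OF A x that(2,4) _ l] that(5) by blast
  qed
  consider "fst p < fst p'" | "fst p' < fst p" | "fst p = fst p'" by linarith
  then show ?thesis
  proof cases
    case 1
    then show ?thesis using less p sub by blast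
  next
    case 2
    then show ?thesis using less p sub by blast
  next
    case 3
    obtain i \<tau> \<tau>' where pe: "p = (i, \<tau>)" "p' = (i, \<tau>')" using 3 by (cases p, cases p') auto
    have T1: "\<tau> \<in> PiE {i<..e} (\<lambda>_. T)" "\<tau>' \<in> PiE {i<..e} (\<lambda>_. T)" and i: "i \<le> e"
      using p unfolding pe normvecs_def by auto
    have "\<tau> \<noteq> \<tau>'" using p(3) pe by auto
    then obtain k where k: "k \<in> {i<..e}" "\<tau> k \<noteq> \<tau>' k" using PiE_ext[OF T1] by blast
    have kT: "\<tau> k \<in> T" "\<tau>' k \<in> T" using T1 k by auto
    define a b u v where "a = x k" and "b = x i" and "u = \<tau> k" and "v = \<tau>' k"
    have cc: "a \<in> carrier R" "b \<in> carrier R" "u \<in> carrier R" "v \<in> carrier R"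
      using x k i kT T_carr by (auto simp: a_def b_def u_def v_def)
    have ki: "\<not> k < i" "k \<in> {..e} - {i}" using k by auto
    have "a \<ominus> u \<otimes> b \<in> A" "a \<ominus> v \<otimes> b \<in> A"
      using sub ki unfolding hyper_def pe a_def b_def u_def v_def by auto
    then have "(a \<ominus> v \<otimes> b) \<ominus> (a \<ominus> u \<otimes> b) \<in> A" using R.ideal_minus_mem[OF A] by blast
    moreover have "(a \<ominus> v \<otimes> b) \<ominus> (a \<ominus> u \<otimes> b) = (u \<ominus> v) \<otimes> b"
      using cc by (simp add: R.ring_nf)
    ultimately have m1: "(u \<ominus> v) \<otimes> b \<in> A" by simp
    have un: "u \<ominus> v \<in> Units R"
      using unit_iff_notin_m[of "u \<ominus> v"] T_distinct[OF kT k(2)] cc by (simp add: u_def v_def)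
    have "inv (u \<ominus> v) \<otimes> ((u \<ominus> v) \<otimes> b) \<in> A" using R.ideal_mult_mem[OF A m1] un by simp
    moreover have "inv (u \<ominus> v) \<otimes> ((u \<ominus> v) \<otimes> b) = b"
      using un cc by (simp add: R.m_assoc[symmetric])
    ultimately have "x (fst p) \<in> A" by (simp add: b_def pe)
    then show ?thesis using hyper_pivot[OF A x p(1) sub(1) _ l] by blast
  qed
qed

lemma exists_avoiding_hyper:
  assumes fin: "finite N" and A: "\<And>M. M \<in> N \<Longrightarrow> ideal (A M) R"
    and x: "\<And>l. l \<le> e \<Longrightarrow> x l \<in> carrier R"
    and av: "\<And>M. M \<in> N \<Longrightarrow> \<exists>l\<le>e. x l \<notin> A M" and card: "card N < card (normvecs e)"
  shows "\<exists>p\<in>normvecs e. \<forall>M\<in>N. \<not> hyper x e p \<subseteq> A M"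
proof (rule ccontr)
  assume "\<not> ?thesis"
  then have "\<forall>p\<in>normvecs e. \<exists>M. M \<in> N \<and> hyper x e p \<subseteq> A M" by blast
  then obtain f where f: "\<And>p. p \<in> normvecs e \<Longrightarrow> f p \<in> N \<and> hyper x e p \<subseteq> A (f p)" by metis
  have "inj_on f (normvecs e)"
  proof (rule inj_onI, rule ccontr)
    fix p p' assume p: "p \<in> normvecs e" "p' \<in> normvecs e" "f p = f p'" "p \<noteq> p'"
    have fN: "f p \<in> N" using f p(1) by blast
    have "x l \<in> A (f p)" if "l \<le> e" for l
      by (rule hyper_unique[OF A[OF fN] x p(1,2,4) _ _ that]) (use f[OF p(1)] f[OF p(2)] p(3) in auto)
    then show False using av[OF fN] by blast
  qed
  then have "card (normvecs e) \<le> card N" using f fin by (intro card_inj_on_le[of f]) auto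
  then show False using card by simp
qed

lemma few_generators_avoiding:
  assumes fin: "finite N" and A: "\<And>M. M \<in> N \<Longrightarrow> ideal (A M) R"
    and card: "card N < card (normvecs n)"
  shows "finite G \<Longrightarrow> G \<subseteq> carrier R \<Longrightarrow> (\<And>M. M \<in> N \<Longrightarrow> \<not> G \<subseteq> A M) \<Longrightarrow>
    \<exists>G'. finite G' \<and> G' \<subseteq> Idl G \<and> card G' \<le> n \<and> (\<forall>M\<in>N. \<not> G' \<subseteq> A M)"
proof (induct "card G" arbitrary: G rule: less_induct)
  case less
  show ?case
  proof (cases "card G \<le> n")
    case True
    then show ?thesis using less R.genideal_self[of G] by blast
  next
    case False
    define e where "e = card G - 1"
    have e: "card G = Suc e" "n \<le> e" using False by (auto simp: e_def)
    obtain x where "bij_betw x {0..<card G} G" using ex_bij_betw_nat_finite[OF less(2)] by blast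
    then have xG: "G = x ` {..e}" by (auto simp: bij_betw_def e lessThan_atLeast0[symmetric] lessThan_Suc_atMost)
    have xc: "x l \<in> carrier R" if "l \<le> e" for l using that xG less(3) by auto
    have "\<exists>l\<le>e. x l \<notin> A M" if "M \<in> N" for M using less(4)[OF that] xG by auto
    moreover have "card N < card (normvecs e)"
    proof -
      have "(\<Sum>i\<le>n. card T ^ i) \<le> (\<Sum>i\<le>e. card T ^ i)" using e(2) by (intro sum_mono2) auto
      then show ?thesis using card by (simp add: card_normvecs)
    qed
    ultimately obtain p where p: "p \<in> normvecs e" and av: "\<And>M. M \<in> N \<Longrightarrow> \<not> hyper x e p \<subseteq> A M"
      using exists_avoiding_hyper[where N = N and A = A and e = e and x = x, OF fin A xc] by blast
    define H where "H = hyper x e p"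
    have i: "fst p \<le> e" and \<tau>: "\<And>k. fst p < k \<Longrightarrow> k \<le> e \<Longrightarrow> snd p k \<in> carrier R"
      using p T_carr unfolding normvecs_def by (auto simp: PiE_def Pi_def)
    have Hf: "finite H" by (simp add: H_def hyper_def)
    have "card H \<le> card ({..e} - {fst p})" unfolding H_def hyper_def by (rule card_image_le) simp
    also have "\<dots> = e" using i by simp
    finally have cH: "card H < card G" using e by simp
    have GI: "ideal (Idl G) R" using less(3) R.genideal_ideal by blast
    have xI: "x l \<in> Idl G" if "l \<le> e" for l using R.genideal_self[OF less(3)] xG that by auto
    have HI: "H \<subseteq> Idl G"
    proof
      fix z assume "z \<in> H"
      then obtain l where l: "l \<le> e" "l \<noteq> fst p" "z = (if l < fst p then x l else x l \<ominus> snd p l \<otimes> x (fst p))"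
        unfolding H_def hyper_def by blast
      show "z \<in> Idl G"
      proof (cases "l < fst p")
        case True
        then show ?thesis using l xI by simp
      next
        case False
        then have "snd p l \<in> carrier R" using \<tau>[of l] l by simp
        then show ?thesis using False l R.ideal_minus_mem[OF GI xI[OF l(1)] R.ideal_mult_mem[OF GI xI[OF i]]] by simp
      qed
    qed
    have Hc: "H \<subseteq> carrier R" using HI R.ideal_sub[OF GI] by blast
    obtain G' where G': "finite G'" "G' \<subseteq> Idl H" "card G' \<le> n" "\<forall>M\<in>N. \<not> G' \<subseteq> A M"
      using less(1)[OF cH Hf Hc] av unfolding H_def by blast
    have "Idl H \<subseteq> Idl G" using R.genideal_minimal[OF GI HI] .
    then show ?thesis using G' by blast
  qed
qed

theorem reductions_if_few_max:
  assumes fin: "finite (Max_spec RBr)" and card: "card (Max_spec RBr) < card (normvecs n)" and I: "ideal I R"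
  shows "\<exists>J. reduction R J I \<and> n_generated R n J"
proof -
  obtain G where G: "G \<subseteq> carrier R" "finite G" "I = Idl G" using finetely_gen[OF I] by blast
  have GI: "G \<subseteq> I" using R.genideal_self G by blast
  define W where "W M w \<longleftrightarrow> w \<in> carrier S \<and> (\<forall>g\<in>G. w \<otimes>\<^sub>S h g \<in> RB) \<and> (\<exists>g\<in>G. w \<otimes>\<^sub>S h g \<notin> M)" for M w
  \<comment> \<open>At the remaining maximal ideals the generators are killed by an element outside
    the ideal, so nothing has to be required of \<open>J\<close> there.\<close>
  define N where "N = {M \<in> Max_spec RBr. \<exists>w. W M w}"
  define w where "w M = (SOME w. W M w)" for M
  have w: "W M (w M)" if "M \<in> N" for M unfolding w_def by (rule someI_ex) (use that in \<open>simp add: N_def\<close>)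
  have wc: "w M \<in> carrier S" if "M \<in> N" for M using w[OF that] by (simp add: W_def)
  have Nmax: "maximalideal M RBr" if "M \<in> N" for M using that by (simp add: N_def Max_spec_def)
  \<comment> \<open>In valuation terms, \<open>A M\<close> consists of the elements whose value at
    \<open>M\<close> exceeds the minimal value on \<open>G\<close>; \<open>J\<close> generates
    \<open>I\<close> locally at \<open>M\<close> once it is not contained in
    \<open>A M\<close>.\<close>
  define A where "A M = {x \<in> carrier R. w M \<otimes>\<^sub>S h x \<in> M}" for M
  have AI: "ideal (A M) R" if M: "M \<in> N" for M
    unfolding A_def
    by (rule scaled_preimage_ideal[OF wc[OF M]])
      (use maxRB_sub[OF Nmax[OF M]] maxRB_zero[OF Nmax[OF M]] maxRB_add[OF Nmax[OF M]] maxRB_mult[OF Nmax[OF M]] h_RB RB_carr in auto)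
  have ext: "w' \<otimes>\<^sub>S h x \<in> RB" if w': "w' \<in> carrier S" "\<And>g. g \<in> G \<Longrightarrow> w' \<otimes>\<^sub>S h g \<in> RB" and x: "x \<in> I" for w' x
  proof -
    have "ideal {x \<in> carrier R. w' \<otimes>\<^sub>S h x \<in> RB} R"
      by (rule scaled_preimage_ideal[OF w'(1)]) (use RB_carr RB_zero RB_add RB_mult h_RB in auto)
    then have "Idl G \<subseteq> {x \<in> carrier R. w' \<otimes>\<^sub>S h x \<in> RB}" by (rule R.genideal_minimal) (use G w' in auto)
    then show ?thesis using x G by blast
  qed
  have ext0: "s \<otimes>\<^sub>S h x = \<zero>\<^sub>S" if s: "s \<in> carrier S" "\<And>g. g \<in> G \<Longrightarrow> s \<otimes>\<^sub>S h g = \<zero>\<^sub>S" and x: "x \<in> I" for s x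
  proof -
    have "ideal {x \<in> carrier R. s \<otimes>\<^sub>S h x \<in> {\<zero>\<^sub>S}} R"
      by (rule scaled_preimage_ideal[OF s(1)]) auto
    then have "Idl G \<subseteq> {x \<in> carrier R. s \<otimes>\<^sub>S h x \<in> {\<zero>\<^sub>S}}" by (rule R.genideal_minimal) (use G s in auto)
    then show ?thesis using x G by blast
  qed
  have finN: "finite N" using fin by (simp add: N_def)
  have "card N \<le> card (Max_spec RBr)" using fin by (intro card_mono) (auto simp: N_def)
  then have cN: "card N < card (normvecs n)" using card by simp
  have "\<not> G \<subseteq> A M" if "M \<in> N" for M using w[OF that] by (auto simp: W_def A_def)
  then obtain G' where G': "finite G'" "G' \<subseteq> Idl G" "card G' \<le> n" "\<And>M. M \<in> N \<Longrightarrow> \<not> G' \<subseteq> A M"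
    using few_generators_avoiding[where N = N and A = A, OF finN AI cN G(2,1)] by blast
  have G'c: "G' \<subseteq> carrier R" using G'(2) R.ideal_sub[OF I] G(3) by blast
  define J where "J = Idl G'"
  have J: "ideal J R" unfolding J_def by (rule R.genideal_ideal[OF G'c])
  have JI: "J \<subseteq> I" unfolding J_def by (rule R.genideal_minimal[OF I]) (use G' G in blast)
  have G'J: "G' \<subseteq> J" unfolding J_def by (rule R.genideal_self[OF G'c])
  have loc: "(\<exists>w\<in>carrier S. (\<forall>x\<in>I. w \<otimes>\<^sub>S h x \<in> RB) \<and> (\<exists>j\<in>J. w \<otimes>\<^sub>S h j \<notin> M)) \<or>
      (\<exists>s\<in>RB. s \<notin> M \<and> (\<forall>x\<in>I. s \<otimes>\<^sub>S h x = \<zero>\<^sub>S))" if M: "maximalideal M RBr" for M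
  proof (cases "M \<in> N")
    case True
    have "\<exists>j\<in>J. w M \<otimes>\<^sub>S h j \<notin> M" using G'(4)[OF True] G'J G'c by (auto simp: A_def)
    moreover have "\<forall>x\<in>I. w M \<otimes>\<^sub>S h x \<in> RB" using ext[OF wc[OF True]] w[OF True] by (simp add: W_def)
    ultimately show ?thesis using wc[OF True] by blast
  next
    case False
    then have "\<not> (\<exists>w. W M w)" using M by (simp add: N_def Max_spec_def)
    then obtain s where s: "s \<in> RB" "s \<notin> M" "\<forall>g\<in>G. s \<otimes>\<^sub>S h g = \<zero>\<^sub>S"
      using local_generator[OF G(2,1) M] unfolding W_def by blast
    then show ?thesis using ext0[OF RB_carr[OF s(1)]] by blast
  qed
  have "reduction R J (Idl G)"
  proof (rule R.reduction_if_generators_integral[OF G(2,1) J])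
    show "J \<subseteq> Idl G" using JI G by simp
    fix x assume "x \<in> G"
    then have "x \<in> I" using GI by blast
    from integral_over_ideal[OF I J JI this loc] show "\<exists>t\<ge>1. x [^] t \<in> R.red_deg J (Idl G) t" using G(3) by simp
  qed
  moreover have "n_generated R n J" unfolding n_generated_def J_def using G' G'c by blast
  ultimately show ?thesis using G(3) by blast
qed

section \<open>Common zeros of linear forms over the residue field\<close>

fun lin :: "(nat \<Rightarrow> 'a) \<Rightarrow> (nat \<Rightarrow> 'a) \<Rightarrow> nat \<Rightarrow> 'a" where
  "lin a v 0 = \<zero>"
| "lin a v (Suc k) = lin a v k \<oplus> a k \<otimes> v k"

lemma lin_carr: "(\<And>i. i < k \<Longrightarrow> a i \<in> carrier R) \<Longrightarrow> (\<And>i. i < k \<Longrightarrow> v i \<in> carrier R) \<Longrightarrow> lin a v k \<in> carrier R"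
  by (induct k) auto

lemma lin_cong_coeff: "(\<And>i. i < k \<Longrightarrow> a i = a' i) \<Longrightarrow> lin a v k = lin a' v k"
  by (induct k) auto

lemma comb_lin:
  assumes "\<And>k. k < p \<Longrightarrow> \<beta> k \<in> carrier R" "u \<in> R.comb (carrier R) \<beta> p"
  shows "\<exists>a. (\<forall>i. a i \<in> carrier R) \<and> u = lin a \<beta> p"
  using assms
proof (induct p arbitrary: u)
  case 0
  from 0(2) have "u = \<zero>" by (induct rule: R.comb.induct) auto
  then show ?case by (intro exI[of _ "\<lambda>_. \<zero>"]) simp
next
  case (Suc p)
  obtain v c where v: "v \<in> R.comb (carrier R) \<beta> p" and c: "c \<in> carrier R" and u: "u = v \<oplus> c \<otimes> \<beta> p"
    using R.comb_Suc[OF _ _ _ Suc.prems(1,2)] by auto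
  obtain a where a: "\<forall>i. a i \<in> carrier R" "v = lin a \<beta> p" using Suc.hyps[OF _ v] Suc.prems(1) by auto
  define a' where "a' i = (if i = p then c else a i)" for i
  have "lin a' \<beta> p = lin a \<beta> p" by (rule lin_cong_coeff) (simp add: a'_def)
  then have "u = lin a' \<beta> (Suc p)" using u a(2) by (simp add: a'_def)
  moreover have "\<forall>i. a' i \<in> carrier R" using a c by (simp add: a'_def)
  ultimately show ?case by blast
qed

lemma lin_scale:
  assumes c: "c \<in> carrier R" and a: "\<And>i. a i \<in> carrier R"
  shows "(\<And>i. i < k \<Longrightarrow> v i \<in> carrier R) \<Longrightarrow> lin a (\<lambda>i. c \<otimes> v i) k = c \<otimes> lin a v k"
proof (induct k)
  case (Suc k)
  have "lin a v k \<in> carrier R" "a k \<in> carrier R" "v k \<in> carrier R" using a Suc.prems by (auto intro: lin_carr)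
  then show ?case using Suc c by (simp add: R.r_distr R.m_lcomm)
qed (use c in simp)

lemma lin_diff_mem_m:
  assumes a: "\<And>i. a i \<in> carrier R"
  shows "(\<And>i. i < k \<Longrightarrow> v i \<in> carrier R) \<Longrightarrow> (\<And>i. i < k \<Longrightarrow> v' i \<in> carrier R) \<Longrightarrow>
    (\<And>i. i < k \<Longrightarrow> v i \<ominus> v' i \<in> m) \<Longrightarrow> lin a v k \<ominus> lin a v' k \<in> m"
proof (induct k)
  case 0
  then show ?case using R.ideal_zero_mem[OF m_ideal] by (simp add: a_minus_def)
next
  case (Suc k)
  define L L' c x y where "L = lin a v k" and "L' = lin a v' k" and "c = a k" and "x = v k" and "y = v' k"
  have cc: "L \<in> carrier R" "L' \<in> carrier R" "c \<in> carrier R" "x \<in> carrier R" "y \<in> carrier R"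
    using a Suc.prems by (auto simp: L_def L'_def c_def x_def y_def intro: lin_carr)
  have "(L \<ominus> L') \<oplus> c \<otimes> (x \<ominus> y) \<in> m"
    using Suc cc by (intro R.ideal_add_mem[OF m_ideal] R.ideal_mult_mem[OF m_ideal]) (auto simp: L_def L'_def x_def y_def)
  moreover have "(L \<ominus> L') \<oplus> c \<otimes> (x \<ominus> y) = (L \<oplus> c \<otimes> x) \<ominus> (L' \<oplus> c \<otimes> y)"
    using cc by (simp add: R.ring_nf)
  ultimately show ?case by (simp add: L_def L'_def c_def x_def y_def)
qed

lemma lin_diff:
  assumes a: "\<And>i. a i \<in> carrier R"
  shows "(\<And>i. i < k \<Longrightarrow> v i \<in> carrier R) \<Longrightarrow> (\<And>i. i < k \<Longrightarrow> v' i \<in> carrier R) \<Longrightarrow>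
    lin a (\<lambda>i. v i \<ominus> v' i) k = lin a v k \<ominus> lin a v' k"
proof (induct k)
  case 0
  then show ?case by (simp add: a_minus_def)
next
  case (Suc k)
  define L L' c x y where "L = lin a v k" and "L' = lin a v' k" and "c = a k" and "x = v k" and "y = v' k"
  have cc: "L \<in> carrier R" "L' \<in> carrier R" "c \<in> carrier R" "x \<in> carrier R" "y \<in> carrier R"
    using a Suc.prems by (auto simp: L_def L'_def c_def x_def y_def intro: lin_carr)
  have "(L \<ominus> L') \<oplus> c \<otimes> (x \<ominus> y) = (L \<oplus> c \<otimes> x) \<ominus> (L' \<oplus> c \<otimes> y)"
    using cc by (simp add: R.ring_nf)
  then show ?case using Suc by (simp add: L_def L'_def c_def x_def y_def)
qed

definition nvec :: "nat \<times> (nat \<Rightarrow> 'a) \<Rightarrow> nat \<Rightarrow> 'a" where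
  "nvec p l = (if l < fst p then \<zero> else if l = fst p then \<one> else snd p l)"

lemma nvec_carr: "p \<in> normvecs n \<Longrightarrow> l < Suc n \<Longrightarrow> nvec p l \<in> carrier R"
  using T_carr by (auto simp: normvecs_def nvec_def PiE_def Pi_def)

text \<open>At most \<open>n\<close> linear forms in \<open>n + 1\<close> variables over the residue
  field have a common nontrivial zero. Counting replaces linear algebra: there are
  \<open>q^(n+1)\<close> digit vectors but at most \<open>q^n\<close> tuples of values, and the
  difference of two colliding vectors is such a zero.\<close>

lemma exists_kernel_normvec:
  assumes fin: "finite X" and card: "card X \<le> n" and a: "\<And>s i. s \<in> X \<Longrightarrow> a s i \<in> carrier R"
  shows "\<exists>p\<in>normvecs n. \<forall>s\<in>X. lin (a s) (nvec p) (Suc n) \<in> m"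
proof -
  define D where "D = PiE {..n} (\<lambda>_. T)"
  have Dc: "\<tau> i \<in> carrier R" if "\<tau> \<in> D" "i < Suc n" for \<tau> i
    using that T_carr by (auto simp: D_def PiE_def Pi_def)
  have lc: "lin (a s) \<tau> (Suc n) \<in> carrier R" if "\<tau> \<in> D" "s \<in> X" for \<tau> s
    by (rule lin_carr) (use a that Dc in auto)
  define F where "F \<tau> = (\<lambda>s\<in>X. SOME t. t \<in> T \<and> lin (a s) \<tau> (Suc n) \<ominus> t \<in> m)" for \<tau>
  have F: "F \<tau> s \<in> T \<and> lin (a s) \<tau> (Suc n) \<ominus> F \<tau> s \<in> m" if "\<tau> \<in> D" "s \<in> X" for \<tau> s
    unfolding F_def restrict_apply'[OF that(2)]
    by (rule someI_ex) (use T_repr[OF lc[OF that]] in blast)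
  have "F ` D \<subseteq> PiE X (\<lambda>_. T)"
  proof
    fix f assume "f \<in> F ` D"
    then obtain \<tau> where "\<tau> \<in> D" "f = F \<tau>" by blast
    then show "f \<in> PiE X (\<lambda>_. T)" using F by (auto simp: F_def)
  qed
  moreover have "card (PiE X (\<lambda>_. T)) < card D"
  proof -
    have "card (PiE X (\<lambda>_. T)) = card T ^ card X" by (simp add: card_PiE fin)
    also have "\<dots> < card T ^ Suc n" using card card_T by (intro power_strict_increasing) auto
    also have "\<dots> = card D" by (simp add: D_def card_PiE)
    finally show ?thesis .
  qed
  moreover have "finite (PiE X (\<lambda>_. T))" using fin T_fin by (intro finite_PiE) auto
  ultimately have "\<not> inj_on F D" using card_inj_on_le[of F D] by (meson leD)
  then obtain \<tau> \<tau>' where t: "\<tau> \<in> D" "\<tau>' \<in> D" "\<tau> \<noteq> \<tau>'" "F \<tau> = F \<tau>'" unfolding inj_on_def by blast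
  define d where "d i = \<tau> i \<ominus> \<tau>' i" for i
  have dc: "d i \<in> carrier R" if "i < Suc n" for i using Dc[OF t(1) that] Dc[OF t(2) that] by (simp add: d_def)
  have ker: "lin (a s) d (Suc n) \<in> m" if s: "s \<in> X" for s
  proof -
    define x y f where "x = lin (a s) \<tau> (Suc n)" and "y = lin (a s) \<tau>' (Suc n)" and "f = F \<tau> s"
    have cc: "x \<in> carrier R" "y \<in> carrier R" "f \<in> carrier R"
      using lc[OF t(1) s] lc[OF t(2) s] F[OF t(1) s] T_carr by (auto simp: x_def y_def f_def simp del: lin.simps)
    have "(x \<ominus> f) \<ominus> (y \<ominus> f) \<in> m"
      using F[OF t(1) s] F[OF t(2) s] t(4) R.ideal_minus_mem[OF m_ideal] by (simp add: x_def y_def f_def del: lin.simps)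
    moreover have "(x \<ominus> f) \<ominus> (y \<ominus> f) = x \<ominus> y" using cc by (simp add: R.ring_nf)
    moreover have "lin (a s) d (Suc n) = x \<ominus> y"
      unfolding d_def x_def y_def by (rule lin_diff) (use a s Dc t in auto)
    ultimately show ?thesis by simp
  qed
  have "\<exists>i. i \<le> n \<and> \<tau> i \<noteq> \<tau>' i"
    using t(1-3) PiE_ext[of \<tau> "{..n}" "\<lambda>_. T" \<tau>'] unfolding D_def by auto
  then obtain i1 where "i1 \<le> n" "\<tau> i1 \<noteq> \<tau>' i1" by blast
  then have i1: "i1 \<le> n \<and> d i1 \<notin> m" using t(1,2) T_distinct by (auto simp: d_def D_def)
  \<comment> \<open>The first coordinate that is nonzero in the residue field becomes the pivot;
    dividing by it produces the entry \<open>1\<close> of a normalised vector.\<close>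
  define i where "i = (LEAST i. i \<le> n \<and> d i \<notin> m)"
  have i: "i \<le> n" "d i \<notin> m" using LeastI[of "\<lambda>i. i \<le> n \<and> d i \<notin> m", OF i1] unfolding i_def by auto
  have low: "d l \<in> m" if "l < i" for l
    using not_less_Least[of l "\<lambda>i. i \<le> n \<and> d i \<notin> m"] that i(1) unfolding i_def[symmetric] by auto
  have u: "d i \<in> Units R" using unit_iff_notin_m dc i by auto
  define c where "c = inv (d i)"
  have cc: "c \<in> carrier R" "c \<otimes> d i = \<one>" using u by (auto simp: c_def)
  define v where "v l = c \<otimes> d l" for l
  have vc: "v l \<in> carrier R" if "l < Suc n" for l using dc[OF that] cc by (simp add: v_def)
  \<comment> \<open>The scaled coordinates are replaced by their representatives in
    \<open>T\<close>, which alters each form only by an element of \<open>m\<close>.\<close>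
  define \<sigma> where "\<sigma> = (\<lambda>l\<in>{i<..n}. SOME t. t \<in> T \<and> v l \<ominus> t \<in> m)"
  have \<sigma>: "\<sigma> l \<in> T \<and> v l \<ominus> \<sigma> l \<in> m" if "l \<in> {i<..n}" for l
    unfolding \<sigma>_def restrict_apply'[OF that]
    by (rule someI_ex) (use T_repr[OF vc[of l]] that in auto)
  have p: "(i, \<sigma>) \<in> normvecs n" unfolding normvecs_def using i \<sigma> by (auto simp: \<sigma>_def)
  have close: "v l \<ominus> nvec (i, \<sigma>) l \<in> m" if l: "l < Suc n" for l
  proof -
    consider "l < i" | "l = i" | "l > i" by linarith
    then show ?thesis
    proof cases
      case 1
      then have "v l \<in> m" using R.ideal_mult_mem[OF m_ideal low cc(1)] by (simp add: v_def)
      then show ?thesis using 1 vc[OF l] by (simp add: nvec_def a_minus_def)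
    next
      case 2
      then show ?thesis using cc R.ideal_zero_mem[OF m_ideal] by (simp add: nvec_def v_def a_minus_def R.r_neg)
    next
      case 3
      then show ?thesis using \<sigma>[of l] l by (simp add: nvec_def)
    qed
  qed
  have "lin (a s) (nvec (i, \<sigma>)) (Suc n) \<in> m" if s: "s \<in> X" for s
  proof -
    have as: "\<And>i. a s i \<in> carrier R" using a s by blast
    have "lin (a s) v (Suc n) = c \<otimes> lin (a s) d (Suc n)"
      unfolding v_def by (rule lin_scale[OF cc(1) as dc])
    then have vm: "lin (a s) v (Suc n) \<in> m" using R.ideal_mult_mem[OF m_ideal ker[OF s] cc(1)] by simp
    have df: "lin (a s) v (Suc n) \<ominus> lin (a s) (nvec (i, \<sigma>)) (Suc n) \<in> m"
      by (rule lin_diff_mem_m[OF as vc nvec_carr[OF p] close])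
    define x y where "x = lin (a s) v (Suc n)" and "y = lin (a s) (nvec (i, \<sigma>)) (Suc n)"
    have xy: "x \<in> carrier R" "y \<in> carrier R"
      unfolding x_def y_def using lin_carr[of "Suc n" "a s" v] lin_carr[of "Suc n" "a s" "nvec (i, \<sigma>)"] as vc nvec_carr[OF p]
      by (auto simp del: lin.simps)
    have "x \<ominus> (x \<ominus> y) \<in> m" using R.ideal_minus_mem[OF m_ideal vm df] by (simp add: x_def y_def del: lin.simps)
    moreover have "x \<ominus> (x \<ominus> y) = y" using xy by (simp add: R.ring_nf)
    ultimately show ?thesis by (simp add: y_def del: lin.simps)
  qed
  then show ?thesis using p by blast
qed

subsection \<open>Prescribed residues at maximal ideals\<close>

text \<open>Distinct maximal ideals are incomparable, so each \<open>M'\<close> contains an element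
  congruent to \<open>1\<close> modulo \<open>M\<close>; the product of these elements is the
  required \<open>e\<close>.\<close>

lemma exists_separating:
  assumes "finite N" and M: "maximalideal M RBr" and N: "\<And>M'. M' \<in> N \<Longrightarrow> maximalideal M' RBr \<and> M' \<noteq> M"
  shows "\<exists>e\<in>RB. e \<ominus>\<^sub>S \<one>\<^sub>S \<in> M \<and> (\<forall>M'\<in>N. e \<in> M')"
  using assms(1) N
proof (induct N)
  case empty
  have "\<one>\<^sub>S \<ominus>\<^sub>S \<one>\<^sub>S \<in> M" using maxRB_zero[OF M] by (simp add: a_minus_def S.r_neg)
  then show ?case using RB_one by blast
next
  case (insert M' N)
  then obtain e where e: "e \<in> RB" "e \<ominus>\<^sub>S \<one>\<^sub>S \<in> M" "\<And>M'. M' \<in> N \<Longrightarrow> e \<in> M'" by blast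
  have M': "maximalideal M' RBr" "M' \<noteq> M" using insert.prems by auto
  have MI: "ideal M RBr" using M by (rule maximalideal.axioms)
  have "\<not> M' \<subseteq> M"
  proof
    assume "M' \<subseteq> M"
    then have "M = M' \<or> M = carrier RBr"
      using maximalideal.I_maximal[OF M'(1) MI] RBr.ideal_sub[OF MI] by blast
    then show False using M'(2) maximalideal.I_notcarr[OF M] by auto
  qed
  then obtain b where b: "b \<in> M'" "b \<notin> M" by blast
  have bRB: "b \<in> RB" using b maxRB_sub[OF M'(1)] by blast
  obtain r where r: "r \<in> RB" "r \<otimes>\<^sub>S b \<ominus>\<^sub>S \<one>\<^sub>S \<in> M" using maxRB_inv[OF M bRB b(2)] by blast
  define u where "u = r \<otimes>\<^sub>S b"
  have uRB: "u \<in> RB" and uM': "u \<in> M'" and u1: "u \<ominus>\<^sub>S \<one>\<^sub>S \<in> M"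
    using RB_mult[OF r(1) bRB] maxRB_mult[OF M'(1) b(1) r(1)] r(2) by (auto simp: u_def)
  have cc: "e \<in> carrier S" "u \<in> carrier S" using e uRB RB_carr by auto
  have "e \<otimes>\<^sub>S (u \<ominus>\<^sub>S \<one>\<^sub>S) \<oplus>\<^sub>S (e \<ominus>\<^sub>S \<one>\<^sub>S) \<in> M"
    using maxRB_add[OF M maxRB_mult[OF M u1 e(1)] e(2)] .
  moreover have "e \<otimes>\<^sub>S (u \<ominus>\<^sub>S \<one>\<^sub>S) \<oplus>\<^sub>S (e \<ominus>\<^sub>S \<one>\<^sub>S) = e \<otimes>\<^sub>S u \<ominus>\<^sub>S \<one>\<^sub>S"
    using cc by (simp add: S.ring_nf)
  moreover have "e \<otimes>\<^sub>S u \<in> M'" using maxRB_mult[OF M'(1) uM' e(1)] .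
  moreover have "e \<otimes>\<^sub>S u \<in> M2" if "M2 \<in> N" for M2
  proof -
    have "u \<otimes>\<^sub>S e \<in> M2" using maxRB_mult[OF _ e(3)[OF that] uRB] insert.prems that by blast
    then show ?thesis using cc by (simp add: S.m_comm)
  qed
  ultimately show ?case using RB_mult[OF e(1) uRB] by (intro bexI[of _ "e \<otimes>\<^sub>S u"]) auto
qed

text \<open>Chinese remainder theorem by successive correction: \<open>x + e (c - x)\<close> takes
  the new residue \<open>c\<close> where \<open>e\<close> is \<open>1\<close> and keeps the old
  residues where \<open>e\<close> is \<open>0\<close>.\<close>

lemma exists_prescribed_residues:
  assumes "finite X" "inj_on f X" "\<And>p. p \<in> X \<Longrightarrow> maximalideal (f p) RBr" "\<And>p. p \<in> X \<Longrightarrow> v p \<in> carrier R"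
  shows "\<exists>x\<in>RB. \<forall>p\<in>X. x \<ominus>\<^sub>S h (v p) \<in> f p"
  using assms
proof (induct X)
  case empty
  then show ?case using RB_one by blast
next
  case (insert p X)
  then obtain x where x: "x \<in> RB" "\<And>p. p \<in> X \<Longrightarrow> x \<ominus>\<^sub>S h (v p) \<in> f p" by auto
  have Mp: "maximalideal (f p) RBr" using insert by blast
  have "\<exists>e\<in>RB. e \<ominus>\<^sub>S \<one>\<^sub>S \<in> f p \<and> (\<forall>M'\<in>f ` X. e \<in> M')"
  proof (rule exists_separating[OF _ Mp])
    show "finite (f ` X)" using insert by simp
    fix M' assume "M' \<in> f ` X"
    then obtain p' where "p' \<in> X" "M' = f p'" by blast
    then show "maximalideal M' RBr \<and> M' \<noteq> f p" using insert.prems insert.hyps(2) by (auto simp: inj_on_def)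
  qed
  then obtain e where e: "e \<in> RB" "e \<ominus>\<^sub>S \<one>\<^sub>S \<in> f p" "\<And>p'. p' \<in> X \<Longrightarrow> e \<in> f p'" by blast
  define c where "c = h (v p)"
  have cRB: "c \<in> RB" using h_RB insert.prems(3) by (simp add: c_def)
  have cc: "c \<in> carrier S" "e \<in> carrier S" "x \<in> carrier S" using cRB e(1) x(1) RB_carr by auto
  define x' where "x' = x \<oplus>\<^sub>S e \<otimes>\<^sub>S (c \<ominus>\<^sub>S x)"
  have cx: "c \<ominus>\<^sub>S x \<in> RB" using RB_minus[OF cRB x(1)] .
  have x'RB: "x' \<in> RB" unfolding x'_def by (intro RB_add RB_mult x(1) e(1) cx)
  have "(c \<ominus>\<^sub>S x) \<otimes>\<^sub>S (e \<ominus>\<^sub>S \<one>\<^sub>S) \<in> f p" using maxRB_mult[OF Mp e(2) cx] .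
  moreover have "(c \<ominus>\<^sub>S x) \<otimes>\<^sub>S (e \<ominus>\<^sub>S \<one>\<^sub>S) = x' \<ominus>\<^sub>S c"
    unfolding x'_def using cc by (simp add: S.ring_nf)
  ultimately have "x' \<ominus>\<^sub>S h (v p) \<in> f p" by (simp add: c_def)
  moreover have "x' \<ominus>\<^sub>S h (v p') \<in> f p'" if p': "p' \<in> X" for p'
  proof -
    have Mp': "maximalideal (f p') RBr" using insert.prems p' by blast
    define d where "d = h (v p')"
    have dc: "d \<in> carrier S" using insert.prems(3) p' by (simp add: d_def)
    have "(x \<ominus>\<^sub>S d) \<oplus>\<^sub>S (c \<ominus>\<^sub>S x) \<otimes>\<^sub>S e \<in> f p'"
      using maxRB_add[OF Mp' x(2)[OF p'] maxRB_mult[OF Mp' e(3)[OF p'] cx]] by (simp add: d_def)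
    moreover have "(x \<ominus>\<^sub>S d) \<oplus>\<^sub>S (c \<ominus>\<^sub>S x) \<otimes>\<^sub>S e = x' \<ominus>\<^sub>S d"
      unfolding x'_def using cc dc by (simp add: S.ring_nf)
    ultimately show ?thesis by (simp add: d_def)
  qed
  ultimately show ?case using x'RB by (intro bexI[of _ x']) auto
qed

lemma common_denominator:
  fixes k :: nat
  shows "(\<And>i. i < k \<Longrightarrow> x i \<in> carrier S) \<Longrightarrow> \<exists>c. reg c \<and> (\<forall>i<k. \<exists>z\<in>carrier R. h c \<otimes>\<^sub>S x i = h z)"
proof (induct k)
  case 0
  then show ?case using reg_one by auto
next
  case (Suc k)
  then obtain c where c: "reg c" "\<And>i. i < k \<Longrightarrow> \<exists>z\<in>carrier R. h c \<otimes>\<^sub>S x i = h z" by auto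
  obtain d r where d: "reg d" "r \<in> carrier R" "h d \<otimes>\<^sub>S x k = h r" using regE[of "x k"] Suc.prems by auto
  have cc: "c \<in> carrier R" "d \<in> carrier R" using regD c d by auto
  have "\<exists>z\<in>carrier R. h (c \<otimes> d) \<otimes>\<^sub>S x i = h z" if i: "i < Suc k" for i
  proof (cases "i = k")
    case True
    have "h (c \<otimes> d) \<otimes>\<^sub>S x k = h c \<otimes>\<^sub>S (h d \<otimes>\<^sub>S x k)" using cc Suc.prems by (simp add: S.m_assoc)
    also have "\<dots> = h (c \<otimes> r)" using d cc by simp
    finally show ?thesis using True cc d by (intro bexI[of _ "c \<otimes> r"]) auto
  next
    case False
    then obtain z where z: "z \<in> carrier R" "h c \<otimes>\<^sub>S x i = h z" using c(2)[of i] i by auto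
    have "h (c \<otimes> d) \<otimes>\<^sub>S x i = h d \<otimes>\<^sub>S (h c \<otimes>\<^sub>S x i)" using cc Suc.prems i by (simp add: S.m_ac)
    also have "\<dots> = h (d \<otimes> z)" using z cc by simp
    finally show ?thesis using cc z by (intro bexI[of _ "d \<otimes> z"]) auto
  qed
  then show ?case using reg_mult[OF c(1) d(1)] by blast
qed

theorem few_max_if_reductions:
  assumes red: "\<And>I. ideal I R \<Longrightarrow> \<exists>J. reduction R J I \<and> n_generated R n J"
    and f: "inj_on f (normvecs n)" "f ` normvecs n \<subseteq> Max_spec RBr"
  shows False
proof -
  have fM: "maximalideal (f p) RBr" if "p \<in> normvecs n" for p using f(2) that by (auto simp: Max_spec_def)
  have "\<exists>x\<in>RB. \<forall>p\<in>normvecs n. x \<ominus>\<^sub>S h (nvec p i) \<in> f p" if "i < Suc n" for i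
    by (rule exists_prescribed_residues[OF finite_normvecs f(1)]) (use fM nvec_carr that in auto)
  then obtain x where x: "\<And>i. i < Suc n \<Longrightarrow> x i \<in> RB \<and> (\<forall>p\<in>normvecs n. x i \<ominus>\<^sub>S h (nvec p i) \<in> f p)" by metis
  have xc: "x i \<in> carrier S" if "i < Suc n" for i using x[OF that] RB_carr by blast
  obtain c where c: "reg c" "\<And>i. i < Suc n \<Longrightarrow> \<exists>z\<in>carrier R. h c \<otimes>\<^sub>S x i = h z"
    using common_denominator[of "Suc n" x] xc by blast
  obtain z where z: "\<And>i. i < Suc n \<Longrightarrow> z i \<in> carrier R \<and> h c \<otimes>\<^sub>S x i = h (z i)" using c(2) by metis
  \<comment> \<open>Multiplication by \<open>w\<close> undoes the clearing of denominators, turning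
    the generators \<open>z i\<close> of the ideal \<open>I\<close> back into the integral elements
    \<open>x i\<close>.\<close>
  define w where "w = inv\<^bsub>S\<^esub> (h c)"
  have hc: "h c \<in> Units S" "h c \<in> carrier S" using regD[OF c(1)] by auto
  have w: "w \<in> carrier S" "w \<otimes>\<^sub>S h c = \<one>\<^sub>S" using hc by (auto simp: w_def)
  have wz: "w \<otimes>\<^sub>S h (z i) = x i" if "i < Suc n" for i
  proof -
    have "w \<otimes>\<^sub>S h (z i) = (w \<otimes>\<^sub>S h c) \<otimes>\<^sub>S x i" using z[OF that] w(1) hc(2) xc[OF that] by (simp add: S.m_assoc)
    then show ?thesis using w xc[OF that] by simp
  qed
  define I where "I = Idl (z ` {..<Suc n})"
  have zc: "z i \<in> carrier R" if "i < Suc n" for i using z[OF that] by blast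
  have zs: "z ` {..<Suc n} \<subseteq> carrier R" using zc by blast
  have I: "ideal I R" unfolding I_def by (rule R.genideal_ideal[OF zs])
  obtain J where J: "reduction R J I" "n_generated R n J" using red[OF I] by blast
  obtain X where X: "X \<subseteq> carrier R" "finite X" "card X \<le> n" "J = Idl X" using J(2) unfolding n_generated_def by blast
  obtain k where JI: "ideal J R" "J \<subseteq> I" and k: "ideal_pow R I (k + 1) = J \<cdot> ideal_pow R I k"
    using J(1) unfolding reduction_def by blast
  have XI: "X \<subseteq> I" using R.genideal_self[OF X(1)] X(4) JI(2) by blast
  have "\<exists>a. (\<forall>i. a i \<in> carrier R) \<and> s = lin a z (Suc n)" if "s \<in> X" for s
  proof (rule comb_lin[OF zc])
    show "s \<in> R.comb (carrier R) z (Suc n)"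
      using R.genideal_subset_comb[of "Suc n" z] zc XI that unfolding I_def by blast
  qed
  then obtain a where a: "\<And>s. s \<in> X \<Longrightarrow> (\<forall>i. a s i \<in> carrier R) \<and> s = lin (a s) z (Suc n)" by metis
  obtain p where p: "p \<in> normvecs n" "\<And>s. s \<in> X \<Longrightarrow> lin (a s) (nvec p) (Suc n) \<in> m"
    using exists_kernel_normvec[OF X(2,3), of a] a by blast
  define M where "M = f p"
  have M: "maximalideal M RBr" using fM[OF p(1)] by (simp add: M_def)
  have Mc: "M \<subseteq> carrier S" using maxRB_sub[OF M] RB_carr by blast
  \<comment> \<open>Modulo \<open>M\<close> each \<open>x i\<close> equals the coordinate of the
    point \<open>p\<close>, so \<open>w s\<close> is congruent to the linear form of
    \<open>s\<close> evaluated at \<open>p\<close>, which lies in \<open>m\<close> by the choice of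
    \<open>p\<close>.\<close>
  have XM: "w \<otimes>\<^sub>S h s \<in> M" if s: "s \<in> X" for s
  proof -
    have as: "a s i \<in> carrier R" for i using a[OF s] by blast
    have "j \<le> Suc n \<Longrightarrow> w \<otimes>\<^sub>S h (lin (a s) z j) \<ominus>\<^sub>S h (lin (a s) (nvec p) j) \<in> M" for j
    proof (induct j)
      case 0
      then show ?case using maxRB_zero[OF M] w by (simp add: a_minus_def)
    next
      case (Suc j)
      define A B u y v where "A = w \<otimes>\<^sub>S h (lin (a s) z j)" and "B = h (lin (a s) (nvec p) j)"
        and "u = h (a s j)" and "y = x j" and "v = h (nvec p j)"
      have l1: "lin (a s) z j \<in> carrier R" by (rule lin_carr) (use as zc Suc.prems in auto)
      have l2: "lin (a s) (nvec p) j \<in> carrier R" by (rule lin_carr) (use as nvec_carr[OF p(1)] Suc.prems in auto)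
      have cc: "A \<in> carrier S" "B \<in> carrier S" "u \<in> carrier S" "y \<in> carrier S" "v \<in> carrier S"
        using l1 l2 w as xc nvec_carr[OF p(1)] Suc.prems by (auto simp: A_def B_def u_def y_def v_def)
      have AB: "A \<ominus>\<^sub>S B \<in> M" using Suc by (simp add: A_def B_def)
      have yv: "y \<ominus>\<^sub>S v \<in> M" using x[of j] p(1) Suc.prems by (simp add: y_def v_def M_def)
      have uRB: "u \<in> RB" using h_RB as by (simp add: u_def)
      have "(A \<ominus>\<^sub>S B) \<oplus>\<^sub>S u \<otimes>\<^sub>S (y \<ominus>\<^sub>S v) \<in> M" by (rule maxRB_add[OF M AB maxRB_mult[OF M yv uRB]])
      moreover have "(A \<ominus>\<^sub>S B) \<oplus>\<^sub>S u \<otimes>\<^sub>S (y \<ominus>\<^sub>S v) = (A \<oplus>\<^sub>S u \<otimes>\<^sub>S y) \<ominus>\<^sub>S (B \<oplus>\<^sub>S u \<otimes>\<^sub>S v)"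
        using cc by (simp add: S.ring_nf)
      moreover have "w \<otimes>\<^sub>S h (lin (a s) z (Suc j)) = A \<oplus>\<^sub>S u \<otimes>\<^sub>S y"
      proof -
        have zj: "z j \<in> carrier R" using zc Suc.prems by simp
        have "w \<otimes>\<^sub>S h (lin (a s) z (Suc j)) = A \<oplus>\<^sub>S u \<otimes>\<^sub>S (w \<otimes>\<^sub>S h (z j))"
          using l1 w as zj by (simp add: A_def u_def S.r_distr S.m_lcomm)
        then show ?thesis using wz[of j] Suc.prems by (simp add: y_def)
      qed
      moreover have "h (lin (a s) (nvec p) (Suc j)) = B \<oplus>\<^sub>S u \<otimes>\<^sub>S v"
        using l2 as nvec_carr[OF p(1), of j] Suc.prems by (simp add: B_def u_def v_def)
      ultimately show ?case by simp
    qed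
    from this[of "Suc n"] have 1: "w \<otimes>\<^sub>S h s \<ominus>\<^sub>S h (lin (a s) (nvec p) (Suc n)) \<in> M"
      using a[OF s] by simp
    have 2: "h (lin (a s) (nvec p) (Suc n)) \<in> M" by (rule h_m_subset_max[OF M p(2)[OF s]])
    define A B where "A = w \<otimes>\<^sub>S h s" and "B = h (lin (a s) (nvec p) (Suc n))"
    have cc: "A \<in> carrier S" "B \<in> carrier S" using w X(1) s 2 Mc by (auto simp: A_def B_def)
    have "(A \<ominus>\<^sub>S B) \<oplus>\<^sub>S B \<in> M" using maxRB_add[OF M 1 2] unfolding A_def B_def .
    moreover have "(A \<ominus>\<^sub>S B) \<oplus>\<^sub>S B = A" using cc by (simp add: S.ring_nf)
    ultimately show ?thesis by (simp add: A_def)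
  qed
  have idealM: "ideal {r \<in> carrier R. w' \<otimes>\<^sub>S h r \<in> M} R" if "w' \<in> carrier S" for w'
    by (rule scaled_preimage_ideal[OF that]) (use Mc maxRB_zero[OF M] maxRB_add[OF M] maxRB_mult[OF M] h_RB in auto)
  have idealRB: "ideal {r \<in> carrier R. w' \<otimes>\<^sub>S h r \<in> RB} R" if "w' \<in> carrier S" for w'
    by (rule scaled_preimage_ideal[OF that]) (use RB_carr RB_zero RB_add RB_mult h_RB in auto)
  have JM: "w \<otimes>\<^sub>S h r \<in> M" if "r \<in> J" for r
  proof -
    have "Idl X \<subseteq> {r \<in> carrier R. w \<otimes>\<^sub>S h r \<in> M}" by (rule R.genideal_minimal[OF idealM[OF w(1)]]) (use X XM in auto)
    then show ?thesis using that X(4) by blast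
  qed
  have IRB: "w \<otimes>\<^sub>S h r \<in> RB" if "r \<in> I" for r
  proof -
    have "Idl (z ` {..<Suc n}) \<subseteq> {r \<in> carrier R. w \<otimes>\<^sub>S h r \<in> RB}"
    proof (rule R.genideal_minimal[OF idealRB[OF w(1)]])
      show "z ` {..<Suc n} \<subseteq> {r \<in> carrier R. w \<otimes>\<^sub>S h r \<in> RB}"
      proof
        fix r assume "r \<in> z ` {..<Suc n}"
        then obtain i where "i < Suc n" "r = z i" by blast
        then show "r \<in> {r \<in> carrier R. w \<otimes>\<^sub>S h r \<in> RB}" using zc wz x by simp
      qed
    qed
    then show ?thesis using that unfolding I_def by blast
  qed
  have split: "w [^]\<^sub>S Suc j \<otimes>\<^sub>S h (u \<otimes> v) = (w [^]\<^sub>S j \<otimes>\<^sub>S h v) \<otimes>\<^sub>S (w \<otimes>\<^sub>S h u)"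
    if "u \<in> carrier R" "v \<in> carrier R" for u v and j :: nat
    using that w(1) by (simp add: S.m_ac)
  have Ic: "I \<subseteq> carrier R" using R.ideal_sub[OF I] .
  have Ipow: "ideal_pow R I j \<subseteq> {r \<in> carrier R. w [^]\<^sub>S j \<otimes>\<^sub>S h r \<in> RB}" for j
  proof (induct j)
    case 0
    then show ?case using h_RB by auto
  next
    case (Suc j)
    have "I \<cdot> ideal_pow R I j \<subseteq> {r \<in> carrier R. w [^]\<^sub>S Suc j \<otimes>\<^sub>S h r \<in> RB}"
    proof (rule R.ideal_prod_subset[OF idealRB])
      fix u v assume u: "u \<in> I" and v: "v \<in> ideal_pow R I j"
      have vv: "v \<in> carrier R" "w [^]\<^sub>S j \<otimes>\<^sub>S h v \<in> RB" using v Suc by auto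
      have uc: "u \<in> carrier R" using u Ic by blast
      show "u \<otimes> v \<in> {r \<in> carrier R. w [^]\<^sub>S Suc j \<otimes>\<^sub>S h r \<in> RB}"
        using split[OF uc vv(1)] RB_mult[OF vv(2) IRB[OF u]] uc vv(1) by (simp del: S.nat_pow_Suc hom_mult)
    qed (use w in simp)
    then show ?case by simp
  qed
  have prodM: "J \<cdot> ideal_pow R I k \<subseteq> {r \<in> carrier R. w [^]\<^sub>S Suc k \<otimes>\<^sub>S h r \<in> M}"
  proof (rule R.ideal_prod_subset[OF idealM])
    fix u v assume u: "u \<in> J" and v: "v \<in> ideal_pow R I k"
    have vv: "v \<in> carrier R" "w [^]\<^sub>S k \<otimes>\<^sub>S h v \<in> RB" using v Ipow by auto
    have uc: "u \<in> carrier R" using u JI Ic by blast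
    show "u \<otimes> v \<in> {r \<in> carrier R. w [^]\<^sub>S Suc k \<otimes>\<^sub>S h r \<in> M}"
      using split[OF uc vv(1)] maxRB_mult[OF M JM[OF u] vv(2)] uc vv(1) by (simp del: S.nat_pow_Suc hom_mult)
  qed (use w in simp)
  \<comment> \<open>The coordinate of \<open>p\<close> at its pivot is \<open>1\<close>, so
    \<open>x i\<close> is congruent to \<open>1\<close> modulo \<open>M\<close>; the reduction
    equation, however, puts a power of \<open>x i\<close> into \<open>M\<close>.\<close>
  define i where "i = fst p"
  have i: "i < Suc n" using p(1) by (auto simp: i_def normvecs_def)
  have "z i \<in> I" unfolding I_def using R.genideal_self[OF zs] i by blast
  then have "z i [^] (k + 1) \<in> J \<cdot> ideal_pow R I k" using R.ideal_pow_mem[OF I] k by metis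
  then have "w [^]\<^sub>S Suc k \<otimes>\<^sub>S h (z i [^] Suc k) \<in> M" using prodM by auto
  moreover have "w [^]\<^sub>S Suc k \<otimes>\<^sub>S h (z i [^] Suc k) = x i [^]\<^sub>S Suc k"
  proof -
    have "h (z i [^] Suc k) = h (z i) [^]\<^sub>S Suc k" using zc[OF i] by simp
    then have "w [^]\<^sub>S Suc k \<otimes>\<^sub>S h (z i [^] Suc k) = (w \<otimes>\<^sub>S h (z i)) [^]\<^sub>S Suc k"
      using S.nat_pow_distrib[of w "h (z i)" "Suc k"] w(1) zc[OF i] by simp
    then show ?thesis using wz[OF i] by simp
  qed
  ultimately have xM: "x i [^]\<^sub>S Suc k \<in> M" by simp
  have "x i \<in> M" if "x i [^]\<^sub>S (j::nat) \<in> M" for j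
    using that
  proof (induct j)
    case 0
    then show ?case using maxRB_one[OF M] by simp
  next
    case (Suc j)
    then show ?case using maxRB_prime[OF M RB_pow x[OF i, THEN conjunct1], of "x i" j] x[OF i] by auto
  qed
  then have xiM: "x i \<in> M" using xM by blast
  have "x i \<ominus>\<^sub>S h (nvec p i) \<in> M" using x[OF i] p(1) by (simp add: M_def)
  then have "x i \<ominus>\<^sub>S \<one>\<^sub>S \<in> M" by (simp add: nvec_def i_def)
  then have "x i \<ominus>\<^sub>S (x i \<ominus>\<^sub>S \<one>\<^sub>S) \<in> M" using maxRB_minus[OF M xiM] by blast
  moreover have "x i \<ominus>\<^sub>S (x i \<ominus>\<^sub>S \<one>\<^sub>S) = \<one>\<^sub>S"
  proof -
    define y where "y = x i"
    have "y \<in> carrier S" using xc[OF i] by (simp add: y_def)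
    then show ?thesis unfolding y_def[symmetric] by (simp add: S.ring_nf)
  qed
  ultimately show False using maxRB_one[OF M] by simp
qed

end

section \<open>Transfer to the concrete rings and the numerical bound\<close>

text \<open>Connects the inductively generated span with the indexed sum in
  \<open>integral_over\<close>.\<close>

lemma (in frac_setup) span_iff_finsum:
  assumes y: "y \<in> carrier S"
  shows "u \<in> span y t \<longleftrightarrow>
    (\<exists>c. (\<forall>i. c i \<in> carrier R) \<and> u = (\<Oplus>\<^bsub>S\<^esub> i\<in>{..<t}. h (c i) \<otimes>\<^sub>S y [^]\<^sub>S i))"
proof
  assume "u \<in> span y t"
  then show "\<exists>c. (\<forall>i. c i \<in> carrier R) \<and> u = (\<Oplus>\<^bsub>S\<^esub> i\<in>{..<t}. h (c i) \<otimes>\<^sub>S y [^]\<^sub>S i)"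
  proof (induct rule: span.induct)
    case zero
    have "(\<Oplus>\<^bsub>S\<^esub> i\<in>{..<t}. h \<zero> \<otimes>\<^sub>S y [^]\<^sub>S i) = (\<Oplus>\<^bsub>S\<^esub> i\<in>{..<t}. \<zero>\<^sub>S)"
      using y by (intro S.finsum_cong') auto
    then show ?case by (intro exI[of _ "\<lambda>_. \<zero>"]) (auto simp: S.finsum_zero)
  next
    case (gen r j)
    have "(\<Oplus>\<^bsub>S\<^esub> i\<in>{..<t}. h (if j = i then r else \<zero>) \<otimes>\<^sub>S y [^]\<^sub>S i) =
        (\<Oplus>\<^bsub>S\<^esub> i\<in>{..<t}. if j = i then h r \<otimes>\<^sub>S y [^]\<^sub>S i else \<zero>\<^sub>S)"
      using y gen by (intro S.finsum_cong') auto
    also have "\<dots> = h r \<otimes>\<^sub>S y [^]\<^sub>S j"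
      by (rule S.finsum_singleton) (use y gen in auto)
    finally show ?case using gen by (intro exI[of _ "\<lambda>i. if j = i then r else \<zero>"]) auto
  next
    case (add u v)
    then obtain c d where c: "\<forall>i. c i \<in> carrier R" "u = (\<Oplus>\<^bsub>S\<^esub> i\<in>{..<t}. h (c i) \<otimes>\<^sub>S y [^]\<^sub>S i)"
      and d: "\<forall>i. d i \<in> carrier R" "v = (\<Oplus>\<^bsub>S\<^esub> i\<in>{..<t}. h (d i) \<otimes>\<^sub>S y [^]\<^sub>S i)" by blast
    have "(\<Oplus>\<^bsub>S\<^esub> i\<in>{..<t}. h (c i \<oplus> d i) \<otimes>\<^sub>S y [^]\<^sub>S i) =
        (\<Oplus>\<^bsub>S\<^esub> i\<in>{..<t}. h (c i) \<otimes>\<^sub>S y [^]\<^sub>S i \<oplus>\<^sub>S h (d i) \<otimes>\<^sub>S y [^]\<^sub>S i)"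
      using y c d by (intro S.finsum_cong') (auto simp: S.l_distr)
    also have "\<dots> = u \<oplus>\<^sub>S v" unfolding c(2) d(2) by (rule S.finsum_addf) (use y c d in auto)
    finally show ?case using c d by (intro exI[of _ "\<lambda>i. c i \<oplus> d i"]) auto
  qed
next
  assume "\<exists>c. (\<forall>i. c i \<in> carrier R) \<and> u = (\<Oplus>\<^bsub>S\<^esub> i\<in>{..<t}. h (c i) \<otimes>\<^sub>S y [^]\<^sub>S i)"
  then obtain c where c: "\<And>i. c i \<in> carrier R" "u = (\<Oplus>\<^bsub>S\<^esub> i\<in>{..<t}. h (c i) \<otimes>\<^sub>S y [^]\<^sub>S i)" by blast
  have "finite F \<Longrightarrow> F \<subseteq> {..<t} \<Longrightarrow> (\<Oplus>\<^bsub>S\<^esub> i\<in>F. h (c i) \<otimes>\<^sub>S y [^]\<^sub>S i) \<in> span y t" for F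
  proof (induct F rule: finite_induct)
    case empty
    then show ?case by (simp add: span.zero)
  next
    case (insert i F)
    have "(\<Oplus>\<^bsub>S\<^esub> i\<in>insert i F. h (c i) \<otimes>\<^sub>S y [^]\<^sub>S i) = h (c i) \<otimes>\<^sub>S y [^]\<^sub>S i \<oplus>\<^sub>S (\<Oplus>\<^bsub>S\<^esub> i\<in>F. h (c i) \<otimes>\<^sub>S y [^]\<^sub>S i)"
      by (rule S.finsum_insert) (use insert c y in auto)
    then show ?case using insert span.add span.gen[of "c i" i t y] c(1) by auto
  qed
  then show "u \<in> span y t" using c(2) by auto
qed

lemma (in cring) quotient_representatives:
  assumes m: "ideal m R"
  obtains T where "T \<subseteq> carrier R" "card T = card (carrier (R Quot m))"
    "finite (carrier (R Quot m)) \<Longrightarrow> finite T"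
    "\<And>r. r \<in> carrier R \<Longrightarrow> \<exists>\<tau>\<in>T. r \<ominus> \<tau> \<in> m"
    "\<And>\<tau> \<tau>'. \<tau> \<in> T \<Longrightarrow> \<tau>' \<in> T \<Longrightarrow> \<tau> \<noteq> \<tau>' \<Longrightarrow> \<tau> \<ominus> \<tau>' \<notin> m"
proof -
  have car: "carrier (R Quot m) = (\<lambda>x. m +> x) ` carrier R"
    by (auto simp: FactRing_def A_RCOSETS_def')
  define rep where "rep C = (SOME x. x \<in> carrier R \<and> m +> x = C)" for C
  have rep: "rep C \<in> carrier R \<and> m +> rep C = C" if "C \<in> carrier (R Quot m)" for C
  proof -
    have "\<exists>x. x \<in> carrier R \<and> m +> x = C" using that unfolding car by auto
    then show ?thesis unfolding rep_def by (rule someI_ex)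
  qed
  define T where "T = rep ` carrier (R Quot m)"
  have inj: "inj_on rep (carrier (R Quot m))" using rep by (metis inj_onI)
  show thesis
  proof (rule that[of T])
    show "T \<subseteq> carrier R" using rep by (auto simp: T_def)
    show "card T = card (carrier (R Quot m))" unfolding T_def by (rule card_image[OF inj])
    show "finite (carrier (R Quot m)) \<Longrightarrow> finite T" by (simp add: T_def)
  next
    fix r assume r: "r \<in> carrier R"
    have C: "m +> r \<in> carrier (R Quot m)" using car r by blast
    then have "r \<ominus> rep (m +> r) \<in> m" using quotient_eq_iff_same_a_r_cos[OF m r] rep[OF C] by auto
    then show "\<exists>\<tau>\<in>T. r \<ominus> \<tau> \<in> m" using C by (auto simp: T_def)
  next
    fix \<tau> \<tau>' assume "\<tau> \<in> T" "\<tau>' \<in> T" and ne: "\<tau> \<noteq> \<tau>'"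
    then obtain C C' where C: "C \<in> carrier (R Quot m)" "C' \<in> carrier (R Quot m)" "\<tau> = rep C" "\<tau>' = rep C'" by (auto simp: T_def)
    then have "m +> \<tau> = C" "m +> \<tau>' = C'" "\<tau> \<in> carrier R" "\<tau>' \<in> carrier R" using rep by auto
    then show "\<tau> \<ominus> \<tau>' \<notin> m" using quotient_eq_iff_same_a_r_cos[OF m, of \<tau> \<tau>'] C ne by auto
  qed
qed

text \<open>The negated conjunction also covers infinite \<open>B\<close>, for which
  \<open>card B\<close> is \<open>0\<close> by convention and would be misleading alone.\<close>

lemma exists_inj_into:
  assumes "finite A" and "\<not> (finite B \<and> card B < card A)"
  obtains f where "inj_on f A" "f ` A \<subseteq> B"
proof -
  obtain B' where B': "B' \<subseteq> B" "finite B'" "card B' = card A"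
  proof (cases "finite B")
    case True
    then have "card A \<le> card B" using assms(2) by auto
    then show thesis using that obtain_subset_with_card_n[of "card A" B] by metis
  next
    case False
    then show thesis using that infinite_arbitrarily_large[of B "card A"] by blast
  qed
  obtain f where "bij_betw f A B'" using finite_same_card_bij[OF assms(1) B'(2)] B'(3) by metis
  then show thesis using that[of f] B'(1) by (auto simp: bij_betw_def)
qed

text \<open>The fraction equals \<open>1 + q + ... + q^n\<close> minus one, so the weak inequality
  of reals becomes a strict inequality of natural numbers.\<close>

lemma geometric_bound_iff:
  fixes q c n :: nat
  assumes q: "q \<ge> 2"
  shows "real c \<le> (real q ^ (n + 1) - real q) / (real q - 1) \<longleftrightarrow> c < (\<Sum>i\<le>n. q ^ i)"
proof -
  have "real (\<Sum>i\<le>n. q ^ i) = (\<Sum>i<Suc n. real q ^ i)" by (simp add: lessThan_Suc_atMost)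
  also have "\<dots> = (real q ^ Suc n - 1) / (real q - 1)" using q by (intro geometric_sum) auto
  finally have "real (\<Sum>i\<le>n. q ^ i) = (real q ^ (n + 1) - real q) / (real q - 1) + 1"
    using q by (simp add: field_simps)
  then have "(real q ^ (n + 1) - real q) / (real q - 1) = real (\<Sum>i\<le>n. q ^ i) - 1" by simp
  then show ?thesis by linarith
qed

theorem theorem3p1:
  fixes R :: "('a, 'b) ring_scheme" and m :: "'a set" and n :: nat
  assumes "cring R"
    and "noetherian_ring R"
    and "local_ring R"
    and "krull_dim_eq R 1"
    and "maximalideal m R"
    and "finite (carrier (R Quot m))"
    and "n > 0"
  shows "(\<forall>I. ideal I R \<longrightarrow> (\<exists>J. reduction R J I \<and> n_generated R n J)) \<longleftrightarrow>
         (let q = real (card (carrier (R Quot m)));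
              M = Max_spec (integral_closure (reduced_ring R))
          in finite M \<and> real (card M) \<le> (q ^ (n + 1) - q) / (q - 1))"
proof -
  interpret R: cring R by (rule assms(1))
  have mI: "ideal m R" using assms(5) by (rule maximalideal.axioms)
  have muniq: "M = m" if "maximalideal M R" for M
    using assms(3,5) that unfolding local_ring_def by blast
  obtain T where T: "T \<subseteq> carrier R" "card T = card (carrier (R Quot m))" "finite T"
    "\<And>r. r \<in> carrier R \<Longrightarrow> \<exists>\<tau>\<in>T. r \<ominus>\<^bsub>R\<^esub> \<tau> \<in> m"
    "\<And>\<tau> \<tau>'. \<tau> \<in> T \<Longrightarrow> \<tau>' \<in> T \<Longrightarrow> \<tau> \<noteq> \<tau>' \<Longrightarrow> \<tau> \<ominus>\<^bsub>R\<^esub> \<tau>' \<notin> m"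
    using R.quotient_representatives[OF mI] assms(6) by metis
  define N where "N = nilradical R"
  have NI: "ideal N R" unfolding N_def by (rule R.nilradical_ideal)
  define A where "A = reduced_ring R"
  have AQ: "A = R Quot N" by (simp add: A_def reduced_ring_def N_def)
  define \<pi> where "\<pi> = (+>\<^bsub>R\<^esub>) N"
  interpret A: cring A unfolding AQ by (rule ideal.quotient_is_cring[OF NI assms(1)])
  have \<pi>hom: "\<pi> \<in> ring_hom R A" unfolding \<pi>_def AQ by (rule ideal.rcos_ring_hom[OF NI])
  interpret \<pi>: ring_hom_cring R A \<pi>
    by (rule ring_hom_cring.intro[OF assms(1) A.is_cring ring_hom_cring_axioms.intro[OF \<pi>hom]])
  have carA: "\<exists>r\<in>carrier R. a = \<pi> r" if "a \<in> carrier A" for a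
    using that unfolding AQ \<pi>_def by (auto simp: FactRing_def A_RCOSETS_def')
  have \<pi>zero: "\<pi> x = \<zero>\<^bsub>A\<^esub> \<longleftrightarrow> x \<in> N" if x: "x \<in> carrier R" for x
    using R.a_rcos_zero[OF NI, of x] ideal.rcos_const_imp_mem[OF NI x] by (auto simp: AQ \<pi>_def FactRing_def)
  define Q where "Q = total_quotient_ring A"
  interpret Q: cring Q unfolding Q_def by (rule A.tqr_cring)
  define h where "h x = frac_map A (\<pi> x)" for x
  interpret \<iota>: ring_hom_cring A Q "frac_map A"
    unfolding Q_def by (rule ring_hom_cring.intro[OF A.is_cring A.tqr_cring ring_hom_cring_axioms.intro[OF A.frac_map_hom]])
  have hhom: "ring_hom_cring R Q h"
    by (rule ring_hom_cring.intro[OF assms(1) Q.is_cring ring_hom_cring_axioms.intro], rule ring_hom_memI) (auto simp: h_def)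
  have hzero: "h x = \<zero>\<^bsub>Q\<^esub> \<longleftrightarrow> \<pi> x = \<zero>\<^bsub>A\<^esub>" if "x \<in> carrier R" for x
    unfolding h_def Q_def by (rule A.frac_map_zero_iff) (use that in auto)
  interpret F: frac_setup R Q h m T
  proof (intro frac_setup.intro frac_setup_axioms.intro)
    show "ring_hom_cring R Q h" by (rule hhom)
    show "noetherian_ring R" by (rule assms(2))
    show "maximalideal m R" by (rule assms(5))
    show "\<And>M. maximalideal M R \<Longrightarrow> M = m" by (rule muniq)
    show "finite T" "T \<subseteq> carrier R" by (fact T)+
    show "\<And>r. r \<in> carrier R \<Longrightarrow> \<exists>\<tau>\<in>T. r \<ominus>\<^bsub>R\<^esub> \<tau> \<in> m" by (fact T)
    show "\<And>\<tau> \<tau>'. \<tau> \<in> T \<Longrightarrow> \<tau>' \<in> T \<Longrightarrow> \<tau> \<noteq> \<tau>' \<Longrightarrow> \<tau> \<ominus>\<^bsub>R\<^esub> \<tau>' \<notin> m" by (fact T)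
  next
    fix P P' assume P: "primeideal P R" and P': "primeideal P' R" and lt: "P' \<subset> P"
    have PI: "ideal P R" using P by (rule primeideal.axioms)
    have "\<one>\<^bsub>R\<^esub> \<notin> P" using ideal.one_imp_carrier[OF PI] primeideal.I_notcarr[OF P] by blast
    then have Pm: "P \<subseteq> m" using R.exists_maximalideal_supset[OF PI] muniq by blast
    show "P = m"
    proof (rule ccontr)
      assume "P \<noteq> m"
      then have "P \<subset> m" using Pm by blast
      define C where "C i = (if i = 0 then P' else if i = Suc 0 then P else m)" for i :: nat
      have "prime_chain R C (Suc 1)"
        unfolding prime_chain_def C_def using P P' R.maximalideal_prime[OF assms(5)] lt \<open>P \<subset> m\<close>
        by (auto simp: less_Suc_eq)
      then show False using assms(4) unfolding krull_dim_eq_def by blast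
    qed
  next
    fix x assume x: "x \<in> carrier R"
    show "h x = \<zero>\<^bsub>Q\<^esub> \<longleftrightarrow> (\<exists>k::nat. x [^]\<^bsub>R\<^esub> k = \<zero>\<^bsub>R\<^esub>)"
      using hzero[OF x] \<pi>zero[OF x] x by (simp add: N_def nilradical_def)
  next
    fix y assume "y \<in> carrier Q"
    then obtain s a where s: "s \<in> nonzerodivisors A" and a: "a \<in> carrier A" and e: "frac_map A s \<otimes>\<^bsub>Q\<^esub> y = frac_map A a"
      using A.frac_map_denominator unfolding Q_def by blast
    obtain d r where "d \<in> carrier R" "s = \<pi> d" "r \<in> carrier R" "a = \<pi> r" using carA a A.nzd_carr[OF s] by meson
    then show "\<exists>d\<in>carrier R. h d \<in> Units Q \<and> (\<exists>r\<in>carrier R. h d \<otimes>\<^bsub>Q\<^esub> y = h r)"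
      using e A.frac_map_unit[OF s] unfolding h_def Q_def by blast
  next
    fix d assume d: "d \<in> carrier R"
      and z: "\<And>r. r \<in> carrier R \<Longrightarrow> h d \<otimes>\<^bsub>Q\<^esub> h r = \<zero>\<^bsub>Q\<^esub> \<Longrightarrow> h r = \<zero>\<^bsub>Q\<^esub>"
    have "\<pi> d \<in> nonzerodivisors A"
    proof (rule A.nzdI)
      show "\<pi> d \<in> carrier A" using d by simp
      fix a assume a: "a \<in> carrier A" "\<pi> d \<otimes>\<^bsub>A\<^esub> a = \<zero>\<^bsub>A\<^esub>"
      obtain r where r: "r \<in> carrier R" "a = \<pi> r" using carA[OF a(1)] by blast
      have "h d \<otimes>\<^bsub>Q\<^esub> h r = frac_map A (\<pi> d \<otimes>\<^bsub>A\<^esub> a)" using d r by (simp add: h_def)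
      also have "\<dots> = \<zero>\<^bsub>Q\<^esub>" using a(2) by simp
      finally show "a = \<zero>\<^bsub>A\<^esub>" using z[OF r(1)] hzero[OF r(1)] r(2) by simp
    qed
    then show "h d \<in> Units Q" using A.frac_map_unit unfolding h_def Q_def by blast
  qed
  have RB: "F.RB = {x. integral_over A x}"
  proof (rule Set.set_eqI, unfold mem_Collect_eq)
    fix y
    show "y \<in> F.RB \<longleftrightarrow> integral_over A y"
    proof (cases "y \<in> carrier Q")
      case False
      then show ?thesis using F.RB_carr by (auto simp: integral_over_def Q_def)
    next
      case y: True
      have "(\<exists>t\<ge>1. y [^]\<^bsub>Q\<^esub> (t::nat) \<in> F.span y t) \<longleftrightarrow> integral_over A y"
      proof
        assume "\<exists>t\<ge>1. y [^]\<^bsub>Q\<^esub> (t::nat) \<in> F.span y t"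
        then obtain t :: nat where t: "t \<ge> 1" "y [^]\<^bsub>Q\<^esub> t \<in> F.span y t" by blast
        \<comment> \<open>\<open>integral_over\<close> collects all terms on one side, so its
          coefficients are those of the negative of \<open>y^t\<close>.\<close>
        have "\<zero>\<^bsub>Q\<^esub> \<ominus>\<^bsub>Q\<^esub> y [^]\<^bsub>Q\<^esub> t \<in> F.span y t" by (rule F.span_minus[OF y F.span.zero t(2)])
        then obtain c where c: "\<And>i. c i \<in> carrier R"
          and e: "\<zero>\<^bsub>Q\<^esub> \<ominus>\<^bsub>Q\<^esub> y [^]\<^bsub>Q\<^esub> t = (\<Oplus>\<^bsub>Q\<^esub> i\<in>{..<t}. h (c i) \<otimes>\<^bsub>Q\<^esub> y [^]\<^bsub>Q\<^esub> i)"
          using F.span_iff_finsum[OF y] by blast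
        have "y [^]\<^bsub>Q\<^esub> t \<oplus>\<^bsub>Q\<^esub> (\<zero>\<^bsub>Q\<^esub> \<ominus>\<^bsub>Q\<^esub> y [^]\<^bsub>Q\<^esub> t) = \<zero>\<^bsub>Q\<^esub>" using y by (simp add: a_minus_def Q.r_neg)
        then have "y [^]\<^bsub>Q\<^esub> t \<oplus>\<^bsub>Q\<^esub> (\<Oplus>\<^bsub>Q\<^esub> i\<in>{..<t}. frac_map A (\<pi> (c i)) \<otimes>\<^bsub>Q\<^esub> y [^]\<^bsub>Q\<^esub> i) = \<zero>\<^bsub>Q\<^esub>"
          unfolding e h_def .
        moreover have "\<forall>i<t. \<pi> (c i) \<in> carrier A" using c by simp
        ultimately show "integral_over A y"
          using y t(1) unfolding integral_over_def Q_def by (intro conjI exI[of _ t] exI[of _ "\<lambda>i. \<pi> (c i)"]) auto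
      next
        assume "integral_over A y"
        then obtain t :: nat and c where t: "t \<ge> 1" and c: "\<And>i. i < t \<Longrightarrow> c i \<in> carrier A"
          and e: "y [^]\<^bsub>Q\<^esub> t \<oplus>\<^bsub>Q\<^esub> (\<Oplus>\<^bsub>Q\<^esub> i\<in>{..<t}. frac_map A (c i) \<otimes>\<^bsub>Q\<^esub> y [^]\<^bsub>Q\<^esub> i) = \<zero>\<^bsub>Q\<^esub>"
          unfolding integral_over_def Q_def by blast
        \<comment> \<open>The coefficients are lifted along the surjection onto \<open>A\<close>;
          from index \<open>t\<close> on the values in \<open>R\<close> are arbitrary, since the
          span is described with total coefficient functions.\<close>
        have "\<forall>i. \<exists>r. r \<in> carrier R \<and> (i < t \<longrightarrow> c i = \<pi> r)" using carA c by (metis R.zero_closed)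
        then obtain r where r: "\<And>i. r i \<in> carrier R" "\<And>i. i < t \<Longrightarrow> c i = \<pi> (r i)" by metis
        define u where "u = (\<Oplus>\<^bsub>Q\<^esub> i\<in>{..<t}. h (r i) \<otimes>\<^bsub>Q\<^esub> y [^]\<^bsub>Q\<^esub> i)"
        have eq: "(\<Oplus>\<^bsub>Q\<^esub> i\<in>{..<t}. frac_map A (c i) \<otimes>\<^bsub>Q\<^esub> y [^]\<^bsub>Q\<^esub> i) = u"
          unfolding u_def by (rule Q.finsum_cong') (use r y in \<open>auto simp: h_def\<close>)
        have u: "u \<in> F.span y t" using F.span_iff_finsum[OF y] r(1) u_def by blast
        have uc: "u \<in> carrier Q" using F.span_carr[OF y u] .
        define z where "z = y [^]\<^bsub>Q\<^esub> t"
        have zc: "z \<in> carrier Q" using y by (simp add: z_def)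
        have "z = (z \<oplus>\<^bsub>Q\<^esub> u) \<ominus>\<^bsub>Q\<^esub> u" using zc uc by (simp add: Q.ring_nf)
        then have "z = \<zero>\<^bsub>Q\<^esub> \<ominus>\<^bsub>Q\<^esub> u" using e unfolding eq z_def by simp
        then have "y [^]\<^bsub>Q\<^esub> t \<in> F.span y t" using F.span_minus[OF y F.span.zero u] by (simp add: z_def)
        then show "\<exists>t\<ge>1. y [^]\<^bsub>Q\<^esub> (t::nat) \<in> F.span y t" using t by blast
      qed
      then show ?thesis using F.RB_iff_integral[OF y] by blast
    qed
  qed
  have RBr: "integral_closure (reduced_ring R) = Q\<lparr>carrier := F.RB\<rparr>"
    by (simp only: integral_closure_def RB A_def[symmetric] Q_def[symmetric])
  define M where "M = Max_spec (Q\<lparr>carrier := F.RB\<rparr>)"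
  have "(\<forall>I. ideal I R \<longrightarrow> (\<exists>J. reduction R J I \<and> n_generated R n J)) \<longleftrightarrow>
      finite M \<and> card M < card (F.normvecs n)"
  proof
    assume red: "\<forall>I. ideal I R \<longrightarrow> (\<exists>J. reduction R J I \<and> n_generated R n J)"
    show "finite M \<and> card M < card (F.normvecs n)"
    proof (rule ccontr)
      assume "\<not> (finite M \<and> card M < card (F.normvecs n))"
      then obtain f where f: "inj_on f (F.normvecs n)" "f ` F.normvecs n \<subseteq> M"
        using exists_inj_into[OF F.finite_normvecs] by blast
      have red': "\<And>I. ideal I R \<Longrightarrow> \<exists>J. reduction R J I \<and> n_generated R n J" using red by blast
      show False by (rule F.few_max_if_reductions[OF red' f(1) f(2)[unfolded M_def]])
    qed
  next
    assume "finite M \<and> card M < card (F.normvecs n)"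
    then show "\<forall>I. ideal I R \<longrightarrow> (\<exists>J. reduction R J I \<and> n_generated R n J)"
      using F.reductions_if_few_max unfolding M_def by blast
  qed
  then show ?thesis
    using geometric_bound_iff[OF F.card_T, of "card M" n]
    by (simp add: Let_def RBr M_def[symmetric] F.card_normvecs T(2))
qed

end
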